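(* Consider the implicit row-polar implementation of CR-P-LPN applied to $\max\{\boldsymbol c^T\boldsymbol x:A\boldsymbol x\le\mathbf 1\}$, where $A\in\mathbb{R}^{m\times n}$ and $\lVert\boldsymbol c\rVert=1$, and let $\operatorname{nnz}(A)$ be the number of stored nonzeros of $A$. Let $G$ be the number of full-row passes used either to find a violating generator or to verify Wolfe's condition, $H$ the number of affine corral solves, $N_{\rm out}$ the number of completed outer iterations, and $r_h\le n+1$ the number of generators in the $h$-th affine solve. Excluding the initial input read, the implementation uses $$O\left((G+1)(\operatorname{nnz}(A)+m)+\sum_{h=1}^{H}(nr_h^2+r_h^3)+N_{\rm out}n+n^3\right)$$ arithmetic operations and $O(\operatorname{nnz}(A)+m+n^2)$ storage. Full-row passes and affine corral solves performed before any unverified warm exit are included in $G$ and $H$, respectively.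
   Context: Generators: $\boldsymbol v_0:=\boldsymbol 0$ and $\boldsymbol v_i:=\boldsymbol a_i$ (the $i$-th row of $A$, as a column), $i\in\mathcal I:=\{0,\dots,m\}$; $\mathcal Q$ is their convex hull and $V:=[\boldsymbol 0,\boldsymbol a_1,\dots,\boldsymbol a_m]$. CR-P-LPN. Starting from $\rho_0>\max_i\boldsymbol c^T\boldsymbol v_i$, at outer iteration $k$ it projects $\boldsymbol y_k:=\rho_k\boldsymbol c$ onto $\mathcal Q$ by Wolfe's nearest-point algorithm, obtaining the projection $\boldsymbol z_k$, a terminal corral $C_k$ (an affinely independent set of at most $n+1$ generators whose affine minimizer is a strictly positive convex combination) and its weights. It stops if $\boldsymbol z_k=\boldsymbol y_k$ or if $h_k:=\boldsymbol d_k^T\boldsymbol z_k=0$, where $\boldsymbol d_k:=\boldsymbol y_k-\boldsymbol z_k$, recovering a primal--dual solution or recession direction and verifying it by products with $A$ and $A^T$; otherwise $\rho_{k+1}:=h_k/(\boldsymbol d_k^T\boldsymbol c)$. Wolfe alternates insertion of a generator violating $(\boldsymbol y_k-\boldsymbol z)^T(\boldsymbol v_j-\boldsymbol z)\le0$ with affine corral solves that may delete zero-weight generators; the "Wolfe condition" is that no $j\in\mathcal I$ violates this inequality. For $1\le k\le B-1$ ($B\ge1$ a fixed integer reuse limit), Wolfe is started warm from the preceding corral after repair (affine corral solves at the new target followed by minor-step deletion of zero-weight generators until all weights are positive); if the warm computation stops before verification (an unverified warm exit), Wolfe is rerun cold from a single generator, and all later projections start cold. Other projections start cold. An outer iteration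 is completed once the accepted projection is available and the method has stopped or chosen the next target. An affine corral solve with $r$ generators, indexed by $C$, computes $\arg\min_{\mathbf 1^T\boldsymbol\mu=1}\tfrac12\lVert V_C\boldsymbol\mu-\boldsymbol y\rVert^2$ by forming the $r\times r$ Gram matrix $V_C^TV_C$ and solving (or condition-estimating) the associated dense Karush--Kuhn--Tucker system. Implicit implementation. Only $A$ (in sparse form) is stored, not $V$; scores and combinations of all generators are computed by $V\boldsymbol\lambda=A^T\boldsymbol\lambda_{1:m}$, where $\boldsymbol\lambda_{1:m}=(\lambda_1,\dots,\lambda_m)^T$, and $V^T\boldsymbol d=(0,(A\boldsymbol d)^T)^T$. A full-row pass is one evaluation of all generator scores. Only columns of the current corral and its KKT matrix are held explicitly; score, weight and index vectors have length $m+1$ and the remaining work vectors have length $n$. At a finite endpoint an optional polishing step may be performed: for the (at most $n+1$) rows with positive dual weight, if that row submatrix has full column rank, primal and dual candidates are recomputed with dense pseudoinverses of the submatrix and its transpose. *)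

theory Defs
  imports "Jordan_Normal_Form.Matrix" "HOL-Library.Monad_Syntax"
begin

section \<open>Cost model\<close>

text \<open>
  The implementation is written as a program over the exact reals with unit-cost scalar operations.
  A computation records its result, the number of operations it performs (arithmetic, comparisons,
  array writes and loop iterations), the words it leaves allocated, and the largest number of
  words allocated at any time during its execution, both relative to its start.
  Reading an array entry, following a pointer and traversing several arrays in parallel
  or consecutively (\<open>!\<close>, \<open>hd\<close>, \<open>tl\<close>, \<open>take\<close>, \<open>drop\<close>, \<open>zip\<close>, \<open>@\<close> as the range of a loop, the counters
  \<open>[i..<j]\<close>) are addressing and cost nothing by themselves; every traversal is a loop and is charged
  as such. \<open>ret\<close> only names data that are already held.
\<close>

datatype 'a comp = Comp (result: 'a) (ops: nat) (retained: nat) (peak: nat)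

class storable =
  fixes words :: "'a \<Rightarrow> nat"

instantiation bool :: storable
begin
definition words_bool :: "bool \<Rightarrow> nat" where "words_bool b = 1"
instance ..
end

instantiation nat :: storable
begin
definition words_nat :: "nat \<Rightarrow> nat" where "words_nat k = 1"
instance ..
end

instantiation real :: storable
begin
definition words_real :: "real \<Rightarrow> nat" where "words_real x = 1"
instance ..
end

instantiation prod :: (storable, storable) storable
begin
definition words_prod :: "'a \<times> 'b \<Rightarrow> nat" where "words_prod p = words (fst p) + words (snd p)"
instance ..
end

instantiation list :: (storable) storable
begin
definition words_list :: "'a list \<Rightarrow> nat" where "words_list xs = 1 + (\<Sum>x\<leftarrow>xs. words x)"
instance ..
end

instantiation option :: (storable) storable
begin
definition words_option :: "'a option \<Rightarrow> nat" where
  "words_option v = 1 + (case v of None \<Rightarrow> 0 | Some x \<Rightarrow> words x)"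
instance ..
end

definition ret :: "'a \<Rightarrow> 'a comp" where
  "ret x = Comp x 0 0 0"

definition bind_comp :: "'a comp \<Rightarrow> ('a \<Rightarrow> 'b comp) \<Rightarrow> 'b comp" where
  "bind_comp p f = (let q = f (result p) in
     Comp (result q) (ops p + ops q) (retained p + retained q)
       (max (peak p) (retained p + peak q)))"

adhoc_overloading Monad_Syntax.bind \<rightleftharpoons> bind_comp

text \<open>The argument of \<open>flop\<close> and \<open>test\<close> must be one operation on scalars that are already available.\<close>

definition flop :: "real \<Rightarrow> real comp" where
  "flop x = Comp x 1 1 1"

definition test :: "bool \<Rightarrow> bool comp" where
  "test b = Comp b 1 1 1"

definition tick :: "unit comp" where
  "tick = Comp () 1 0 0"

text \<open>In-place writes: \<open>upd\<close> overwrites an entry, \<open>push\<close> and \<open>cons\<close> extend an array.\<close>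

definition upd :: "'a list \<Rightarrow> nat \<Rightarrow> 'a \<Rightarrow> 'a list comp" where
  "upd xs i x = Comp (xs[i := x]) 1 0 0"

definition push :: "'a::storable list \<Rightarrow> 'a \<Rightarrow> 'a list comp" where
  "push xs x = Comp (xs @ [x]) 1 (words x) (words x)"

definition cons :: "'a::storable \<Rightarrow> 'a list \<Rightarrow> 'a list comp" where
  "cons x xs = Comp (x # xs) 1 (words x) (words x)"

text \<open>On return from a procedure only its result stays allocated.\<close>

definition call :: "'a::storable comp \<Rightarrow> 'a comp" where
  "call p = Comp (result p) (ops p) (words (result p)) (max (peak p) (words (result p)))"

text \<open>
  Loops. The loop variable \<open>s\<close> of \<open>foldC\<close> is allocated throughout; everything else
  allocated by an iteration is released at its end.
\<close>

fun mapC :: "('a \<Rightarrow> 'b::storable comp) \<Rightarrow> 'a list \<Rightarrow> 'b list comp" where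
  "mapC f [] = Comp [] 1 1 1"
| "mapC f (x # xs) = do { y \<leftarrow> call (f x); ys \<leftarrow> mapC f xs; Comp (y # ys) 1 0 0 }"

fun foldC :: "('s::storable \<Rightarrow> 'a \<Rightarrow> 's comp) \<Rightarrow> 's \<Rightarrow> 'a list \<Rightarrow> 's comp" where
  "foldC f s [] = Comp s 0 (words s) (words s)"
| "foldC f s (x # xs) =
     (let p = f s x; q = foldC f (result p) xs in
      Comp (result q) (1 + ops p + ops q) (retained q) (max (words s + peak p) (peak q)))"

definition allC :: "('a \<Rightarrow> bool comp) \<Rightarrow> 'a list \<Rightarrow> bool comp" where
  "allC f xs = foldC (\<lambda>b x. do { t \<leftarrow> f x; test (b \<and> t) }) True xs"


section \<open>Dense and sparse linear algebra\<close>

type_synonym dense = "real list"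
type_synonym sparse = "(nat \<times> real) list list"

definition sparse_rows :: "real mat \<Rightarrow> sparse" where
  "sparse_rows A = map (\<lambda>i. map (\<lambda>j. (j, A $$ (i, j))) (filter (\<lambda>j. A $$ (i, j) \<noteq> 0) [0..<dim_col A]))
     [0..<dim_row A]"

definition nnz :: "real mat \<Rightarrow> nat" where
  "nnz A = (\<Sum>row\<leftarrow>sparse_rows A. length row)"

definition zeros :: "nat \<Rightarrow> dense comp" where
  "zeros k = mapC (\<lambda>_. flop 0) [0..<k]"

definition ones :: "nat \<Rightarrow> dense comp" where
  "ones k = mapC (\<lambda>_. flop 1) [0..<k]"

definition vec_add :: "dense \<Rightarrow> dense \<Rightarrow> dense comp" where
  "vec_add u v = mapC (\<lambda>(a, b). flop (a + b)) (zip u v)"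

definition vec_sub :: "dense \<Rightarrow> dense \<Rightarrow> dense comp" where
  "vec_sub u v = mapC (\<lambda>(a, b). flop (a - b)) (zip u v)"

definition scale :: "real \<Rightarrow> dense \<Rightarrow> dense comp" where
  "scale r v = mapC (\<lambda>a. flop (r * a)) v"

definition vec_sum :: "dense \<Rightarrow> real comp" where
  "vec_sum v = foldC (\<lambda>s a. flop (s + a)) 0 v"

definition dot :: "dense \<Rightarrow> dense \<Rightarrow> real comp" where
  "dot u v = foldC (\<lambda>s (a, b). do { p \<leftarrow> flop (a * b); flop (s + p) }) 0 (zip u v)"

definition largest :: "dense \<Rightarrow> real comp" where
  "largest v = foldC (\<lambda>s a. do { t \<leftarrow> test (s < a); ret (if t then a else s) }) (hd v) (tl v)"

definition scatter :: "dense \<Rightarrow> nat list \<Rightarrow> dense \<Rightarrow> dense comp" where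
  "scatter u js ws = foldC (\<lambda>u (j, w). upd u j w) u (zip js ws)"

definition lincomb :: "nat \<Rightarrow> dense list \<Rightarrow> dense \<Rightarrow> dense comp" where
  "lincomb n vs ws = do {
     u \<leftarrow> zeros n;
     foldC (\<lambda>u (v, w). do { t \<leftarrow> scale w v; vec_add u t }) u (zip vs ws) }"

text \<open>Matrices are lists of rows; \<open>mult_trans X Y\<close> is \<open>X Y\<^sup>T\<close>.\<close>

definition mult_trans :: "dense list \<Rightarrow> dense list \<Rightarrow> dense list comp" where
  "mult_trans X Y = mapC (\<lambda>x. mapC (\<lambda>y. dot x y) Y) X"

definition mult_vec :: "dense list \<Rightarrow> dense \<Rightarrow> dense comp" where
  "mult_vec X v = mapC (\<lambda>x. dot x v) X"

definition transp :: "nat \<Rightarrow> dense list \<Rightarrow> dense list comp" where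
  "transp k X = mapC (\<lambda>j. mapC (\<lambda>x. flop (x ! j)) X) [0..<k]"

definition identity :: "nat \<Rightarrow> dense list comp" where
  "identity k = mapC (\<lambda>i. mapC (\<lambda>j. do { t \<leftarrow> test (i = j); flop (if t then 1 else 0) }) [0..<k]) [0..<k]"

text \<open>One column of Gauss-Jordan elimination with partial pivoting; fails if no pivot exists.\<close>

definition pivot_step :: "nat \<Rightarrow> dense list \<Rightarrow> dense list option comp" where
  "pivot_step j X = do {
     p \<leftarrow> foldC (\<lambda>p i. do {
            a \<leftarrow> flop \<bar>X ! i ! j\<bar>; b \<leftarrow> flop \<bar>X ! p ! j\<bar>; t \<leftarrow> test (a > b);
            ret (if t then i else p) }) j [j..<length X];
     singular \<leftarrow> test (X ! p ! j = 0);
     if singular then ret None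
     else do {
       piv \<leftarrow> mapC (\<lambda>a. flop (a / (X ! p ! j))) (X ! p);
       X \<leftarrow> upd X p (X ! j);
       X \<leftarrow> mapC (\<lambda>(i, x). do {
              t \<leftarrow> test (i = j);
              if t then mapC flop piv
              else mapC (\<lambda>(a, b). do { q \<leftarrow> flop (x ! j * b); flop (a - q) }) (zip x piv) })
            (zip [0..<length X] X);
       ret (Some X) } }"

text \<open>\<open>gauss_jordan K R\<close> is the solution \<open>Z\<close> of \<open>K Z = R\<close> for square \<open>K\<close>, and fails if \<open>K\<close> is singular.\<close>

definition gauss_jordan :: "dense list \<Rightarrow> dense list \<Rightarrow> dense list option comp" where
  "gauss_jordan K R = call (do {
     X \<leftarrow> mapC (\<lambda>(k, r). mapC flop (k @ r)) (zip K R);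
     S \<leftarrow> foldC (\<lambda>S j. case S of None \<Rightarrow> ret None | Some X \<Rightarrow> pivot_step j X) (Some X) [0..<length K];
     (case S of
        None \<Rightarrow> ret None
      | Some X \<Rightarrow> do {
          Z \<leftarrow> mapC (\<lambda>x. mapC flop (drop (length K) x)) X;
          ret (Some Z) }) })"

definition inverse_matrix :: "dense list \<Rightarrow> dense list option comp" where
  "inverse_matrix K = call (do { I \<leftarrow> identity (length K); gauss_jordan K I })"

definition row_sum_norm :: "dense list \<Rightarrow> real comp" where
  "row_sum_norm X = foldC (\<lambda>s x. do {
     r \<leftarrow> foldC (\<lambda>s a. do { b \<leftarrow> flop \<bar>a\<bar>; flop (s + b) }) 0 x;
     t \<leftarrow> test (s < r);
     ret (if t then r else s) }) 0 X"

text \<open>Products with the sparsely stored matrix and with its transpose.\<close>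

definition sparse_mult :: "sparse \<Rightarrow> dense \<Rightarrow> dense comp" where
  "sparse_mult S d =
     mapC (\<lambda>row. foldC (\<lambda>s (j, a). do { p \<leftarrow> flop (a * d ! j); flop (s + p) }) 0 row) S"

definition sparse_mult_trans :: "nat \<Rightarrow> sparse \<Rightarrow> dense \<Rightarrow> dense comp" where
  "sparse_mult_trans n S w = do {
     u \<leftarrow> zeros n;
     foldC (\<lambda>u (row, b).
       foldC (\<lambda>u (j, a). do { p \<leftarrow> flop (a * b); q \<leftarrow> flop (u ! j + p); upd u j q }) u row)
       u (zip S w) }"


section \<open>Generators and corrals\<close>

text \<open>
  Generator \<open>0\<close> is the origin and generator \<open>i + 1\<close> is row \<open>i\<close> of the matrix.
  \<open>V = [0, a\<^sub>1, \<dots>, a\<^sub>m]\<close> is never formed.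
\<close>

definition scores :: "sparse \<Rightarrow> dense \<Rightarrow> dense comp" where
  "scores S d = do { s \<leftarrow> sparse_mult S d; cons 0 s }"

definition combine :: "nat \<Rightarrow> sparse \<Rightarrow> dense \<Rightarrow> dense comp" where
  "combine n S lam = sparse_mult_trans n S (tl lam)"

definition generator :: "nat \<Rightarrow> sparse \<Rightarrow> nat \<Rightarrow> dense comp" where
  "generator n S i = do {
     u \<leftarrow> zeros n;
     if i = 0 then ret u else foldC (\<lambda>u (j, a). upd u j a) u (S ! (i - 1)) }"

text \<open>
  With \<open>V\<^sub>C\<close> the matrix whose columns are the corral generators, the affine minimizer for target \<open>y\<close>
  is characterized by \<open>V\<^sub>C\<^sup>T V\<^sub>C \<mu> + \<nu> 1 = V\<^sub>C\<^sup>T y\<close> and \<open>1\<^sup>T \<mu> = 1\<close>.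
\<close>

definition kkt_matrix :: "dense list \<Rightarrow> dense list comp" where
  "kkt_matrix gens = do {
     gram \<leftarrow> mult_trans gens gens;
     K \<leftarrow> mapC (\<lambda>g. push g 1) gram;
     b \<leftarrow> ones (length gens);
     b \<leftarrow> push b 0;
     push K b }"

definition condition_estimate :: "dense list \<Rightarrow> real option comp" where
  "condition_estimate K = call (do {
     Z \<leftarrow> inverse_matrix K;
     (case Z of
        None \<Rightarrow> ret None
      | Some Z \<Rightarrow> do {
          a \<leftarrow> row_sum_norm K; b \<leftarrow> row_sum_norm Z; k \<leftarrow> flop (a * b);
          ret (Some k) }) })"

definition affine_estimate :: "dense list \<Rightarrow> real option comp" where
  "affine_estimate gens = call (do { K \<leftarrow> kkt_matrix gens; condition_estimate K })"

text \<open>The flag selects whether the KKT matrix is also condition-estimated before it is solved.\<close>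

definition affine_solve :: "bool \<Rightarrow> dense list \<Rightarrow> dense \<Rightarrow> dense option comp" where
  "affine_solve est gens y = call (do {
     K \<leftarrow> kkt_matrix gens;
     kappa \<leftarrow> (if est then condition_estimate K else ret None);
     R \<leftarrow> mapC (\<lambda>v. do { p \<leftarrow> dot v y; ret [p] }) gens;
     R \<leftarrow> push R [1];
     Z \<leftarrow> gauss_jordan K R;
     (case Z of
        None \<Rightarrow> ret None
      | Some Z \<Rightarrow> do {
          mu \<leftarrow> mapC (\<lambda>z. flop (z ! 0)) (take (length gens) Z);
          ret (Some mu) }) })"

text \<open>
  One affine solve followed, if some weight of the affine minimizer is not positive, by the minor step
  to the boundary of the corral simplex and the deletion of the zero-weight generators.
  The flag in the result tells whether all weights were positive; then the last component is the
  new affine minimizer.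
\<close>

definition corral_step ::
  "nat \<Rightarrow> bool \<Rightarrow> nat list \<Rightarrow> dense list \<Rightarrow> dense \<Rightarrow> dense \<Rightarrow> dense
     \<Rightarrow> (bool \<times> nat list \<times> dense list \<times> dense \<times> dense) option comp" where
  "corral_step n est C gens wts y z = do {
     r \<leftarrow> affine_solve est gens y;
     (case r of
        None \<Rightarrow> ret None
      | Some mu \<Rightarrow> do {
          pos \<leftarrow> allC (\<lambda>a. test (a > 0)) mu;
          if pos then do {
            z \<leftarrow> lincomb n gens mu;
            ret (Some (True, C, gens, mu, z)) }
          else do {
            theta \<leftarrow> foldC (\<lambda>t (l, a). do {
                nonpos \<leftarrow> test (a \<le> 0);
                if nonpos then do {
                  e \<leftarrow> flop (l - a); q \<leftarrow> flop (l / e); less \<leftarrow> test (q < t);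
                  ret (if less then q else t) }
                else ret t }) 1 (zip wts mu);
            wts \<leftarrow> mapC (\<lambda>(l, a). do {
                e \<leftarrow> flop (a - l); f \<leftarrow> flop (theta * e); flop (l + f) }) (zip wts mu);
            (C, gens, wts) \<leftarrow> foldC (\<lambda>(C', gens', wts') (i, v, l). do {
                zero \<leftarrow> test (l = 0);
                if zero then ret (C', gens', wts')
                else do {
                  C' \<leftarrow> push C' i; gens' \<leftarrow> push gens' v; wts' \<leftarrow> push wts' l;
                  ret (C', gens', wts') } }) ([], [], []) (zip C (zip gens wts));
            ret (Some (False, C, gens, wts, z)) } }) }"

text \<open>A full-row pass returns all generators \<open>j\<close> with \<open>(y - z)\<^sup>T (v\<^sub>j - z) > 0\<close>.\<close>

definition violators :: "sparse \<Rightarrow> dense \<Rightarrow> dense \<Rightarrow> nat list comp" where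
  "violators S y z = call (do {
     d \<leftarrow> vec_sub y z;
     s \<leftarrow> scores S d;
     h \<leftarrow> dot d z;
     foldC (\<lambda>vs (j, a). do {
       e \<leftarrow> flop (a - h); t \<leftarrow> test (e > 0);
       if t then push vs j else ret vs }) [] (zip [0..<length s] s) })"


section \<open>Outer method\<close>

definition initial_target :: "sparse \<Rightarrow> dense \<Rightarrow> real \<Rightarrow> (bool \<times> dense) comp" where
  "initial_target S c r = do {
     s \<leftarrow> scores S c;
     top \<leftarrow> largest s;
     above \<leftarrow> test (r > top);
     y \<leftarrow> scale r c;
     ret (above, y) }"

definition warm_start :: "nat \<Rightarrow> bool \<Rightarrow> nat \<Rightarrow> bool comp" where
  "warm_start B reuse k = do {
     a \<leftarrow> test (1 \<le> k); b \<leftarrow> test (k \<le> B - 1); e \<leftarrow> test (a \<and> b); test (reuse \<and> e) }"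

definition insert_generator ::
  "nat \<Rightarrow> sparse \<Rightarrow> nat \<Rightarrow> nat list \<Rightarrow> dense list \<Rightarrow> dense \<Rightarrow> (nat list \<times> dense list \<times> dense) comp" where
  "insert_generator n S j C gens wts = do {
     v \<leftarrow> generator n S j;
     C \<leftarrow> push C j; gens \<leftarrow> push gens v; wts \<leftarrow> push wts 0;
     ret (C, gens, wts) }"

text \<open>The weights of all generators and the projection, once Wolfe's condition has been verified.\<close>

definition accept :: "nat \<Rightarrow> sparse \<Rightarrow> nat list \<Rightarrow> dense \<Rightarrow> (dense \<times> dense) comp" where
  "accept n S C wts = do {
     u \<leftarrow> zeros (length S + 1);
     lam \<leftarrow> scatter u C wts;
     z \<leftarrow> combine n S lam;
     ret (lam, z) }"

datatype outcome =
    On_target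
  | Zero_value dense
  | Next_target dense real real dense

definition outer_test :: "dense \<Rightarrow> dense \<Rightarrow> dense \<Rightarrow> outcome comp" where
  "outer_test c y z = do {
     same \<leftarrow> allC (\<lambda>(a, b). test (a = b)) (zip y z);
     if same then ret On_target
     else do {
       d \<leftarrow> vec_sub y z;
       h \<leftarrow> dot d z;
       t \<leftarrow> test (h = 0);
       if t then ret (Zero_value d)
       else do {
         e \<leftarrow> dot d c;
         r \<leftarrow> flop (h / e);
         y' \<leftarrow> scale r c;
         ret (Next_target d h r y') } } }"

definition check_optimal :: "sparse \<Rightarrow> dense \<Rightarrow> dense \<Rightarrow> dense \<Rightarrow> bool comp" where
  "check_optimal S c x u = do {
     s \<leftarrow> sparse_mult S x;
     feasible \<leftarrow> allC (\<lambda>a. test (a \<le> 1)) s;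
     nonneg \<leftarrow> allC (\<lambda>a. test (0 \<le> a)) u;
     t \<leftarrow> sparse_mult_trans (length c) S u;
     stationary \<leftarrow> allC (\<lambda>(a, b). test (a = b)) (zip t c);
     p \<leftarrow> dot c x;
     q \<leftarrow> vec_sum u;
     gap \<leftarrow> test (p = q);
     allC ret [feasible, nonneg, stationary, gap] }"

definition check_recession :: "sparse \<Rightarrow> dense \<Rightarrow> dense \<Rightarrow> bool comp" where
  "check_recession S c d = do {
     s \<leftarrow> sparse_mult S d;
     a \<leftarrow> allC (\<lambda>a. test (a \<le> 0)) s;
     p \<leftarrow> dot c d;
     b \<leftarrow> test (p > 0);
     test (a \<and> b) }"

text \<open>
  If \<open>M\<close> is the submatrix of the rows with positive dual weight, it has full column rank iff
  \<open>M\<^sup>T M\<close> is invertible, and then the pseudoinverses of \<open>M\<close> and \<open>M\<^sup>T\<close> are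
  \<open>(M\<^sup>T M)\<^sup>-\<^sup>1 M\<^sup>T\<close> and \<open>M (M\<^sup>T M)\<^sup>-\<^sup>1\<close>. The candidates are their products with \<open>1\<close> and \<open>c\<close>.
\<close>

definition polish :: "sparse \<Rightarrow> dense \<Rightarrow> dense \<Rightarrow> dense \<Rightarrow> bool \<Rightarrow> (dense \<times> dense \<times> bool) comp" where
  "polish S c x u ok = call (do {
     T \<leftarrow> foldC (\<lambda>T (i, a). do { t \<leftarrow> test (a > 0); if t then push T i else ret T }) []
           (zip [0..<length u] u);
     M \<leftarrow> mapC (\<lambda>i. generator (length c) S (i + 1)) T;
     Mt \<leftarrow> transp (length c) M;
     N \<leftarrow> mult_trans Mt Mt;
     Z \<leftarrow> inverse_matrix N;
     (case Z of
        None \<Rightarrow> ret (x, u, ok)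
      | Some Z \<Rightarrow> do {
          P \<leftarrow> mult_trans Z M;
          Zt \<leftarrow> transp (length c) Z;
          Q \<leftarrow> mult_trans M Zt;
          e \<leftarrow> ones (length T);
          x' \<leftarrow> mult_vec P e;
          w \<leftarrow> mult_vec Q c;
          u0 \<leftarrow> zeros (length S);
          u' \<leftarrow> scatter u0 T w;
          ok' \<leftarrow> check_optimal S c x' u';
          ret (if ok' then (x', u', ok') else (x, u, ok)) }) })"

text \<open>
  At a finite endpoint \<open>y = \<rho> c\<close> is the combination of the generators with weights \<open>lam\<close>, so \<open>lam\<close>
  without its entry at the origin, divided by \<open>\<rho>\<close>, is dual feasible; the primal solution is \<open>d / h\<close>
  for the direction \<open>d\<close> and value \<open>h\<close> of the preceding outer iteration, because \<open>\<rho> = h / (d\<^sup>T c)\<close>.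
\<close>

definition recover_finite ::
  "bool \<Rightarrow> sparse \<Rightarrow> dense \<Rightarrow> real \<Rightarrow> dense \<Rightarrow> dense \<Rightarrow> real \<Rightarrow> (dense \<times> dense \<times> bool) comp" where
  "recover_finite pol S c r lam d h = do {
     u \<leftarrow> mapC (\<lambda>a. flop (a / r)) (tl lam);
     x \<leftarrow> mapC (\<lambda>a. flop (a / h)) d;
     ok \<leftarrow> check_optimal S c x u;
     if pol then polish S c x u ok else ret (x, u, ok) }"


section \<open>Executions\<close>

datatype phase = Start | Project | Cold | Major | Affine | Accepted | Finite | Unbounded | Stopped

text \<open>
  \<open>reuse\<close> is cleared by an unverified warm exit; \<open>warm\<close> holds while the current projection
  is computed from the preceding corral; \<open>dir\<close> and \<open>hval\<close> belong to the last outer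
  iteration that did not stop on its target.
\<close>

record state =
  phase :: phase
  iter :: nat
  reuse :: bool
  warm :: bool
  rho :: real
  target :: dense
  point :: dense
  corral :: "nat list"
  gens :: "dense list"
  wts :: dense
  lam :: dense
  dir :: dense
  hval :: real
  primal :: dense
  dual :: dense
  verified :: bool

definition state_words :: "state \<Rightarrow> nat" where
  "state_words s = 7 + words (target s) + words (point s) + words (corral s) + words (gens s)
     + words (wts s) + words (lam s) + words (dir s) + words (primal s) + words (dual s)"

definition input_words :: "sparse \<Rightarrow> dense \<Rightarrow> nat" where
  "input_words S c = 3 + words S + words c"

record config =
  state :: state
  operations :: nat
  storage :: nat
  passes :: nat
  solves :: "nat list"  \<comment> \<open>the number of generators in each affine corral solve\<close>
  outers :: nat

definition initial :: "sparse \<Rightarrow> dense \<Rightarrow> config" where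
  "initial S c =
     (let s = \<lparr>phase = Start, iter = 0, reuse = True, warm = False, rho = 0, target = [], point = [],
               corral = [], gens = [], wts = [], lam = [], dir = [], hval = 1,
               primal = [], dual = [], verified = False\<rparr>
      in \<lparr>state = s, operations = 0, storage = input_words S c + state_words s,
          passes = 0, solves = [], outers = 0\<rparr>)"

definition execute :: "sparse \<Rightarrow> dense \<Rightarrow> 'a comp \<Rightarrow> state \<Rightarrow> config \<Rightarrow> config" where
  "execute S c p s' g = g\<lparr>state := s', operations := operations g + ops p,
     storage := Max {storage g, input_words S c + state_words (state g) + peak p,
                     input_words S c + state_words s'}\<rparr>"

text \<open>
  The choices the method leaves open are nondeterministic: the starting value of \<open>\<rho>\<close>, the single generator
  of a cold start, the violating generator to insert, whether to condition-estimate, when an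
  unverified warm exit occurs, and whether to polish.
  A singular KKT matrix (impossible in exact arithmetic, as corrals are affinely independent) ends a warm
  computation unverified and stops a cold one.
\<close>

inductive step :: "sparse \<Rightarrow> dense \<Rightarrow> nat \<Rightarrow> config \<Rightarrow> config \<Rightarrow> bool" for S c B where
  start:
    "\<lbrakk> s = state g; phase s = Start; p = initial_target S c r; result p = (True, y) \<rbrakk> \<Longrightarrow>
     step S c B g (execute S c p (s\<lparr>phase := Project, rho := r, target := y\<rparr>) g)"
| project:
    "\<lbrakk> s = state g; phase s = Project; p = warm_start B (reuse s) (iter s) \<rbrakk> \<Longrightarrow>
     step S c B g (execute S c p
       (s\<lparr>phase := (if result p then Affine else Cold), warm := result p\<rparr>) g)"
| cold_start:
    "\<lbrakk> s = state g; phase s = Cold; i \<le> length S; p = generator (length c) S i \<rbrakk> \<Longrightarrow>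
     step S c B g (execute S c p
       (s\<lparr>phase := Major, point := result p, corral := [i], gens := [result p], wts := [1]\<rparr>) g)"
| major_insert:
    "\<lbrakk> s = state g; phase s = Major; v = violators S (target s) (point s); j \<in> set (result v);
       p = insert_generator (length c) S j (corral s) (gens s) (wts s); result p = (C', gens', wts') \<rbrakk> \<Longrightarrow>
     step S c B g (execute S c (bind_comp v (\<lambda>_. p))
       (s\<lparr>phase := Affine, corral := C', gens := gens', wts := wts'\<rparr>) (g\<lparr>passes := passes g + 1\<rparr>))"
| major_accept:
    "\<lbrakk> s = state g; phase s = Major; v = violators S (target s) (point s); result v = [];
       p = accept (length c) S (corral s) (wts s); result p = (lam', z') \<rbrakk> \<Longrightarrow>
     step S c B g (execute S c (bind_comp v (\<lambda>_. p))
       (s\<lparr>phase := Accepted, lam := lam', point := z'\<rparr>) (g\<lparr>passes := passes g + 1\<rparr>))"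
| affine:
    "\<lbrakk> s = state g; phase s = Affine;
       p = corral_step (length c) est (corral s) (gens s) (wts s) (target s) (point s);
       result p = Some (fin, C', gens', wts', z') \<rbrakk> \<Longrightarrow>
     step S c B g (execute S c p
       (s\<lparr>phase := (if fin then Major else Affine), corral := C', gens := gens', wts := wts', point := z'\<rparr>)
       (g\<lparr>solves := solves g @ [length (corral s)]\<rparr>))"
| affine_singular:
    "\<lbrakk> s = state g; phase s = Affine;
       p = corral_step (length c) est (corral s) (gens s) (wts s) (target s) (point s);
       result p = None \<rbrakk> \<Longrightarrow>
     step S c B g (execute S c p
       (if warm s then s\<lparr>phase := Cold, warm := False, reuse := False\<rparr> else s\<lparr>phase := Stopped\<rparr>)
       (g\<lparr>solves := solves g @ [length (corral s)]\<rparr>))"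
| warm_exit:
    "\<lbrakk> s = state g; phase s \<in> {Major, Affine}; warm s \<rbrakk> \<Longrightarrow>
     step S c B g (execute S c tick (s\<lparr>phase := Cold, warm := False, reuse := False\<rparr>) g)"
| warm_exit_estimate:
    "\<lbrakk> s = state g; phase s = Affine; warm s; p = affine_estimate (gens s) \<rbrakk> \<Longrightarrow>
     step S c B g (execute S c p (s\<lparr>phase := Cold, warm := False, reuse := False\<rparr>)
       (g\<lparr>solves := solves g @ [length (corral s)]\<rparr>))"
| stop_finite:
    "\<lbrakk> s = state g; phase s = Accepted; p = outer_test c (target s) (point s); result p = On_target \<rbrakk> \<Longrightarrow>
     step S c B g (execute S c p (s\<lparr>phase := Finite\<rparr>) (g\<lparr>outers := outers g + 1\<rparr>))"
| stop_unbounded: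
    "\<lbrakk> s = state g; phase s = Accepted; p = outer_test c (target s) (point s); result p = Zero_value d \<rbrakk> \<Longrightarrow>
     step S c B g (execute S c p (s\<lparr>phase := Unbounded, dir := d, hval := 0\<rparr>)
       (g\<lparr>outers := outers g + 1\<rparr>))"
| next_target:
    "\<lbrakk> s = state g; phase s = Accepted; p = outer_test c (target s) (point s);
       result p = Next_target d h r y \<rbrakk> \<Longrightarrow>
     step S c B g (execute S c p
       (s\<lparr>phase := Project, iter := iter s + 1, rho := r, target := y, dir := d, hval := h\<rparr>)
       (g\<lparr>outers := outers g + 1\<rparr>))"
| finite:
    "\<lbrakk> s = state g; phase s = Finite; p = recover_finite pol S c (rho s) (lam s) (dir s) (hval s);
       result p = (x, u, ok) \<rbrakk> \<Longrightarrow>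
     step S c B g (execute S c p (s\<lparr>phase := Stopped, primal := x, dual := u, verified := ok\<rparr>) g)"
| unbounded:
    "\<lbrakk> s = state g; phase s = Unbounded; p = check_recession S c (dir s) \<rbrakk> \<Longrightarrow>
     step S c B g (execute S c p (s\<lparr>phase := Stopped, verified := result p\<rparr>) g)"

definition execution :: "real mat \<Rightarrow> real vec \<Rightarrow> nat \<Rightarrow> config \<Rightarrow> bool" where
  "execution A c B g \<longleftrightarrow>
     (step (sparse_rows A) (list_of_vec c) B)\<^sup>*\<^sup>* (initial (sparse_rows A) (list_of_vec c)) g"

end

theory Submission
  imports "Jordan_Normal_Form.Determinant" Defs
begin

text \<open>
  The operation count is an amortized bound. Every full-row pass costs \<open>O(nnz A + m + n)\<close>, and the part
  \<open>O(n)\<close> that is not paid by \<open>G\<close> is charged to what led to the pass: either a cold start, of which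
  there is at most one per outer iteration, or a successful affine solve, which has at least one generator and is
  allotted at least \<open>n\<close>. The same potential pays for cold starts, insertions and singular solves.

  The bound \<open>n + 1\<close> on the corral size, on which the storage bound and the cost of polishing rest, needs
  the corrals to be affinely independent. After a successful affine solve with minimizer \<open>z\<close>, the functional
  \<open>y - z\<close> is constant on the corral, whereas an inserted generator violates Wolfe's condition and thus takes
  a larger value.
\<close>

section \<open>Results and costs of computations\<close>

text \<open>An operation count seems to need no numerical correctness, but the corral bound does:
  the functional is constant on the corral only because the elimination really solves the KKT
  system. Gauss-Jordan is therefore verified, in the one direction used here: a returned matrix
  solves the system. Existence of pivots, signs of weights and termination are not claimed. A failed
  solve is a transition with a charge of its own, and the bounds hold at every reachable
  configuration.

  Apart from this, mostly lengths of results are tracked, since data influence the cost through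
  lengths, and these also bound the stored state. The exception is the number of nonzero weights at
  acceptance, which limits the rows used in polishing.

  Additive constants need care: \<open>m\<close> may be zero, so the size of the input cannot absorb
  them. They are charged to \<open>n\<close>, which is positive because the objective has norm one.
  The numerical factors are generous and only have to be consistent with each other.\<close>

lemma result_bind [simp]: "result (bind_comp p f) = result (f (result p))"
  by (simp add: bind_comp_def Let_def)

lemma result_basic [simp]:
  "result (ret x) = x" "result (flop a) = a" "result (test b) = b" "result (upd xs i y) = xs[i := y]"
  "result (push zs z) = zs @ [z]" "result (cons z zs) = z # zs" "result (call p) = result p"
  by (simp_all add: ret_def flop_def test_def upd_def push_def cons_def call_def)

lemma result_mapC [simp]: "result (mapC f xs) = map (\<lambda>x. result (f x)) xs"
  by (induction xs) simp_all

lemma result_foldC [simp]: "result (foldC f s xs) = foldl (\<lambda>s x. result (f s x)) s xs"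
  by (induction xs arbitrary: s) (simp_all add: Let_def)

lemma words_simps [simp]:
  "words (b :: bool) = 1" "words (k :: nat) = 1" "words (a :: real) = 1"
  "words (p :: 'a::storable \<times> 'b::storable) = words (fst p) + words (snd p)"
  "words (None :: 'a option) = 1" "words (Some x :: 'a option) = 1 + words x"
  "words ([] :: 'a list) = 1" "words (x # xs) = words x + words xs"
  "words (xs @ ys) + 1 = words xs + words ys"
  by (simp_all add: words_bool_def words_nat_def words_real_def words_prod_def words_option_def
      words_list_def)

lemma words_nats [simp]: "words (xs :: nat list) = length xs + 1"
  by (induction xs) simp_all

lemma words_reals [simp]: "words (xs :: real list) = length xs + 1"
  by (induction xs) simp_all

lemma words_le: "(\<And>x. x \<in> set xs \<Longrightarrow> words x \<le> w) \<Longrightarrow> words xs \<le> length xs * w + 1"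
proof (induction xs)
  case (Cons a xs)
  have "words a \<le> w" "words xs \<le> length xs * w + 1" using Cons by auto
  then show ?case by simp
qed simp

text \<open>Retained and peak memory share one bound, which makes sequencing additive. This is
  affordable because memory that must not accumulate is released by \<open>call\<close> and by the
  loops, not by sequencing.\<close>

definition cost :: "'a comp \<Rightarrow> nat \<Rightarrow> nat \<Rightarrow> bool" where
  "cost p a w \<longleftrightarrow> ops p \<le> a \<and> retained p \<le> w \<and> peak p \<le> w"

lemma cost_weaken: "cost p a w \<Longrightarrow> a \<le> a' \<Longrightarrow> w \<le> w' \<Longrightarrow> cost p a' w'"
  by (auto simp: cost_def)

text \<open>The continuation is bounded only at the actual result of the first part. This is why
  facts about results enter the cost proofs.\<close>

lemma cost_bind: "cost p a w \<Longrightarrow> cost (f (result p)) a' w' \<Longrightarrow> cost (bind_comp p f) (a + a') (w + w')"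
  by (auto simp: cost_def bind_comp_def Let_def)

lemma cost_basic:
  "cost (ret x) 0 0" "cost (flop a) 1 1" "cost (test b) 1 1" "cost tick 1 0" "cost (upd xs i y) 1 0"
  "cost (push zs z) 1 (words z)" "cost (cons z zs) 1 (words z)"
  by (simp_all add: cost_def ret_def flop_def test_def tick_def upd_def push_def cons_def)

lemma cost_call: "cost p a w \<Longrightarrow> words (result p) \<le> v \<Longrightarrow> cost (call p) a (max w v)"
  by (auto simp: cost_def call_def)

lemma cost_if: "(b \<Longrightarrow> cost p a w) \<Longrightarrow> (\<not> b \<Longrightarrow> cost q a' w') \<Longrightarrow> cost (if b then p else q) (max a a') (max w w')"
  by (auto simp: cost_def)

text \<open>Only the result of a finished iteration survives, so the results add up while the
  working memory \<open>w\<close> of a single iteration is counted once. The operation bound depends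
  on the element, as sparse rows have different lengths.\<close>

lemma cost_mapC:
  assumes "\<And>x. x \<in> set xs \<Longrightarrow> cost (f x) (g x) w" "\<And>x. x \<in> set xs \<Longrightarrow> words (result (f x)) \<le> v"
  shows "cost (mapC f xs) ((\<Sum>x\<leftarrow>xs. 1 + g x) + 1) (length xs * v + max w v + 1)"
  using assms
proof (induction xs)
  case Nil
  then show ?case by (simp add: cost_def)
next
  case (Cons x xs)
  have "cost (f x) (g x) w" "words (result (f x)) \<le> v" using Cons.prems by auto
  moreover have "cost (mapC f xs) ((\<Sum>x\<leftarrow>xs. 1 + g x) + 1) (length xs * v + max w v + 1)"
    using Cons by auto
  ultimately show ?case by (auto simp: cost_def call_def bind_comp_def Let_def)
qed

lemma cost_mapC_const:
  assumes "\<And>x. x \<in> set xs \<Longrightarrow> cost (f x) a w" "\<And>x. x \<in> set xs \<Longrightarrow> words (result (f x)) \<le> v"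
  shows "cost (mapC f xs) (length xs * (1 + a) + 1) (length xs * v + max w v + 1)"
  using cost_mapC[OF assms] by (simp add: sum_list_triv algebra_simps)

text \<open>The invariant \<open>I\<close> keeps the accumulator within \<open>b\<close> words and
  each body is released before the next one starts, so the space does not depend on the number of
  iterations.\<close>

lemma cost_foldC:
  assumes "I s" "\<And>s. I s \<Longrightarrow> words s \<le> b"
    "\<And>s x. I s \<Longrightarrow> x \<in> set xs \<Longrightarrow> cost (f s x) (g x) w"
    "\<And>s x. I s \<Longrightarrow> x \<in> set xs \<Longrightarrow> I (result (f s x))"
  shows "cost (foldC f s xs) (\<Sum>x\<leftarrow>xs. 1 + g x) (b + w)"
  using assms
proof (induction xs arbitrary: s)
  case Nil
  then show ?case by (fastforce simp: cost_def intro: trans_le_add1)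
next
  case (Cons x xs)
  have "cost (f s x) (g x) w" "I (result (f s x))" "words s \<le> b" using Cons.prems by auto
  moreover from this have "cost (foldC f (result (f s x)) xs) (\<Sum>x\<leftarrow>xs. 1 + g x) (b + w)"
    using Cons by auto
  ultimately show ?case by (auto simp: cost_def Let_def)
qed

lemma cost_foldC_const:
  assumes "I s" "\<And>s. I s \<Longrightarrow> words s \<le> b"
    "\<And>s x. I s \<Longrightarrow> x \<in> set xs \<Longrightarrow> cost (f s x) a w"
    "\<And>s x. I s \<Longrightarrow> x \<in> set xs \<Longrightarrow> I (result (f s x))"
  shows "cost (foldC f s xs) (length xs * (1 + a)) (b + w)"
  using cost_foldC[OF assms] by (simp add: sum_list_triv algebra_simps)

lemma cost_mapC_le:
  assumes "length xs \<le> k" "\<And>x. x \<in> set xs \<Longrightarrow> cost (f x) a w" "\<And>x. x \<in> set xs \<Longrightarrow> words (result (f x)) \<le> v"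
  shows "cost (mapC f xs) (k * (1 + a) + 1) (k * v + max w v + 1)"
  by (rule cost_weaken[OF cost_mapC_const[OF assms(2,3)]]) (auto intro: mult_le_mono1 assms(1) simp del: mult_Suc_right)

lemma cost_foldC_le:
  assumes "length xs \<le> k" "I s" "\<And>s. I s \<Longrightarrow> words s \<le> b"
    "\<And>s x. I s \<Longrightarrow> x \<in> set xs \<Longrightarrow> cost (f s x) a w"
    "\<And>s x. I s \<Longrightarrow> x \<in> set xs \<Longrightarrow> I (result (f s x))"
  shows "cost (foldC f s xs) (k * (1 + a)) (b + w)"
  by (rule cost_weaken[OF cost_foldC_const[OF assms(2-5)]]) (auto intro: mult_le_mono1 assms(1) simp del: mult_Suc_right)

lemma comp_simps:
  "ops (bind_comp p f) = ops p + ops (f (result p))"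
  "retained (bind_comp p f) = retained p + retained (f (result p))"
  "peak (bind_comp p f) = max (peak p) (retained p + peak (f (result p)))"
  "ops (ret x) = 0" "retained (ret x) = 0" "peak (ret x) = 0"
  "ops (flop a) = 1" "retained (flop a) = 1" "peak (flop a) = 1"
  "ops (test b) = 1" "retained (test b) = 1" "peak (test b) = 1"
  "ops tick = 1" "retained tick = 0" "peak tick = 0"
  "ops (upd xs i y) = 1" "retained (upd xs i y) = 0" "peak (upd xs i y) = 0"
  "ops (push zs z) = 1" "retained (push zs z) = words z" "peak (push zs z) = words z"
  "ops (cons z zs) = 1" "retained (cons z zs) = words z" "peak (cons z zs) = words z"
  by (simp_all add: ret_def flop_def test_def tick_def upd_def push_def cons_def bind_comp_def Let_def)

section \<open>Values of the dense vector and matrix routines\<close>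

lemma result_zeros [simp]: "result (zeros k) = replicate k 0"
  by (simp add: zeros_def map_replicate_const)

lemma result_ones [simp]: "result (ones k) = replicate k 1"
  by (simp add: ones_def map_replicate_const)

lemma result_vec_add [simp]: "result (vec_add u v) = map2 (+) u v"
  by (simp add: vec_add_def case_prod_unfold)

lemma result_vec_sub [simp]: "result (vec_sub u v) = map2 (-) u v"
  by (simp add: vec_sub_def case_prod_unfold)

lemma result_scale [simp]: "result (scale r v) = map ((*) r) v"
  by (simp add: scale_def)

lemma foldl_add_map: "foldl (\<lambda>s x. s + f x) a xs = a + (\<Sum>x\<leftarrow>xs. f x)" for a :: "'a::comm_monoid_add"
  by (induction xs arbitrary: a) (simp_all add: algebra_simps)

lemma result_dot [simp]: "result (dot u v) = (\<Sum>i<min (length u) (length v). u ! i * v ! i)"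
proof -
  have "result (dot u v) = (\<Sum>x\<leftarrow>zip u v. fst x * snd x)"
    by (simp add: dot_def case_prod_unfold foldl_add_map)
  also have "\<dots> = (\<Sum>i<min (length u) (length v). u ! i * v ! i)"
    by (simp add: sum_list_sum_nth atLeast0LessThan)
  finally show ?thesis .
qed

lemma result_mult_trans [simp]: "result (mult_trans X Y) = map (\<lambda>x. map (\<lambda>y. result (dot x y)) Y) X"
  by (simp add: mult_trans_def)

lemma result_mult_vec [simp]: "result (mult_vec X v) = map (\<lambda>x. result (dot x v)) X"
  by (simp add: mult_vec_def)

lemma result_transp [simp]: "result (transp k X) = map (\<lambda>j. map (\<lambda>x. x ! j) X) [0..<k]"
  by (simp add: transp_def)

lemma result_identity [simp]:
  "result (identity k) = map (\<lambda>i. map (\<lambda>j. if i = j then 1 else 0) [0..<k]) [0..<k]"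
  by (simp add: identity_def)

lemma foldl_list_update_length:
  "length (foldl (\<lambda>u x. u[f x := g u x]) u xs) = length u"
  by (induction xs arbitrary: u) simp_all

lemma result_scatter: "result (scatter u js ws) = foldl (\<lambda>u x. u[fst x := snd x]) u (zip js ws)"
  by (simp add: scatter_def case_prod_unfold)

lemma length_scatter [simp]: "length (result (scatter u js ws)) = length u"
  by (simp add: result_scatter foldl_list_update_length)

lemma length_lincomb:
  assumes "\<And>v. v \<in> set vs \<Longrightarrow> length v = n"
  shows "length (result (lincomb n vs ws)) = n"
proof -
  have "length u = n \<Longrightarrow> (\<And>v. v \<in> set vs \<Longrightarrow> length v = n) \<Longrightarrow>
    length (foldl (\<lambda>u x. map2 (+) u (map ((*) (snd x)) (fst x))) u (zip vs ws)) = n" for u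
  proof (induction vs arbitrary: u ws)
    case (Cons v vs)
    then show ?case by (cases ws) auto
  qed simp
  then show ?thesis using assms by (simp add: lincomb_def case_prod_unfold)
qed

lemma foldl_vec_add_nth:
  assumes "length u = n" "\<And>v. v \<in> set vs \<Longrightarrow> length v = n" "length vs = length ws" "k < n"
  shows "foldl (\<lambda>u x. map2 (+) u (map ((*) (snd x)) (fst x))) u (zip vs ws) ! k
    = u ! k + (\<Sum>i<length vs. ws ! i * vs ! i ! k)"
  using assms
proof (induction vs arbitrary: u ws)
  case (Cons v vs)
  then obtain w ws' where ws: "ws = w # ws'" by (cases ws) auto
  have "foldl (\<lambda>u x. map2 (+) u (map ((*) (snd x)) (fst x))) (map2 (+) u (map ((*) w) v)) (zip vs ws') ! k
    = map2 (+) u (map ((*) w) v) ! k + (\<Sum>i<length vs. ws' ! i * vs ! i ! k)"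
    using Cons ws by (intro Cons.IH) auto
  then show ?case using Cons.prems ws by (simp add: sum.lessThan_Suc_shift add.assoc del: sum.lessThan_Suc)
qed simp

lemma lincomb_nth:
  assumes "\<And>v. v \<in> set vs \<Longrightarrow> length v = n" "length vs = length ws" "k < n"
  shows "result (lincomb n vs ws) ! k = (\<Sum>i<length vs. ws ! i * vs ! i ! k)"
  using foldl_vec_add_nth[of "replicate n 0" n vs ws k] assms by (simp add: lincomb_def case_prod_unfold)

section \<open>Costs of the dense vector and matrix routines\<close>

lemma cost_allC:
  assumes "\<And>x. x \<in> set xs \<Longrightarrow> cost (f x) a w"
  shows "cost (allC f xs) (length xs * (a + 2)) (w + 2)"
proof -
  have "cost (allC f xs) (length xs * (1 + (a + 1))) (1 + (w + 1))"
    unfolding allC_def by (intro cost_foldC_const[where I = "\<lambda>_. True"] cost_bind cost_basic assms) auto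
  then show ?thesis by (elim cost_weaken) auto
qed

lemma cost_zeros: "cost (zeros k) (2 * k + 1) (k + 2)"
  unfolding zeros_def by (rule cost_weaken[OF cost_mapC_const[where a = 1 and w = 1 and v = 1]]) (auto simp: cost_def comp_simps)

lemma cost_ones: "cost (ones k) (2 * k + 1) (k + 2)"
  unfolding ones_def by (rule cost_weaken[OF cost_mapC_const[where a = 1 and w = 1 and v = 1]]) (auto simp: cost_def comp_simps)

lemma cost_vec_add: "length u \<le> n \<Longrightarrow> cost (vec_add u v) (2 * n + 1) (n + 2)"
  unfolding vec_add_def by (rule cost_weaken[OF cost_mapC_const[where a = 1 and w = 1 and v = 1]]) (auto simp: cost_def comp_simps)

lemma cost_vec_sub: "length u \<le> n \<Longrightarrow> cost (vec_sub u v) (2 * n + 1) (n + 2)"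
  unfolding vec_sub_def by (rule cost_weaken[OF cost_mapC_const[where a = 1 and w = 1 and v = 1]]) (auto simp: cost_def comp_simps)

lemma cost_scale: "length v \<le> n \<Longrightarrow> cost (scale r v) (2 * n + 1) (n + 2)"
  unfolding scale_def by (rule cost_weaken[OF cost_mapC_const[where a = 1 and w = 1 and v = 1]]) (auto simp: cost_def comp_simps)

lemma cost_vec_sum: "length v \<le> n \<Longrightarrow> cost (vec_sum v) (2 * n) 2"
  unfolding vec_sum_def
  by (rule cost_weaken[OF cost_foldC_const[where I = "\<lambda>_. True" and b = 1 and a = 1 and w = 1]]) (auto simp: cost_def comp_simps)

lemma cost_dot: "length u \<le> n \<Longrightarrow> cost (dot u v) (3 * n) 3"
  unfolding dot_def
  by (rule cost_weaken[OF cost_foldC_const[where I = "\<lambda>_. True" and b = 1 and a = 2 and w = 2]]) (auto simp: cost_def comp_simps)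

lemma cost_largest: "length v \<le> n \<Longrightarrow> cost (largest v) (2 * n) 2"
  unfolding largest_def
  by (rule cost_weaken[OF cost_foldC_const[where I = "\<lambda>_. True" and b = 1 and a = 1 and w = 1]]) (auto simp: cost_def comp_simps)

lemma cost_scatter: "length js \<le> k \<Longrightarrow> cost (scatter u js ws) (2 * k) (length u + 1)"
  unfolding scatter_def
  by (rule cost_weaken[OF cost_foldC_const[where I = "\<lambda>v. length v = length u" and b = "length u + 1" and a = 1 and w = 0]])
    (auto simp: cost_def comp_simps)

text \<open>The space is free of \<open>r\<close>: a scaled copy and the previous partial sum live
  for one iteration only.\<close>

lemma cost_lincomb:
  assumes "\<And>v. v \<in> set vs \<Longrightarrow> length v = n" "length vs \<le> r"
  shows "cost (lincomb n vs ws) (2 * n + 1 + r * (4 * n + 3)) (4 * n + 7)"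
proof -
  have "cost (foldC (\<lambda>u (v, w). do { t \<leftarrow> scale w v; vec_add u t }) (replicate n 0) (zip vs ws))
     (length (zip vs ws) * (1 + ((2 * n + 1) + (2 * n + 1)))) ((n + 1) + ((n + 2) + (n + 2)))"
  proof (intro cost_foldC_const[where I = "\<lambda>v. length v = n"])
    fix s :: dense and x :: "dense \<times> real" assume *: "length s = n" "x \<in> set (zip vs ws)"
    then have l: "length (fst x) = n" using assms(1) by (cases x) (auto dest: set_zip_leftD)
    show "cost (case x of (v, w) \<Rightarrow> do { t \<leftarrow> scale w v; vec_add s t }) ((2 * n + 1) + (2 * n + 1)) ((n + 2) + (n + 2))"
      unfolding case_prod_unfold using * l by (intro cost_bind cost_scale cost_vec_add) auto
    show "length (result (case x of (v, w) \<Rightarrow> do { t \<leftarrow> scale w v; vec_add s t })) = n"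
      using * l by (simp add: case_prod_unfold)
  qed auto
  moreover have "length (zip vs ws) \<le> r" using assms by simp
  then have "length (zip vs ws) * (1 + ((2 * n + 1) + (2 * n + 1))) \<le> r * (4 * n + 3)"
    by (intro mult_mono) auto
  ultimately have "cost (foldC (\<lambda>u (v, w). do { t \<leftarrow> scale w v; vec_add u t }) (replicate n 0) (zip vs ws))
     (r * (4 * n + 3)) (3 * n + 5)"
    by (elim cost_weaken) auto
  then show ?thesis unfolding lincomb_def
    by (intro cost_weaken[OF cost_bind[OF cost_zeros]]) auto
qed

lemma cost_mult_trans:
  assumes "\<And>x. x \<in> set X \<Longrightarrow> length x \<le> l" "length X \<le> a" "length Y \<le> b"
  shows "cost (mult_trans X Y) (a * (b * (3 * l + 1) + 2) + 1) (a * (b + 1) + b + 5)"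
proof -
  have "cost (mapC (\<lambda>y. dot x y) Y) (b * (3 * l + 1) + 1) (b + 4)" if "x \<in> set X" for x
    using assms that
    by (intro cost_weaken[OF cost_mapC_le[where a = "3 * l" and w = 3 and v = 1 and k = b]] cost_dot) auto
  then have "cost (mult_trans X Y) (a * (1 + (b * (3 * l + 1) + 1)) + 1) (a * (b + 1) + max (b + 4) (b + 1) + 1)"
    unfolding mult_trans_def using assms by (intro cost_mapC_le) auto
  then show ?thesis by (elim cost_weaken) auto
qed

lemma cost_mult_vec:
  assumes "\<And>x. x \<in> set X \<Longrightarrow> length x \<le> l" "length X \<le> a"
  shows "cost (mult_vec X v) (a * (3 * l + 1) + 1) (a + 4)"
  unfolding mult_vec_def using assms
  by (intro cost_weaken[OF cost_mapC_le[where a = "3 * l" and w = 3 and v = 1 and k = a]] cost_dot) auto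

lemma cost_transp:
  assumes "length X \<le> a"
  shows "cost (transp k X) (k * (2 * a + 2) + 1) (k * (a + 1) + a + 3)"
proof -
  have "cost (mapC (\<lambda>x. flop (x ! j)) X) (2 * a + 1) (a + 2)" for j
    using assms by (intro cost_weaken[OF cost_mapC_const[where a = 1 and w = 1 and v = 1]]) (auto simp: cost_def comp_simps)
  then have "cost (transp k X) (length [0..<k] * (1 + (2 * a + 1)) + 1) (length [0..<k] * (a + 1) + max (a + 2) (a + 1) + 1)"
    unfolding transp_def using assms by (intro cost_mapC_const) auto
  then show ?thesis by (elim cost_weaken) auto
qed

lemma cost_identity: "cost (identity k) (k * (3 * k + 2) + 1) (k * (k + 1) + k + 4)"
proof -
  have "cost (mapC (\<lambda>j. do { t \<leftarrow> test (i = j); flop (if t then 1 else 0) }) [0..<k]) (3 * k + 1) (k + 3)" for i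
    by (intro cost_weaken[OF cost_mapC_const[where a = 2 and w = 2 and v = 1]]) (auto simp: cost_def comp_simps)
  then have "cost (identity k) (length [0..<k] * (1 + (3 * k + 1)) + 1) (length [0..<k] * (k + 1) + max (k + 3) (k + 1) + 1)"
    unfolding identity_def by (intro cost_mapC_const) auto
  then show ?thesis by (elim cost_weaken) auto
qed

lemma cost_row_sum_norm:
  assumes "\<And>x. x \<in> set X \<Longrightarrow> length x \<le> l" "length X \<le> a"
  shows "cost (row_sum_norm X) (a * (3 * l + 2)) 5"
proof -
  have "cost (foldC (\<lambda>s a. do { b \<leftarrow> flop \<bar>a\<bar>; flop (s + b) }) 0 x) (3 * l) 3" if "x \<in> set X" for x
    using assms that
    by (intro cost_weaken[OF cost_foldC_le[where I = "\<lambda>_. True" and b = 1 and a = 2 and w = 2 and k = l]])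
       (auto simp: cost_def comp_simps)
  then have "cost (row_sum_norm X) (a * (1 + (3 * l + (1 + 0)))) (1 + (3 + (1 + 0)))"
    unfolding row_sum_norm_def using assms(2)
    by (intro cost_foldC_le[where I = "\<lambda>_. True"] cost_bind cost_basic) auto
  then show ?thesis by (elim cost_weaken) auto
qed

section \<open>Gauss-Jordan elimination\<close>

definition shape :: "nat \<Rightarrow> nat \<Rightarrow> dense list \<Rightarrow> bool" where
  "shape r l X \<longleftrightarrow> length X = r \<and> (\<forall>x\<in>set X. length x = l)"

lemma shapeD:
  "shape r l X \<Longrightarrow> length X = r" "shape r l X \<Longrightarrow> i < r \<Longrightarrow> length (X ! i) = l"
  "shape r l X \<Longrightarrow> x \<in> set X \<Longrightarrow> length x = l"
  by (auto simp: shape_def)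

text \<open>The pivot search inside \<open>pivot_step\<close>, separated so that the chosen row can
  be named.\<close>

definition search :: "nat \<Rightarrow> dense list \<Rightarrow> nat comp" where
  "search j X = foldC (\<lambda>p i. do {
     a \<leftarrow> flop \<bar>X ! i ! j\<bar>; b \<leftarrow> flop \<bar>X ! p ! j\<bar>; t \<leftarrow> test (a > b);
     ret (if t then i else p) }) j [j..<length X]"

text \<open>The lower bound keeps the rows that already carry a pivot out of the search; the unit
  columns survive only because of it.\<close>

lemma search_bounds: "j < length X \<Longrightarrow> j \<le> result (search j X) \<and> result (search j X) < length X"
proof -
  assume "j < length X"
  then have "j \<le> p \<Longrightarrow> p < length X \<Longrightarrow> set is \<subseteq> {j..<length X} \<Longrightarrow>
    j \<le> foldl (\<lambda>p i. if \<bar>X ! p ! j\<bar> < \<bar>X ! i ! j\<bar> then i else p) p is \<and>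
    foldl (\<lambda>p i. if \<bar>X ! p ! j\<bar> < \<bar>X ! i ! j\<bar> then i else p) p is < length X" for p "is"
    by (induction "is" arbitrary: p) auto
  from this[of j "[j..<length X]"] \<open>j < length X\<close> show ?thesis by (simp add: search_def)
qed

lemma cost_search: "length X \<le> r \<Longrightarrow> cost (search j X) (4 * r) 4"
  unfolding search_def
  by (rule cost_weaken[OF cost_foldC_le[where I = "\<lambda>_. True" and b = 1 and a = 3 and w = 3 and k = r]])
    (auto simp: cost_def comp_simps)

definition pivot_row :: "nat \<Rightarrow> dense list \<Rightarrow> dense" where
  "pivot_row j X = map (\<lambda>a. a / X ! result (search j X) ! j) (X ! result (search j X))"

lemma result_pivot_step:
  "result (pivot_step j X) = (if X ! result (search j X) ! j = 0 then None
     else Some (map (\<lambda>(i, x). if i = j then pivot_row j X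
                else map2 (\<lambda>a b. a - x ! j * b) x (pivot_row j X))
       (zip [0..<length X] (X[result (search j X) := X ! j]))))"
  unfolding pivot_step_def search_def[symmetric] pivot_row_def
  by (simp add: case_prod_unfold if_distrib[of result] cong: if_cong)

text \<open>The row exchange is only half explicit: row \<open>j\<close> is copied into place
  \<open>p\<close>, and place \<open>j\<close> is filled afterwards by the normalized pivot row.
  Thus \<open>X[p := X ! j]\<close> holds the rows from which multiples of the pivot row are
  subtracted.\<close>

lemma pivot_step_Some:
  assumes X: "shape r l X" and "j < r" "j < l" and Some: "result (pivot_step j X) = Some X'"
  obtains p where "j \<le> p" "p < r" "X ! p ! j \<noteq> 0" "shape r l X'"
    "\<And>i k. i < r \<Longrightarrow> k < l \<Longrightarrow> X' ! i ! k =
       (if i = j then X ! p ! k / X ! p ! j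
        else X[p := X ! j] ! i ! k - X[p := X ! j] ! i ! j * (X ! p ! k / X ! p ! j))"
proof (rule that[of "result (search j X)"])
  define p where "p = result (search j X)"
  have p: "j \<le> p" "p < r" using search_bounds[of j X] assms by (auto simp: p_def shape_def)
  show "j \<le> result (search j X)" "result (search j X) < r" using p by (auto simp: p_def)
  have X': "X ! p ! j \<noteq> 0" "X' = map (\<lambda>(i, x). if i = j then pivot_row j X
                else map2 (\<lambda>a b. a - x ! j * b) x (pivot_row j X)) (zip [0..<length X] (X[p := X ! j]))"
    using Some unfolding result_pivot_step p_def by (auto split: if_splits)
  show "X ! result (search j X) ! j \<noteq> 0" using X' by (simp add: p_def)
  have row: "pivot_row j X = map (\<lambda>a. a / X ! p ! j) (X ! p)" "length (X ! p) = l"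
    using p shapeD[OF X] by (auto simp: pivot_row_def p_def)
  have upd: "length (X[p := X ! j] ! i) = l" if "i < r" for i
    using that assms shapeD[OF X] by (cases "i = p") auto
  show "shape r l X'"
    unfolding shape_def X'(2) using upd shapeD[OF X] row p by (auto simp: in_set_zip)
  show "X' ! i ! k = (if i = j then X ! result (search j X) ! k / X ! result (search j X) ! j
        else X[result (search j X) := X ! j] ! i ! k - X[result (search j X) := X ! j] ! i ! j
          * (X ! result (search j X) ! k / X ! result (search j X) ! j))"
    if "i < r" "k < l" for i k
    unfolding X'(2) p_def[symmetric] using that upd[of i] shapeD[OF X] row by simp
qed

definition row_value :: "(nat \<Rightarrow> real) \<Rightarrow> nat \<Rightarrow> dense \<Rightarrow> real" where
  "row_value w l x = (\<Sum>k<l. x ! k * w k)"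

definition unit_columns :: "nat \<Rightarrow> dense list \<Rightarrow> bool" where
  "unit_columns t X \<longleftrightarrow> (\<forall>i<length X. \<forall>c<t. X ! i ! c = (if i = c then 1 else 0))"

text \<open>
  Correctness of the elimination is read off kernels: a vector annihilated by the rows after a step is
  annihilated by the rows before it, and for the final tableau \<open>[I | Z]\<close> each column of \<open>Z\<close>
  followed by a negated unit vector is such a vector.
\<close>

lemma pivot_step_kernel:
  assumes X: "shape r l X" and j: "j < r" "j < l" and Some: "result (pivot_step j X) = Some X'"
    and zero: "\<And>i. i < r \<Longrightarrow> row_value w l (X' ! i) = 0" and "i < r"
  shows "row_value w l (X ! i) = 0"
proof -
  obtain p where p: "j \<le> p" "p < r" "X ! p ! j \<noteq> 0"
    and X': "\<And>i k. i < r \<Longrightarrow> k < l \<Longrightarrow> X' ! i ! k =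
       (if i = j then X ! p ! k / X ! p ! j
        else X[p := X ! j] ! i ! k - X[p := X ! j] ! i ! j * (X ! p ! k / X ! p ! j))"
    using pivot_step_Some[OF X j Some] by metis
  have "row_value w l (X' ! j) = row_value w l (X ! p) / X ! p ! j"
    unfolding row_value_def sum_divide_distrib using X'[OF j(1)] by (intro sum.cong) auto
  then have vp: "row_value w l (X ! p) = 0" using zero[OF j(1)] p by simp
  have other: "row_value w l (X[p := X ! j] ! i) = 0" if "i < r" "i \<noteq> j" for i
  proof -
    have "row_value w l (X' ! i) = (\<Sum>k<l. X[p := X ! j] ! i ! k * w k - X[p := X ! j] ! i ! j / X ! p ! j * (X ! p ! k * w k))"
      unfolding row_value_def using X'[OF that(1)] that(2) by (intro sum.cong) (auto simp: left_diff_distrib mult.assoc)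
    also have "\<dots> = row_value w l (X[p := X ! j] ! i) - X[p := X ! j] ! i ! j / X ! p ! j * row_value w l (X ! p)"
      unfolding row_value_def sum_subtractf sum_distrib_left ..
    finally show ?thesis using zero[OF that(1)] vp by simp
  qed
  show ?thesis
  proof (cases "i = p")
    case True
    then show ?thesis using vp by simp
  next
    case False
    show ?thesis
    proof (cases "i = j")
      case True
      \<comment> \<open>After the exchange the old row \<open>j\<close> stands in place
        \<open>p\<close>.\<close>
      then show ?thesis using other[of p] False p shapeD[OF X] by simp
    next
      case False
      then show ?thesis using other[of i] \<open>i \<noteq> p\<close> \<open>i < r\<close> by simp
    qed
  qed
qed

text \<open>In a column \<open>c < j\<close> the pivot row is zero, since it lies at or below row
  \<open>j\<close>, so nothing changes there. In column \<open>j\<close> the pivot row has been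
  scaled to 1 and cancels every other entry.\<close>

lemma pivot_step_unit_columns:
  assumes X: "shape r l X" and j: "j < r" "j < l" and Some: "result (pivot_step j X) = Some X'"
    and unit: "unit_columns j X"
  shows "unit_columns (Suc j) X'"
proof -
  obtain p where p: "j \<le> p" "p < r" "X ! p ! j \<noteq> 0" and sh: "shape r l X'"
    and X': "\<And>i k. i < r \<Longrightarrow> k < l \<Longrightarrow> X' ! i ! k =
       (if i = j then X ! p ! k / X ! p ! j
        else X[p := X ! j] ! i ! k - X[p := X ! j] ! i ! j * (X ! p ! k / X ! p ! j))"
    using pivot_step_Some[OF X j Some] by metis
  have u: "X ! i ! c = (if i = c then 1 else 0)" if "i < r" "c < j" for i c
    using unit that shapeD[OF X] by (auto simp: unit_columns_def)
  have "X' ! i ! c = (if i = c then 1 else 0)" if "i < r" "c < Suc j" for i c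
  proof (cases "c = j")
    case True
    then show ?thesis using X'[of i c] that p j by simp
  next
    case False
    then have "c < j" using that by simp
    moreover have "X[p := X ! j] ! i ! c = (if i = c then 1 else 0)" if "i \<noteq> j"
      using u[of i c] u[of j c] \<open>c < j\<close> \<open>i < r\<close> p j that shapeD[OF X] by (cases "i = p") auto
    ultimately show ?thesis using X'[of i c] u[of p c] that p j by auto
  qed
  then show ?thesis using shapeD[OF sh] by (simp add: unit_columns_def)
qed

text \<open>The kernel inclusions of the single steps compose into one that leads from the last
  tableau back to the first. Failure is absorbing, so a final \<open>Some\<close> means that every
  step found a pivot.\<close>

lemma elimination_invariant:
  assumes X: "shape r l X0" and "r \<le> l" "t \<le> r"
    "foldl (\<lambda>S j. result (case S of None \<Rightarrow> ret None | Some X \<Rightarrow> pivot_step j X)) (Some X0) [0..<t] = Some X"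
  shows "shape r l X \<and> unit_columns t X \<and>
    (\<forall>w. (\<forall>i<r. row_value w l (X ! i) = 0) \<longrightarrow> (\<forall>i<r. row_value w l (X0 ! i) = 0))"
  using assms(3,4)
proof (induction t arbitrary: X)
  case 0
  then show ?case using X by (simp add: unit_columns_def)
next
  case (Suc t)
  define S where "S = foldl (\<lambda>S j. result (case S of None \<Rightarrow> ret None | Some X \<Rightarrow> pivot_step j X)) (Some X0) [0..<t]"
  have *: "result (case S of None \<Rightarrow> ret None | Some X \<Rightarrow> pivot_step t X) = Some X"
    using Suc.prems by (simp add: S_def)
  then obtain Y where Y: "S = Some Y" "result (pivot_step t Y) = Some X" by (cases S) auto
  have IH: "shape r l Y" "unit_columns t Y"
    "\<And>w. (\<forall>i<r. row_value w l (Y ! i) = 0) \<Longrightarrow> (\<forall>i<r. row_value w l (X0 ! i) = 0)"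
    using Suc.IH[of Y] Suc.prems Y by (auto simp: S_def)
  have t: "t < r" "t < l" using Suc.prems \<open>r \<le> l\<close> by auto
  show ?case
    using pivot_step_Some[OF IH(1) t Y(2)] pivot_step_unit_columns[OF IH(1) t Y(2) IH(2)]
      pivot_step_kernel[OF IH(1) t Y(2)] IH(3) by metis
qed

definition augmented :: "dense list \<Rightarrow> dense list \<Rightarrow> dense list" where
  "augmented K R = map2 (@) K R"

lemma augmented_shape: "shape k a K \<Longrightarrow> shape k b R \<Longrightarrow> shape k (a + b) (augmented K R)"
  by (auto simp: shape_def augmented_def in_set_zip)

lemma sum_split_add: "(\<Sum>i<k + l. f i) = (\<Sum>i<k. f i) + (\<Sum>i<l. f (k + i))" for f :: "nat \<Rightarrow> real"
  by (induction l) (simp_all add: algebra_simps)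

definition eliminated :: "dense list \<Rightarrow> dense list \<Rightarrow> dense list option" where
  "eliminated K R = foldl (\<lambda>S j. result (case S of None \<Rightarrow> ret None | Some X \<Rightarrow> pivot_step j X))
     (Some (augmented K R)) [0..<length K]"

lemma result_gauss_jordan:
  "result (gauss_jordan K R) = map_option (map (drop (length K))) (eliminated K R)"
proof -
  have "result (gauss_jordan K R) = result (case eliminated K R of None \<Rightarrow> ret None
      | Some X \<Rightarrow> do { Z \<leftarrow> mapC (\<lambda>x. mapC flop (drop (length K) x)) X; ret (Some Z) })"
    by (simp add: gauss_jordan_def eliminated_def augmented_def case_prod_unfold)
  then show ?thesis by (cases "eliminated K R") auto
qed

lemma gauss_jordan_solves:
  assumes K: "shape k k K" and R: "shape k l R" and Some: "result (gauss_jordan K R) = Some Z"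
  shows "shape k l Z" "\<And>i q. i < k \<Longrightarrow> q < l \<Longrightarrow> (\<Sum>j<k. K ! i ! j * Z ! j ! q) = R ! i ! q"
proof -
  obtain X where X: "eliminated K R = Some X" and Z: "Z = map (drop k) X"
    using Some K by (auto simp: result_gauss_jordan shape_def)
  have inv: "shape k (k + l) X" "unit_columns k X"
    "\<And>w. (\<forall>i<k. row_value w (k + l) (X ! i) = 0) \<Longrightarrow> (\<forall>i<k. row_value w (k + l) (augmented K R ! i) = 0)"
    using elimination_invariant[OF augmented_shape[OF K R], of k X] X shapeD(1)[OF K]
    by (auto simp: eliminated_def)
  show sZ: "shape k l Z" using inv(1) by (auto simp: shape_def Z)
  fix i q assume i: "i < k" and q: "q < l"
  define w where "w = (\<lambda>c. if c < k then Z ! c ! q else if c = k + q then -1 else 0)"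
  have split: "row_value w (k + l) x = (\<Sum>c<k. x ! c * Z ! c ! q) - x ! (k + q)" for x
  proof -
    have "(\<Sum>c<l. x ! (k + c) * w (k + c)) = (\<Sum>c<l. if c = q then - x ! (k + q) else 0)"
      by (intro sum.cong) (auto simp: w_def)
    also have "\<dots> = - x ! (k + q)" using q by simp
    moreover have "(\<Sum>c<k. x ! c * w c) = (\<Sum>c<k. x ! c * Z ! c ! q)"
      by (intro sum.cong) (auto simp: w_def)
    ultimately show ?thesis by (simp add: row_value_def sum_split_add)
  qed
  have "row_value w (k + l) (X ! a) = 0" if a: "a < k" for a
  proof -
    have "(\<Sum>c<k. X ! a ! c * Z ! c ! q) = (\<Sum>c<k. if c = a then Z ! c ! q else 0)"
      using inv(2) a shapeD[OF inv(1)] by (intro sum.cong) (auto simp: unit_columns_def)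
    also have "\<dots> = X ! a ! (k + q)" using a shapeD[OF inv(1)] by (simp add: Z)
    finally show ?thesis by (simp add: split)
  qed
  then have "row_value w (k + l) (augmented K R ! i) = 0" using inv(3) i by blast
  then have "(\<Sum>c<k. augmented K R ! i ! c * Z ! c ! q) = augmented K R ! i ! (k + q)"
    by (simp add: split)
  then show "(\<Sum>j<k. K ! i ! j * Z ! j ! q) = R ! i ! q"
    using i shapeD[OF K] shapeD[OF R] by (simp add: augmented_def nth_append)
qed

lemma cost_pivot_step:
  assumes X: "shape r l X" and j: "j < r" "j < l"
  shows "cost (pivot_step j X) (20 * (r * l)) (20 * (r * l))"
proof -
  define p where "p = result (search j X)"
  have p: "p < r" using search_bounds[of j X] assms by (auto simp: p_def shape_def)
  have c1: "cost (search j X) (4 * r) 4" using cost_search shapeD[OF X] by simp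
  have c2: "cost (mapC (\<lambda>a. flop (a / X ! p ! j)) (X ! p)) (l * (1 + 1) + 1) (l * 1 + max 1 1 + 1)"
    using shapeD[OF X] p by (intro cost_mapC_le) (auto simp: cost_def comp_simps)
  have row_length: "length (X[p := X ! j] ! i) = l" if "i < r" for i
    using that assms shapeD[OF X] by (cases "i = p") auto
  have in_zip: "length (snd z) = l" if "z \<in> set (zip [0..<length X] (X[p := X ! j]))" for z
  proof -
    obtain i where "i < length X" "snd z = X[p := X ! j] ! i" using \<open>z \<in> _\<close> by (auto simp: in_set_zip)
    then show ?thesis using row_length shapeD[OF X] by simp
  qed
  have c3: "cost (mapC (\<lambda>(i, x). do {
              t \<leftarrow> test (i = j);
              if t then mapC flop (map (\<lambda>a. a / X ! p ! j) (X ! p))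
              else mapC (\<lambda>(a, b). do { q \<leftarrow> flop (x ! j * b); flop (a - q) }) (zip x (map (\<lambda>a. a / X ! p ! j) (X ! p))) })
            (zip [0..<length X] (X[p := X ! j])))
       (r * (1 + (1 + max (l * (1 + 1) + 1) (l * (1 + 2) + 1))) + 1)
       (r * (l + 1) + max (1 + max (l * 1 + max 1 1 + 1) (l * 1 + max 2 1 + 1)) (l + 1) + 1)"
    unfolding case_prod_unfold
    using in_zip shapeD[OF X] p
    by (intro cost_mapC_le cost_bind cost_basic cost_if)
      (auto simp: cost_basic if_distrib[of result] cost_def comp_simps)
  have "cost (pivot_step j X) (4 * r + (1 + (l * (1 + 1) + 1 + (1 + (r * (1 + (1 + max (l * (1 + 1) + 1) (l * (1 + 2) + 1))) + 1)))))
     (4 + (1 + (l * 1 + max 1 1 + 1 + (r * (l + 1) + max (1 + max (l * 1 + max 1 1 + 1) (l * 1 + max 2 1 + 1)) (l + 1) + 1))))"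
  proof -
    have else_cost: "cost (do {
       piv \<leftarrow> mapC (\<lambda>a. flop (a / (X ! p ! j))) (X ! p);
       X \<leftarrow> upd X p (X ! j);
       X \<leftarrow> mapC (\<lambda>(i, x). do {
              t \<leftarrow> test (i = j);
              if t then mapC flop piv
              else mapC (\<lambda>(a, b). do { q \<leftarrow> flop (x ! j * b); flop (a - q) }) (zip x piv) })
            (zip [0..<length X] X);
       ret (Some X) }) ((l * (1 + 1) + 1) + (1 + ((r * (1 + (1 + max (l * (1 + 1) + 1) (l * (1 + 2) + 1))) + 1) + 0)))
     ((l * 1 + max 1 1 + 1) + (0 + ((r * (l + 1) + max (1 + max (l * 1 + max 1 1 + 1) (l * 1 + max 2 1 + 1)) (l + 1) + 1) + 0)))"
      by (rule cost_bind[OF c2], rule cost_bind[OF cost_basic(5)], rule cost_bind[OF _ cost_basic(1)])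
        (use c3 in \<open>simp only: result_basic result_mapC length_list_update\<close>)
    show ?thesis
      unfolding pivot_step_def search_def[symmetric]
      by (rule cost_bind[OF c1], rule cost_bind[OF cost_basic(3)], unfold p_def[symmetric] result_basic,
          rule cost_weaken[OF cost_if[OF cost_basic(1) else_cost]]) auto
  qed
  \<comment> \<open>With \<open>r\<close> and \<open>l\<close> written as successors, both sides
    expand into polynomials that can be compared coefficient by coefficient; this is how lower-order
    terms disappear into \<open>r * l\<close>.\<close>
  moreover obtain r' where "r = Suc r'" using j by (cases r) auto
  moreover obtain l' where "l = Suc l'" using j by (cases l) auto
  ultimately show ?thesis by (elim cost_weaken) (simp_all add: algebra_simps)
qed

lemma words_dense_list: "length X \<le> a \<Longrightarrow> (\<And>x. x \<in> set X \<Longrightarrow> length x \<le> l) \<Longrightarrow> words (X :: dense list) \<le> a * (l + 1) + 1"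
  using words_le[of X "l + 1"] mult_le_mono1[of "length X" a "l + 1"] by fastforce

lemma words_shape: "shape r l X \<Longrightarrow> words X \<le> r * (l + 1) + 1"
  by (intro words_dense_list) (auto simp: shape_def)

lemma cost_case_option:
  "(x = None \<Longrightarrow> cost p a w) \<Longrightarrow> (\<And>y. x = Some y \<Longrightarrow> cost (q y) a w) \<Longrightarrow> cost (case x of None \<Rightarrow> p | Some y \<Rightarrow> q y) a w"
  by (cases x) auto

lemma cost_gauss_jordan:
  assumes K: "shape k k K" and R: "shape k l R" and k: "1 \<le> k" "l \<le> k"
  shows "cost (gauss_jordan K R) (100 * (k * k * k)) (100 * (k * k))"
proof -
  have c1: "cost (mapC (\<lambda>(k, r). mapC flop (k @ r)) (zip K R))
      (k * (1 + (2 * k * (1 + 1) + 1)) + 1) (k * (2 * k + 1) + max (2 * k * 1 + max 1 1 + 1) (2 * k + 1) + 1)"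
  proof -
    have "length (fst z) = k" "length (snd z) = l" if "z \<in> set (zip K R)" for z
      using that K R set_zip_leftD[of "fst z" "snd z" K R] set_zip_rightD[of "fst z" "snd z" K R] by (simp_all add: shape_def)
    then show ?thesis unfolding case_prod_unfold using k shapeD(1)[OF K]
      by (intro cost_mapC_le) (auto simp: cost_def comp_simps)
  qed
  have *: "cost (foldC (\<lambda>S j. case S of None \<Rightarrow> ret None | Some X \<Rightarrow> pivot_step j X) (Some (augmented K R)) [0..<length K])
      (k * (1 + 20 * (k * (k + l)))) ((k * (k + l + 1) + 2) + 20 * (k * (k + l)))"
  proof (rule cost_foldC_le[where I = "\<lambda>S. \<forall>X. S = Some X \<longrightarrow> shape k (k + l) X"])
    fix S :: "dense list option" assume "\<forall>X. S = Some X \<longrightarrow> shape k (k + l) X"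
    then show "words S \<le> k * (k + l + 1) + 2"
    proof (cases S)
      case (Some X)
      then have "words X \<le> k * (k + l + 1) + 1" using \<open>\<forall>X. _\<close> words_shape by blast
      then show ?thesis using Some by simp
    qed simp
  next
    fix S j assume S: "\<forall>X. S = Some X \<longrightarrow> shape k (k + l) X" and j: "j \<in> set [0..<length K]"
    then have j: "j < k" "j < k + l" using shapeD[OF K] by auto
    show "cost (case S of None \<Rightarrow> ret None | Some X \<Rightarrow> pivot_step j X) (20 * (k * (k + l))) (20 * (k * (k + l)))"
      using S j by (intro cost_case_option cost_pivot_step cost_weaken[OF cost_basic(1)]) auto
    show "\<forall>X. result (case S of None \<Rightarrow> ret None | Some X \<Rightarrow> pivot_step j X) = Some X \<longrightarrow> shape k (k + l) X"
    proof (intro allI impI)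
      fix X assume X: "result (case S of None \<Rightarrow> ret None | Some X \<Rightarrow> pivot_step j X) = Some X"
      then obtain Y where Y: "S = Some Y" "result (pivot_step j Y) = Some X" by (cases S) auto
      then have Y_shape: "shape k (k + l) Y" using S by simp
      show "shape k (k + l) X" by (rule pivot_step_Some[OF Y_shape j Y(2)])
    qed
  qed (use augmented_shape[OF K R] shapeD(1)[OF K] in simp_all)
  have kl: "k * (k + l) \<le> k * (2 * k)" using k by simp
  have c2: "cost (foldC (\<lambda>S j. case S of None \<Rightarrow> ret None | Some X \<Rightarrow> pivot_step j X) (Some (augmented K R)) [0..<length K])
      (k * (1 + 20 * (k * (2 * k)))) (k * (2 * k) + k + 2 + 20 * (k * (2 * k)))"
    by (rule cost_weaken[OF *]) (use kl in \<open>auto simp: distrib_left intro: add_mono\<close>)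
  have sX: "shape k (k + l) X" if "eliminated K R = Some X" for X
    using elimination_invariant[OF augmented_shape[OF K R], of k X] that shapeD(1)[OF K]
    by (auto simp: eliminated_def)
  have c3: "cost (case eliminated K R of None \<Rightarrow> ret None
      | Some X \<Rightarrow> do { Z \<leftarrow> mapC (\<lambda>x. mapC flop (drop (length K) x)) X; ret (Some Z) })
    ((k * (1 + (k * (1 + 1) + 1)) + 1) + 0) ((k * (k + 1) + max (k * 1 + max 1 1 + 1) (k + 1) + 1) + 0)"
  proof (intro cost_case_option cost_weaken[OF cost_basic(1)] cost_bind cost_mapC_le cost_basic)
    fix X x assume "eliminated K R = Some X" "x \<in> set X"
    then have "length (drop (length K) x) \<le> k" using sX[of X] k shapeD(1)[OF K] shapeD(3)[of k "k + l" X x] by simp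
    then show "length (drop (length K) x) \<le> k" "words (result (mapC flop (drop (length K) x))) \<le> k + 1" by auto
  qed (use sX shapeD(1) in auto)
  have r1: "result (mapC (\<lambda>(k, r). mapC flop (k @ r)) (zip K R)) = augmented K R"
    by (simp add: augmented_def case_prod_unfold)
  have r2: "result (foldC (\<lambda>S j. case S of None \<Rightarrow> ret None | Some X \<Rightarrow> pivot_step j X) (Some (augmented K R)) [0..<length K])
      = eliminated K R"
    by (simp add: eliminated_def)
  have w: "words (result (gauss_jordan K R)) \<le> k * (k + 1) + 2"
  proof (cases "result (gauss_jordan K R)")
    case (Some Z)
    moreover have "k * (l + 1) \<le> k * (k + 1)" using mult_le_mono2[OF k(2), of k] unfolding distrib_left by linarith
    ultimately show ?thesis using words_shape[OF gauss_jordan_solves(1)[OF K R Some]] unfolding Some words_simps by linarith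
  qed simp
  obtain k' where k': "k = Suc k'" using k by (cases k) auto
  have "cost (gauss_jordan K R)
     ((k * (1 + (2 * k * (1 + 1) + 1)) + 1) + ((k * (1 + 20 * (k * (2 * k)))) + ((k * (1 + (k * (1 + 1) + 1)) + 1) + 0)))
     (max ((k * (2 * k + 1) + max (2 * k * 1 + max 1 1 + 1) (2 * k + 1) + 1) + ((k * (2 * k) + k + 2 + 20 * (k * (2 * k)))
         + ((k * (k + 1) + max (k * 1 + max 1 1 + 1) (k + 1) + 1) + 0))) (k * (k + 1) + 2))"
    unfolding gauss_jordan_def
  proof (rule cost_call, rule cost_bind[OF c1], rule cost_bind)
    show "words (result (do {
     X \<leftarrow> mapC (\<lambda>(k, r). mapC flop (k @ r)) (zip K R);
     S \<leftarrow> foldC (\<lambda>S j. case S of None \<Rightarrow> ret None | Some X \<Rightarrow> pivot_step j X) (Some X) [0..<length K];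
     (case S of
        None \<Rightarrow> ret None
      | Some X \<Rightarrow> do {
          Z \<leftarrow> mapC (\<lambda>x. mapC flop (drop (length K) x)) X;
          ret (Some Z) }) })) \<le> k * (k + 1) + 2"
      using w unfolding gauss_jordan_def result_basic .
  qed (unfold r1, rule c2, unfold r2, rule c3)
  then show ?thesis
    by (rule cost_weaken) (use k' in \<open>simp_all add: algebra_simps\<close>)
qed

section \<open>Inverse and condition estimate\<close>

lemma identity_shape: "shape k k (result (identity k))"
  by (auto simp: shape_def)

lemma result_inverse_matrix: "result (inverse_matrix K) = result (gauss_jordan K (result (identity (length K))))"
  by (simp add: inverse_matrix_def)

lemma inverse_matrix_shape: "shape k k K \<Longrightarrow> result (inverse_matrix K) = Some Z \<Longrightarrow> shape k k Z"
  unfolding result_inverse_matrix using gauss_jordan_solves(1) identity_shape shapeD(1) by metis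

lemma cost_inverse_matrix:
  assumes K: "shape k k K" and k: "1 \<le> k"
  shows "cost (inverse_matrix K) (110 * (k * k * k)) (110 * (k * k))"
proof -
  have w: "words (result (inverse_matrix K)) \<le> k * (k + 1) + 2"
  proof (cases "result (inverse_matrix K)")
    case (Some Z)
    then show ?thesis using words_shape[OF inverse_matrix_shape[OF K Some]] by simp
  qed simp
  have c: "cost (gauss_jordan K (result (identity (length K)))) (100 * (k * k * k)) (100 * (k * k))"
    using cost_gauss_jordan[OF K _ k order_refl] identity_shape shapeD(1)[OF K] by simp
  have "cost (inverse_matrix K) ((k * (3 * k + 2) + 1) + 100 * (k * k * k))
     (max ((k * (k + 1) + k + 4) + 100 * (k * k)) (k * (k + 1) + 2))"
    unfolding inverse_matrix_def
    using w cost_identity[of k] shapeD(1)[OF K] c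
    by (intro cost_call cost_bind) (auto simp: inverse_matrix_def)
  moreover obtain k' where "k = Suc k'" using k by (cases k) auto
  ultimately show ?thesis by (elim cost_weaken) (simp_all add: algebra_simps)
qed

lemma cost_condition_estimate:
  assumes K: "shape k k K" and k: "1 \<le> k"
  shows "cost (condition_estimate K) (130 * (k * k * k)) (130 * (k * k))"
proof -
  have "cost (case result (inverse_matrix K) of
        None \<Rightarrow> ret None
      | Some Z \<Rightarrow> do {
          a \<leftarrow> row_sum_norm K; b \<leftarrow> row_sum_norm Z; k \<leftarrow> flop (a * b);
          ret (Some k) }) (k * (3 * k + 2) + (k * (3 * k + 2) + (1 + 0))) (5 + (5 + (1 + 0)))"
    using shapeD(1,3)[OF K] shapeD(1,3)[OF inverse_matrix_shape[OF K]]
    by (intro cost_case_option cost_weaken[OF cost_basic(1)] cost_bind cost_row_sum_norm cost_basic) auto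
  note c = this
  have "cost (condition_estimate K) (110 * (k * k * k) + (k * (3 * k + 2) + (k * (3 * k + 2) + (1 + 0))))
    (max (110 * (k * k) + (5 + (5 + (1 + 0)))) 2)"
    unfolding condition_estimate_def
    by (rule cost_call, rule cost_bind[OF cost_inverse_matrix[OF K k]], rule c) (auto split: option.splits)
  moreover obtain k' where "k = Suc k'" using k by (cases k) auto
  ultimately show ?thesis by (elim cost_weaken) (simp_all add: algebra_simps)
qed

section \<open>Affine independence and affine minimizers\<close>

definition inner :: "nat \<Rightarrow> dense \<Rightarrow> dense \<Rightarrow> real" where
  "inner n u v = (\<Sum>k<n. u ! k * v ! k)"

text \<open>A property of a set of points, so that inserting and deleting generators become
  \<open>insert\<close> and passing to a subset. Repetitions in the list of generators are excluded
  separately.\<close>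

definition aff_indep :: "nat \<Rightarrow> dense set \<Rightarrow> bool" where
  "aff_indep n F \<longleftrightarrow> finite F \<and> (\<forall>c. (\<forall>k<n. (\<Sum>v\<in>F. c v * v ! k) = 0) \<and> (\<Sum>v\<in>F. c v) = 0 \<longrightarrow> (\<forall>v\<in>F. c v = 0))"

lemma aff_indepD:
  "aff_indep n F \<Longrightarrow> (\<And>k. k < n \<Longrightarrow> (\<Sum>v\<in>F. c v * v ! k) = 0) \<Longrightarrow> (\<Sum>v\<in>F. c v) = 0 \<Longrightarrow> v \<in> F \<Longrightarrow> c v = 0"
  unfolding aff_indep_def by blast

lemma aff_indep_singleton: "aff_indep n {v}"
  by (simp add: aff_indep_def)

text \<open>A dependency on the subset is extended by zero coefficients.\<close>

lemma aff_indep_subset: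
  assumes F: "aff_indep n F" and "E \<subseteq> F"
  shows "aff_indep n E"
  unfolding aff_indep_def
proof (intro conjI allI impI ballI)
  have fin: "finite F" using F by (simp add: aff_indep_def)
  then show "finite E" using \<open>E \<subseteq> F\<close> finite_subset by blast
  fix c v assume c: "(\<forall>k<n. (\<Sum>v\<in>E. c v * v ! k) = 0) \<and> (\<Sum>v\<in>E. c v) = 0" and v: "v \<in> E"
  have E: "(\<Sum>v\<in>F. (if v \<in> E then c v else 0) * g v) = (\<Sum>v\<in>E. c v * g v)" for g :: "dense \<Rightarrow> real"
    using fin \<open>E \<subseteq> F\<close> by (intro sum.mono_neutral_cong_right) auto
  have "(if v \<in> E then c v else 0) = 0"
    using c E E[of "\<lambda>_. 1"] v \<open>E \<subseteq> F\<close> by (intro aff_indepD[OF F, where c = "\<lambda>v. if v \<in> E then c v else 0"]) auto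
  then show "c v = 0" using v by simp
qed

text \<open>Apply the functional \<open>d\<close> to a dependency. As the coefficients sum to zero,
  what remains is \<open>c v * (inner n d v - h) = 0\<close>. So the new coefficient vanishes and
  the rest is a dependency on \<open>F\<close>.\<close>

lemma aff_indep_insert:
  assumes F: "aff_indep n F" and h: "\<And>u. u \<in> F \<Longrightarrow> inner n d u = h" and v: "inner n d v \<noteq> h"
  shows "aff_indep n (insert v F)"
  unfolding aff_indep_def
proof (intro conjI allI impI ballI)
  have fin: "finite F" and nv: "v \<notin> F" using F h v by (auto simp: aff_indep_def)
  then show "finite (insert v F)" by simp
  fix c u assume c: "(\<forall>k<n. (\<Sum>v\<in>insert v F. c v * v ! k) = 0) \<and> (\<Sum>v\<in>insert v F. c v) = 0" and u: "u \<in> insert v F"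
  have "0 = (\<Sum>k<n. d ! k * (\<Sum>u\<in>insert v F. c u * u ! k))" using c by simp
  also have "\<dots> = (\<Sum>u\<in>insert v F. c u * inner n d u)"
    unfolding sum_distrib_left inner_def by (subst sum.swap) (simp add: algebra_simps)
  also have "\<dots> = c v * inner n d v + (\<Sum>u\<in>F. c u * h)" using fin nv h by simp
  also have "(\<Sum>u\<in>F. c u * h) = - c v * h" using c fin nv by (simp add: sum_distrib_right[symmetric] add_eq_0_iff)
  finally have "c v * (inner n d v - h) = 0" by (simp add: right_diff_distrib)
  then have cv: "c v = 0" using v by auto
  moreover have "c u = 0" if "u \<in> F" for u
    using c fin nv cv that by (intro aff_indepD[OF F, where c = c]) auto
  ultimately show "c u = 0" using u by auto
qed

text \<open>With more than \<open>n + 1\<close> points, the homogeneous system for an affine dependency, padded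
  with zero equations to a square one, is singular.\<close>

lemma aff_indep_card:
  assumes F: "aff_indep n F"
  shows "card F \<le> n + 1"
proof (rule ccontr)
  assume "\<not> card F \<le> n + 1"
  then have N: "n + 1 < card F" by simp
  define N where "N = card F"
  have fin: "finite F" using F by (simp add: aff_indep_def)
  obtain b where b: "bij_betw b {0..<N} F" using ex_bij_betw_nat_finite[OF fin] N_def by auto
  define A where "A = mat N N (\<lambda>(k, i). if k < n then b i ! k else if k = n then 1 else (0 :: real))"
  have A: "A \<in> carrier_mat N N" by (simp add: A_def)
  \<comment> \<open>Row \<open>N - 1\<close> is one of the zero equations: \<open>n + 1 < N\<close>
    places it strictly after row \<open>n\<close>, which holds the condition on the sum.\<close>
  have "A = mat\<^sub>r N N (\<lambda>k. if k = N - 1 then 0\<^sub>v N else row A k)"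
    using N by (intro eq_matI) (auto simp: A_def N_def)
  then have "det A = 0"
    using N det_row_0[of "N - 1" N "row A"] A by (auto simp: N_def)
  then obtain v where v: "v \<in> carrier_vec N" "v \<noteq> 0\<^sub>v N" "A *\<^sub>v v = 0\<^sub>v N"
    using det_0_iff_vec_prod_zero_field[OF A] by auto
  define c where "c = (\<lambda>u. v $ (inv_into {0..<N} b u))"
  have c: "c (b i) = v $ i" if "i < N" for i
    using b that by (simp add: c_def bij_betw_inv_into_left)
  have sum: "(\<Sum>u\<in>F. c u * g u) = (\<Sum>i<N. v $ i * g (b i))" for g :: "dense \<Rightarrow> real"
    using sum.reindex_bij_betw[OF b, of "\<lambda>u. c u * g u"] c by (simp add: lessThan_atLeast0)
  have row: "(\<Sum>i<N. A $$ (k, i) * v $ i) = 0" if "k < N" for k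
  proof -
    have "(A *\<^sub>v v) $ k = 0" using v that by simp
    then show ?thesis using that A v(1) by (simp add: mult_mat_vec_def scalar_prod_def lessThan_atLeast0)
  qed
  have "c u = 0" if "u \<in> F" for u
  proof (rule aff_indepD[OF F _ _ that])
    show "(\<Sum>v\<in>F. c v * v ! k) = 0" if "k < n" for k
      using row[of k] that N by (simp add: sum A_def N_def mult.commute)
    show "(\<Sum>v\<in>F. c v) = 0"
      using row[of n] N sum[of "\<lambda>_. 1"] by (simp add: A_def N_def)
  qed
  then have "v $ i = 0" if "i < N" for i
    using c[OF that] bij_betwE[OF b] that by simp
  then have "v = 0\<^sub>v N" using v(1) by auto
  then show False using v(2) by simp
qed

text \<open>For loops that grow their accumulator by \<open>push\<close>: no fixed size bound is
  preserved by the body, but one indexed by the number of completed iterations is.\<close>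

lemma cost_foldC_count:
  assumes "I 0 s" "\<And>i s. i \<le> length xs \<Longrightarrow> I i s \<Longrightarrow> words s \<le> b"
    "\<And>i s. i < length xs \<Longrightarrow> I i s \<Longrightarrow> cost (f s (xs ! i)) a w"
    "\<And>i s. i < length xs \<Longrightarrow> I i s \<Longrightarrow> I (Suc i) (result (f s (xs ! i)))"
  shows "cost (foldC f s xs) (length xs * (1 + a)) (b + w)"
  using assms
proof (induction xs arbitrary: s I)
  case Nil
  then have "words s \<le> b" by blast
  then show ?case by (simp add: cost_def)
next
  case (Cons x xs)
  have "words s \<le> b" using Cons.prems(1) Cons.prems(2)[of 0 s] by simp
  moreover have "cost (f s x) a w" using Cons.prems(1) Cons.prems(3)[of 0 s] by simp
  moreover have "cost (foldC f (result (f s x)) xs) (length xs * (1 + a)) (b + w)"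
  proof (rule Cons.IH[where I = "\<lambda>i. I (Suc i)"])
    show "I (Suc 0) (result (f s x))" using Cons.prems(1) Cons.prems(4)[of 0 s] by simp
  next
    fix i s assume "i \<le> length xs" "I (Suc i) s"
    then show "words s \<le> b" using Cons.prems(2)[of "Suc i" s] by simp
  next
    fix i s assume "i < length xs" "I (Suc i) s"
    then show "cost (f s (xs ! i)) a w" "I (Suc (Suc i)) (result (f s (xs ! i)))"
      using Cons.prems(3,4)[of "Suc i" s] by simp_all
  qed
  ultimately show ?case by (auto simp: cost_def Let_def)
qed

section \<open>The KKT system and its solution\<close>

lemma result_dot_inner: "length u = n \<Longrightarrow> length v = n \<Longrightarrow> result (dot u v) = inner n u v"
  by (simp add: inner_def)

lemma result_kkt_matrix:
  "result (kkt_matrix gs) = map (\<lambda>x. map (\<lambda>y. result (dot x y)) gs @ [1]) gs @ [replicate (length gs) 1 @ [0]]"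
  unfolding kkt_matrix_def result_bind result_mapC result_basic result_ones result_mult_trans map_map
  by (simp add: comp_def)

lemma kkt_matrix_shape: "shape (length gs + 1) (length gs + 1) (result (kkt_matrix gs))"
  by (auto simp: shape_def result_kkt_matrix)

definition kkt_rhs :: "dense list \<Rightarrow> dense \<Rightarrow> dense list" where
  "kkt_rhs gs y = map (\<lambda>v. [result (dot v y)]) gs @ [[1]]"

lemma kkt_rhs_shape: "shape (length gs + 1) 1 (kkt_rhs gs y)"
  by (auto simp: shape_def kkt_rhs_def)

lemma result_affine_solve:
  "result (affine_solve est gs y) =
     map_option (\<lambda>Z. map (\<lambda>z. z ! 0) (take (length gs) Z)) (result (gauss_jordan (result (kkt_matrix gs)) (kkt_rhs gs y)))"
proof -
  have "result (affine_solve est gs y) = result (case result (gauss_jordan (result (kkt_matrix gs)) (kkt_rhs gs y)) of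
        None \<Rightarrow> ret None
      | Some Z \<Rightarrow> do {
          mu \<leftarrow> mapC (\<lambda>z. flop (z ! 0)) (take (length gs) Z);
          ret (Some mu) })"
    unfolding affine_solve_def result_bind result_basic result_mapC kkt_rhs_def ..
  then show ?thesis by (cases "result (gauss_jordan (result (kkt_matrix gs)) (kkt_rhs gs y))") auto
qed

lemma affine_solve_length: "result (affine_solve est gs y) = Some mu \<Longrightarrow> length mu = length gs"
  unfolding result_affine_solve
  using gauss_jordan_solves(1)[OF kkt_matrix_shape kkt_rhs_shape, of gs y] by (auto simp: shape_def)

text \<open>The first unknowns are the weights and the last is the multiplier \<open>nu\<close>. The
  bordering row of the KKT matrix becomes the normalization of the weights.\<close>

lemma affine_solve_kkt:
  assumes gs: "\<And>v. v \<in> set gs \<Longrightarrow> length v = n" and y: "length y = n"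
    and Some: "result (affine_solve est gs y) = Some mu"
  obtains nu where "(\<Sum>i<length gs. mu ! i) = 1"
    "\<And>i. i < length gs \<Longrightarrow> (\<Sum>j<length gs. inner n (gs ! i) (gs ! j) * mu ! j) + nu = inner n (gs ! i) y"
proof -
  define r where "r = length gs"
  obtain Z where Z: "result (gauss_jordan (result (kkt_matrix gs)) (kkt_rhs gs y)) = Some Z"
    and mu: "mu = map (\<lambda>z. z ! 0) (take r Z)"
    using Some by (auto simp: result_affine_solve r_def)
  have Z_shape: "shape (r + 1) 1 Z"
    and sol: "\<And>i. i < r + 1 \<Longrightarrow> (\<Sum>j<r + 1. result (kkt_matrix gs) ! i ! j * Z ! j ! 0) = kkt_rhs gs y ! i ! 0"
    using gauss_jordan_solves[OF kkt_matrix_shape kkt_rhs_shape Z] by (auto simp: r_def)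
  have mu_nth: "mu ! j = Z ! j ! 0" if "j < r" for j
    using that Z_shape by (simp add: mu shape_def)
  show ?thesis
  proof
    show "(\<Sum>i<length gs. mu ! i) = 1"
      using sol[of r] mu_nth by (simp add: result_kkt_matrix kkt_rhs_def nth_append r_def)
  next
    fix i assume i: "i < length gs"
    have K: "result (kkt_matrix gs) ! i = map (\<lambda>y. inner n (gs ! i) y) gs @ [1]"
      using i gs by (simp add: result_kkt_matrix nth_append result_dot_inner del: result_dot)
    have R: "kkt_rhs gs y ! i ! 0 = inner n (gs ! i) y"
      using i gs y by (simp add: kkt_rhs_def nth_append result_dot_inner del: result_dot)
    show "(\<Sum>j<length gs. inner n (gs ! i) (gs ! j) * mu ! j) + Z ! r ! 0 = inner n (gs ! i) y"
      using sol[of i] i mu_nth by (simp add: K R nth_append r_def)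
  qed
qed

lemma inner_commute: "inner n u v = inner n v u"
  by (simp add: inner_def mult.commute)

lemma inner_lincomb:
  assumes "\<And>v. v \<in> set vs \<Longrightarrow> length v = n" "length vs = length ws"
  shows "inner n u (result (lincomb n vs ws)) = (\<Sum>i<length vs. inner n u (vs ! i) * ws ! i)"
proof -
  have "inner n u (result (lincomb n vs ws)) = (\<Sum>k<n. \<Sum>i<length vs. u ! k * (ws ! i * vs ! i ! k))"
    unfolding inner_def sum_distrib_left[symmetric] using lincomb_nth[OF assms] by (intro sum.cong) auto
  also have "\<dots> = (\<Sum>i<length vs. inner n u (vs ! i) * ws ! i)"
    unfolding inner_def sum_distrib_right by (subst sum.swap) (intro sum.cong refl, simp)
  finally show ?thesis .
qed

lemma inner_vec_sub: "length y = n \<Longrightarrow> length z = n \<Longrightarrow> inner n (map2 (-) y z) v = inner n y v - inner n z v"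
  by (simp add: inner_def left_diff_distrib sum_subtractf)

text \<open>Row \<open>i\<close> of the KKT system says that \<open>y - z\<close> takes the value
  \<open>nu\<close> at generator \<open>i\<close>. The weights sum to one, so it takes the same
  value at their combination \<open>z\<close>.\<close>

lemma affine_minimizer_orthogonal:
  assumes gs: "\<And>v. v \<in> set gs \<Longrightarrow> length v = n" and y: "length y = n"
    and Some: "result (affine_solve est gs y) = Some mu" and z: "z = result (lincomb n gs mu)"
    and v: "v \<in> set gs"
  shows "inner n (map2 (-) y z) v = inner n (map2 (-) y z) z"
proof -
  have mu: "length gs = length mu" using affine_solve_length[OF Some] by simp
  have lz: "length z = n" using length_lincomb gs z by simp
  obtain nu where sum: "(\<Sum>i<length gs. mu ! i) = 1" and
    kkt: "\<And>i. i < length gs \<Longrightarrow> (\<Sum>j<length gs. inner n (gs ! i) (gs ! j) * mu ! j) + nu = inner n (gs ! i) y"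
    using affine_solve_kkt[OF gs y Some] by blast
  let ?d = "map2 (-) y z"
  have nu: "inner n ?d (gs ! i) = nu" if "i < length gs" for i
  proof -
    have "inner n (gs ! i) z = (\<Sum>j<length gs. inner n (gs ! i) (gs ! j) * mu ! j)"
      unfolding z using inner_lincomb[OF gs mu] .
    then show ?thesis using kkt[OF that] inner_vec_sub[OF y lz, of "gs ! i"]
        inner_commute[of n y "gs ! i"] inner_commute[of n z "gs ! i"] by linarith
  qed
  have "inner n ?d z = (\<Sum>i<length gs. inner n ?d (gs ! i) * mu ! i)"
    by (subst (2) z) (rule inner_lincomb[OF gs mu])
  also have "\<dots> = (\<Sum>i<length gs. nu * mu ! i)"
    using nu by (intro sum.cong) auto
  also have "\<dots> = nu" using sum by (simp add: sum_distrib_left[symmetric])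
  finally show ?thesis using v nu by (auto simp: in_set_conv_nth)
qed

text \<open>Weights of an empty corral cannot sum to one. Hence a successful solve contributes at
  least \<open>n\<close> to the bound, which is what the amortization charges to it.\<close>

lemma affine_solve_nonempty:
  assumes "result (affine_solve est gs y) = Some mu"
  shows "gs \<noteq> []"
proof
  assume "gs = []"
  then show False using affine_solve_kkt[of "[]" "length y" y est mu] assms by simp
qed

section \<open>Cost of an affine solve\<close>

lemma cost_kkt_matrix:
  assumes gs: "\<And>v. v \<in> set gs \<Longrightarrow> length v = n" and k: "k = length gs + 1"
  shows "cost (kkt_matrix gs) (20 * (k * k * (n + k))) (20 * (k * k))"
proof -
  define r where "r = length gs"
  have "cost (kkt_matrix gs) ((r * (r * (3 * n + 1) + 2) + 1) + ((r * (1 + 1) + 1) + ((2 * r + 1) + (1 + 1))))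
     ((r * (r + 1) + r + 5) + ((r * (r + 2) + max 1 (r + 2) + 1) + ((r + 2) + (1 + (r + 2)))))"
    unfolding kkt_matrix_def
  proof (intro cost_bind cost_mult_trans cost_mapC_le)
    fix x assume "x \<in> set (result (mult_trans gs gs))"
    then show "cost (push x 1) 1 1" "words (result (push x 1)) \<le> r + 2"
      by (auto simp: cost_def comp_simps r_def)
  next
    show "cost (ones (length gs)) (2 * r + 1) (r + 2)" unfolding r_def by (rule cost_ones)
  qed (auto simp: r_def cost_def comp_simps gs)
  then show ?thesis by (rule cost_weaken) (simp_all add: k r_def[symmetric] algebra_simps)
qed

text \<open>The Gram matrix accounts for \<open>k * k * n\<close>; elimination and condition
  estimate account for \<open>k * k * k\<close>. The space is free of \<open>n\<close>, because only
  the system of order \<open>k\<close> and data derived from it are allocated.\<close>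

lemma cost_affine_solve:
  assumes gs: "\<And>v. v \<in> set gs \<Longrightarrow> length v = n" and k: "k = length gs + 1"
  shows "cost (affine_solve est gs y) (300 * (k * k * (n + k))) (300 * (k * k))"
proof -
  define r where "r = length gs"
  let ?K = "result (kkt_matrix gs)"
  have K: "shape k k ?K" and R: "shape k 1 (kkt_rhs gs y)"
    using kkt_matrix_shape kkt_rhs_shape k by auto
  have c1: "cost (if est then condition_estimate ?K else ret None) (130 * (k * k * k)) (130 * (k * k))"
    by (rule cost_weaken[OF cost_if[OF cost_condition_estimate[OF K] cost_basic(1)]]) (auto simp: k)
  have c2: "cost (mapC (\<lambda>v. do { p \<leftarrow> dot v y; ret [p] }) gs) (r * (1 + (3 * n + 0)) + 1) (r * 2 + max (3 + 0) 2 + 1)"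
    by (intro cost_mapC_le cost_bind cost_dot cost_basic) (auto simp: r_def gs)
  have c3: "cost (gauss_jordan ?K (kkt_rhs gs y)) (100 * (k * k * k)) (100 * (k * k))"
    using cost_gauss_jordan[OF K R] k by simp
  have c4: "cost (case result (gauss_jordan ?K (kkt_rhs gs y)) of
        None \<Rightarrow> ret None
      | Some Z \<Rightarrow> do {
          mu \<leftarrow> mapC (\<lambda>z. flop (z ! 0)) (take (length gs) Z);
          ret (Some mu) }) ((r * (1 + 1) + 1) + 0) ((r * 1 + max 1 1 + 1) + 0)"
    by (intro cost_case_option cost_weaken[OF cost_basic(1)] cost_bind cost_mapC_le cost_basic) (auto simp: r_def)
  have w: "words (result (affine_solve est gs y)) \<le> r + 2"
    using affine_solve_length[of est gs y] by (cases "result (affine_solve est gs y)") (auto simp: r_def)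
  have "cost (affine_solve est gs y)
    (20 * (k * k * (n + k)) + (130 * (k * k * k) + ((r * (1 + (3 * n + 0)) + 1) + (1 + (100 * (k * k * k) + ((r * (1 + 1) + 1) + 0))))))
    (max (20 * (k * k) + (130 * (k * k) + ((r * 2 + max (3 + 0) 2 + 1) + (2 + (100 * (k * k) + ((r * 1 + max 1 1 + 1) + 0)))))) (r + 2))"
    unfolding affine_solve_def
  proof (rule cost_call, rule cost_bind[OF cost_kkt_matrix[OF gs k]], assumption, rule cost_bind[OF c1], rule cost_bind[OF c2], rule cost_bind)
    show "cost (push (result (mapC (\<lambda>v. do { p \<leftarrow> dot v y; ret [p] }) gs)) [1]) 1 2"
      by (simp add: cost_def comp_simps)
    have "result (push (result (mapC (\<lambda>v. do { p \<leftarrow> dot v y; ret [p] }) gs)) [1]) = kkt_rhs gs y"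
      by (simp add: kkt_rhs_def)
    then show "cost (do {
     Z \<leftarrow> gauss_jordan ?K (result (push (result (mapC (\<lambda>v. do { p \<leftarrow> dot v y; ret [p] }) gs)) [1]));
     (case Z of
        None \<Rightarrow> ret None
      | Some Z \<Rightarrow> do {
          mu \<leftarrow> mapC (\<lambda>z. flop (z ! 0)) (take (length gs) Z);
          ret (Some mu) }) }) (100 * (k * k * k) + ((r * (1 + 1) + 1) + 0)) (100 * (k * k) + ((r * 1 + max 1 1 + 1) + 0))"
      using cost_bind[of _ _ _ "\<lambda>Z. case Z of
        None \<Rightarrow> ret None
      | Some Z \<Rightarrow> do {
          mu \<leftarrow> mapC (\<lambda>z. flop (z ! 0)) (take (length gs) Z);
          ret (Some mu) }", OF c3 c4] by simp
  qed (rule w[unfolded affine_solve_def result_basic])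
  then show ?thesis by (rule cost_weaken) (simp_all add: k r_def[symmetric] algebra_simps)
qed

lemma cost_affine_estimate:
  assumes gs: "\<And>v. v \<in> set gs \<Longrightarrow> length v = n" and k: "k = length gs + 1"
  shows "cost (affine_estimate gs) (300 * (k * k * (n + k))) (300 * (k * k))"
proof -
  have K: "shape k k (result (kkt_matrix gs))"
    using kkt_matrix_shape k by auto
  have w: "words x \<le> 2" for x :: "real option" by (cases x) auto
  have "cost (affine_estimate gs) (20 * (k * k * (n + k)) + 130 * (k * k * k))
    (max (20 * (k * k) + 130 * (k * k)) 2)"
    unfolding affine_estimate_def
    by (rule cost_call, rule cost_bind[OF cost_kkt_matrix[OF gs k]], assumption, rule cost_condition_estimate[OF K]) (use k w in auto)
  then show ?thesis by (rule cost_weaken) (simp_all add: k algebra_simps)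
qed

section \<open>Corral steps\<close>

text \<open>Distinctness is demanded of the vectors and not just of the indices, since rows may
  coincide. It turns the cardinality bound for affinely independent sets into a bound on the length
  of the list.\<close>

definition corral_ok :: "nat \<Rightarrow> nat list \<Rightarrow> dense list \<Rightarrow> dense \<Rightarrow> bool" where
  "corral_ok n C gs ws \<longleftrightarrow> length C = length gs \<and> length ws = length gs \<and>
     (\<forall>v\<in>set gs. length v = n) \<and> distinct gs \<and> aff_indep n (set gs)"

lemma corral_ok_length: "corral_ok n C gs ws \<Longrightarrow> length gs \<le> n + 1"
  unfolding corral_ok_def using aff_indep_card distinct_card by metis

text \<open>This and the next definitions name the loops of the minor step, so that values and costs
  can be treated loop by loop.\<close>

definition step_length :: "dense \<Rightarrow> dense \<Rightarrow> real comp" where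
  "step_length ws mu = foldC (\<lambda>t (l, a). do {
     nonpos \<leftarrow> test (a \<le> 0);
     if nonpos then do {
       e \<leftarrow> flop (l - a); q \<leftarrow> flop (l / e); less \<leftarrow> test (q < t);
       ret (if less then q else t) }
     else ret t }) 1 (zip ws mu)"

definition move_weights :: "real \<Rightarrow> dense \<Rightarrow> dense \<Rightarrow> dense comp" where
  "move_weights theta ws mu = mapC (\<lambda>(l, a). do {
     e \<leftarrow> flop (a - l); f \<leftarrow> flop (theta * e); flop (l + f) }) (zip ws mu)"

definition keep_nonzero ::
  "nat list \<times> dense list \<times> dense \<Rightarrow> nat \<times> dense \<times> real \<Rightarrow> (nat list \<times> dense list \<times> dense) comp" where
  "keep_nonzero = (\<lambda>(C', gens', wts') (i, v, l). do {
     zero \<leftarrow> test (l = 0);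
     if zero then ret (C', gens', wts')
     else do {
       C' \<leftarrow> push C' i; gens' \<leftarrow> push gens' v; wts' \<leftarrow> push wts' l;
       ret (C', gens', wts') } })"

definition drop_zeros :: "(nat \<times> dense \<times> real) list \<Rightarrow> (nat list \<times> dense list \<times> dense) comp" where
  "drop_zeros xs = foldC keep_nonzero ([], [], []) xs"

lemma corral_step_eq:
  "corral_step n est C gs ws y z = do {
     r \<leftarrow> affine_solve est gs y;
     (case r of
        None \<Rightarrow> ret None
      | Some mu \<Rightarrow> do {
          pos \<leftarrow> allC (\<lambda>a. test (a > 0)) mu;
          if pos then do {
            z \<leftarrow> lincomb n gs mu;
            ret (Some (True, C, gs, mu, z)) }
          else do {
            theta \<leftarrow> step_length ws mu;
            ws \<leftarrow> move_weights theta ws mu;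
            (C, gs, ws) \<leftarrow> drop_zeros (zip C (zip gs ws));
            ret (Some (False, C, gs, ws, z)) } }) }"
  unfolding corral_step_def step_length_def move_weights_def drop_zeros_def keep_nonzero_def ..

lemma result_keep_nonzero:
  "result (keep_nonzero (C, gs, ws) x) = (if snd (snd x) = 0 then (C, gs, ws)
     else (C @ [fst x], gs @ [fst (snd x)], ws @ [snd (snd x)]))"
  by (cases x) (simp add: keep_nonzero_def)

lemma result_drop_zeros:
  "result (drop_zeros xs) = (let zs = filter (\<lambda>x. snd (snd x) \<noteq> 0) xs in (map fst zs, map (fst \<circ> snd) zs, map (snd \<circ> snd) zs))"
proof -
  have "foldl (\<lambda>s x. result (keep_nonzero s x)) (a, b, c) xs =
    (let zs = filter (\<lambda>x. snd (snd x) \<noteq> 0) xs in (a @ map fst zs, b @ map (fst \<circ> snd) zs, c @ map (snd \<circ> snd) zs))"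
    for a b c
    by (induction xs arbitrary: a b c) (simp_all add: result_keep_nonzero Let_def)
  then show ?thesis by (simp add: drop_zeros_def)
qed

lemma length_move_weights: "length ws = r \<Longrightarrow> length mu = r \<Longrightarrow> length (result (move_weights theta ws mu)) = r"
  by (simp add: move_weights_def)

text \<open>Deletion leaves a sublist of the generators, so distinctness and affine independence are
  inherited whatever weights the move produced.\<close>

lemma drop_zeros_corral_ok:
  assumes ok: "corral_ok n C gs ws" and ws': "length ws' = length gs"
    and d: "result (drop_zeros (zip C (zip gs ws'))) = (C', gs', ws'')"
  shows "corral_ok n C' gs' ws''"
proof -
  define zs where "zs = filter (\<lambda>x. snd (snd x) \<noteq> 0) (zip C (zip gs ws'))"
  have *: "C' = map fst zs" "gs' = map (fst \<circ> snd) zs" "ws'' = map (snd \<circ> snd) zs"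
    using d by (auto simp: result_drop_zeros zs_def Let_def)
  have all: "map (fst \<circ> snd) (zip C (zip gs ws')) = gs"
    using ok ws' by (simp add: corral_ok_def map_zip_map2 flip: map_map)
  have sub: "set gs' \<subseteq> set gs"
    by (subst all[symmetric]) (auto simp: *(2) zs_def)
  moreover have "distinct gs'"
    unfolding *(2) zs_def by (rule distinct_map_filter) (use all ok in \<open>simp add: corral_ok_def\<close>)
  ultimately show ?thesis
    using ok aff_indep_subset[OF _ sub] unfolding corral_ok_def by (auto simp: *)
qed

text \<open>Orthogonality is obtained only after a step with all weights positive, where the point
  becomes the new minimizer. A minor step keeps the old point and preserves independence by deletion
  alone, so repair after a change of target fits as well.\<close>

lemma corral_step_ok:
  assumes ok: "corral_ok n C gs ws" and y: "length y = n"
    and step: "result (corral_step n est C gs ws y z) = Some (fin, C', gs', ws', z')"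
  shows "gs \<noteq> []" "corral_ok n C' gs' ws'" "\<not> fin \<Longrightarrow> z' = z" "fin \<Longrightarrow> length z' = n"
    "fin \<Longrightarrow> v \<in> set gs' \<Longrightarrow> inner n (map2 (-) y z') v = inner n (map2 (-) y z') z'"
proof -
  have gs: "\<And>v. v \<in> set gs \<Longrightarrow> length v = n" and lens: "length C = length gs" "length ws = length gs"
    using ok by (auto simp: corral_ok_def)
  obtain mu where mu: "result (affine_solve est gs y) = Some mu"
    using step by (cases "result (affine_solve est gs y)") (auto simp: corral_step_eq)
  note lmu = affine_solve_length[OF mu]
  show "gs \<noteq> []" using affine_solve_nonempty[OF mu] .
  have main: "corral_ok n C' gs' ws' \<and> (\<not> fin \<longrightarrow> z' = z) \<and> (fin \<longrightarrow> length z' = n) \<and>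
      (fin \<longrightarrow> v \<in> set gs' \<longrightarrow> inner n (map2 (-) y z') v = inner n (map2 (-) y z') z')" for v
  proof (cases "result (allC (\<lambda>a. test (a > 0)) mu)")
    case True
    then have "fin" "C' = C" "gs' = gs" "ws' = mu" and z': "z' = result (lincomb n gs mu)"
      using step mu by (auto simp: corral_step_eq)
    then show ?thesis
      using ok lmu length_lincomb[OF gs] affine_minimizer_orthogonal[OF gs y mu z']
      by (auto simp: corral_ok_def)
  next
    case False
    define ws1 where "ws1 = result (move_weights (result (step_length ws mu)) ws mu)"
    have l1: "length ws1 = length gs" using lens lmu by (simp add: ws1_def length_move_weights)
    obtain C1 gs1 ws2 where d: "result (drop_zeros (zip C (zip gs ws1))) = (C1, gs1, ws2)"
      by (cases "result (drop_zeros (zip C (zip gs ws1)))") auto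
    have "\<not> fin" "C' = C1" "gs' = gs1" "ws' = ws2" "z' = z"
      using step mu False d by (auto simp: corral_step_eq ws1_def)
    then show ?thesis
      using drop_zeros_corral_ok[OF ok l1 d] by simp
  qed
  show "corral_ok n C' gs' ws'" "\<not> fin \<Longrightarrow> z' = z" "fin \<Longrightarrow> length z' = n"
    "fin \<Longrightarrow> v \<in> set gs' \<Longrightarrow> inner n (map2 (-) y z') v = inner n (map2 (-) y z') z'"
    using main[of v] by auto
qed

lemma cost_step_length: "length ws \<le> r \<Longrightarrow> cost (step_length ws mu) (5 * r) 5"
  unfolding step_length_def
  by (rule cost_weaken[OF cost_foldC_le[where I = "\<lambda>_. True" and b = 1 and a = 4 and w = 4 and k = r]])
    (auto simp: cost_def comp_simps)

lemma cost_move_weights: "length ws \<le> r \<Longrightarrow> cost (move_weights theta ws mu) (4 * r + 1) (r + 4)"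
  unfolding move_weights_def
  by (rule cost_weaken[OF cost_mapC_le[where v = 1 and a = 3 and w = 3 and k = r]])
    (auto simp: cost_def comp_simps)

text \<open>Appending a generator is one operation but allocates \<open>n + 1\<close> words: time is
  linear in \<open>r\<close>, space in \<open>r * n\<close>.\<close>

lemma cost_drop_zeros:
  assumes "length xs \<le> r" and n: "\<And>x. x \<in> set xs \<Longrightarrow> length (fst (snd x)) = n"
  shows "cost (drop_zeros xs) (5 * r) ((r * (n + 1) + 2 * r + 3) + (n + 4))"
proof -
  have "cost (drop_zeros xs) (length xs * (1 + 4)) ((r * (n + 1) + 2 * r + 3) + (n + 4))"
    unfolding drop_zeros_def
  proof (rule cost_foldC_count[where I = "\<lambda>i (C', gs', ws'). length C' \<le> i \<and> length gs' \<le> i \<and> length ws' \<le> i \<and> (\<forall>v\<in>set gs'. length v = n)"])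
    fix i :: nat and s :: "nat list \<times> dense list \<times> dense"
    assume i: "i \<le> length xs" and s: "case s of (C', gs', ws') \<Rightarrow> length C' \<le> i \<and> length gs' \<le> i \<and> length ws' \<le> i \<and> (\<forall>v\<in>set gs'. length v = n)"
    obtain C' gs' ws' where s': "s = (C', gs', ws')" by (cases s) auto
    have "words gs' \<le> r * (n + 1) + 1" using s i assms by (intro words_dense_list) (auto simp: s')
    then show "words s \<le> r * (n + 1) + 2 * r + 3" using s i assms by (simp add: s')
  next
    fix i :: nat and s :: "nat list \<times> dense list \<times> dense"
    assume i: "i < length xs" and s: "case s of (C', gs', ws') \<Rightarrow> length C' \<le> i \<and> length gs' \<le> i \<and> length ws' \<le> i \<and> (\<forall>v\<in>set gs'. length v = n)"
    have l: "length (fst (snd (xs ! i))) = n" using i n by simp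
    then show "cost (keep_nonzero s (xs ! i)) 4 (n + 4)"
      by (cases s; cases "xs ! i") (auto simp: keep_nonzero_def cost_def comp_simps)
    show "case result (keep_nonzero s (xs ! i)) of (C', gs', ws') \<Rightarrow> length C' \<le> Suc i \<and> length gs' \<le> Suc i \<and> length ws' \<le> Suc i \<and> (\<forall>v\<in>set gs'. length v = n)"
      using l s by (cases s) (auto simp: result_keep_nonzero)
  qed simp
  then show ?thesis using assms(1) by (elim cost_weaken) auto
qed

text \<open>In the space bound, \<open>k * n\<close> comes from the rebuilt list of generators and
  \<open>k * k\<close> from the elimination.\<close>

lemma cost_corral_step:
  assumes ok: "corral_ok n C gs ws" and k: "k = length gs + 1"
  shows "cost (corral_step n est C gs ws y z) (400 * (k * k * (n + k))) (400 * (k * (n + k)))"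
proof -
  define r where "r = length gs"
  have gs: "\<And>v. v \<in> set gs \<Longrightarrow> length v = n" and lens: "length C = r" "length ws = r"
    using ok by (auto simp: corral_ok_def r_def)
  have c1: "cost (affine_solve est gs y) (300 * (k * k * (n + k))) (300 * (k * k))"
    by (rule cost_affine_solve[OF gs k])
  have c2: "cost (do {
          pos \<leftarrow> allC (\<lambda>a. test (a > 0)) mu;
          if pos then do {
            z \<leftarrow> lincomb n gs mu;
            ret (Some (True, C, gs, mu, z)) }
          else do {
            theta \<leftarrow> step_length ws mu;
            ws \<leftarrow> move_weights theta ws mu;
            (C, gs, ws) \<leftarrow> drop_zeros (zip C (zip gs ws));
            ret (Some (False, C, gs, ws, z)) } })
     (r * (1 + 2) + max ((2 * n + 1 + r * (4 * n + 3)) + 0) (5 * r + ((4 * r + 1) + (5 * r + 0))))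
     ((1 + 2) + max ((4 * n + 7) + 0) (5 + ((r + 4) + (((r * (n + 1) + 2 * r + 3) + (n + 4)) + 0))))"
    if mu: "result (affine_solve est gs y) = Some mu" for mu
  proof -
    have "cost (allC (\<lambda>a. test (a > 0)) mu) (r * (1 + 2)) (1 + 2)"
      using cost_allC[of mu "\<lambda>a. test (a > 0)" 1 1] cost_basic(3) affine_solve_length[OF mu] by (simp add: r_def)
    moreover have "cost (drop_zeros (zip C (zip gs ws'))) (5 * r) ((r * (n + 1) + 2 * r + 3) + (n + 4))" for ws'
      by (rule cost_drop_zeros) (use gs lens in \<open>auto dest!: set_zip_rightD[where xs = C] dest: set_zip_leftD\<close>)
    moreover have "cost (case result (drop_zeros (zip C (zip gs ws'))) of (C, gs, ws) \<Rightarrow> ret (Some (False, C, gs, ws, z))) 0 0" for ws'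
      by (simp add: case_prod_unfold cost_basic)
    moreover have "cost (step_length ws mu) (5 * r) 5" "cost (move_weights theta ws mu) (4 * r + 1) (r + 4)" for theta
      using cost_step_length cost_move_weights lens by auto
    moreover have "cost (lincomb n gs mu) (2 * n + 1 + r * (4 * n + 3)) (4 * n + 7)"
      using cost_lincomb[OF gs] by (simp add: r_def)
    ultimately show ?thesis by (intro cost_bind cost_if cost_basic(1))
  qed
  have "cost (corral_step n est C gs ws y z)
     (300 * (k * k * (n + k)) + (r * (1 + 2) + max ((2 * n + 1 + r * (4 * n + 3)) + 0) (5 * r + ((4 * r + 1) + (5 * r + 0)))))
     (300 * (k * k) + ((1 + 2) + max ((4 * n + 7) + 0) (5 + ((r + 4) + (((r * (n + 1) + 2 * r + 3) + (n + 4)) + 0)))))"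
    unfolding corral_step_eq by (rule cost_bind[OF c1], rule cost_case_option[OF cost_weaken[OF cost_basic(1)] c2]) auto
  then show ?thesis by (rule cost_weaken) (simp_all add: k r_def[symmetric] algebra_simps)
qed

section \<open>Full-row passes and outer iterations\<close>

text \<open>Distinct column indices serve two purposes: a row has at most \<open>n\<close> entries,
  and writing it into a zero vector never overwrites an entry already written.\<close>

definition sparse_ok :: "nat \<Rightarrow> sparse \<Rightarrow> bool" where
  "sparse_ok n S \<longleftrightarrow> (\<forall>row\<in>set S. distinct (map fst row) \<and> (\<forall>x\<in>set row. fst x < n))"

definition entries :: "sparse \<Rightarrow> nat" where
  "entries S = (\<Sum>row\<leftarrow>S. length row)"

lemma sparse_ok_row_length:
  assumes "sparse_ok n S" "xs \<in> set S"
  shows "length xs \<le> n"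
proof -
  have "distinct (map fst xs)" "set (map fst xs) \<subseteq> {..<n}" using assms by (auto simp: sparse_ok_def)
  then have "card (set (map fst xs)) \<le> card {..<n}" by (intro card_mono) auto
  then show ?thesis using distinct_card[OF \<open>distinct (map fst xs)\<close>] by simp
qed

lemma sum_rows: "(\<Sum>row\<leftarrow>S. b + a * length row) = b * length S + a * entries S"
  by (induction S) (simp_all add: entries_def algebra_simps)

lemma length_sparse_mult [simp]: "length (result (sparse_mult S d)) = length S"
  by (simp add: sparse_mult_def)

lemma cost_sparse_mult: "cost (sparse_mult S d) (length S + 3 * entries S + 1) (length S + 4)"
proof -
  have "cost (foldC (\<lambda>s (j, a). do { p \<leftarrow> flop (a * d ! j); flop (s + p) }) 0 row) (3 * length row) 3" for row
    by (rule cost_weaken[OF cost_foldC_const[where I = "\<lambda>_. True" and b = 1 and a = 2 and w = 2]])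
      (auto simp: cost_def comp_simps)
  then have "cost (sparse_mult S d) ((\<Sum>row\<leftarrow>S. 1 + 3 * length row) + 1) (length S * 1 + max 3 1 + 1)"
    unfolding sparse_mult_def by (intro cost_mapC) auto
  then show ?thesis by (simp only: sum_rows) (simp add: add.commute)
qed

lemma inner_list_update:
  assumes "j < n" "length u = n" "u ! j = 0"
  shows "inner n d (u[j := a]) = inner n d u + a * d ! j"
proof -
  have "inner n d (u[j := a]) = (\<Sum>k<n. d ! k * u ! k + (if k = j then a * d ! j else 0))"
    unfolding inner_def using assms by (intro sum.cong) auto
  also have "\<dots> = inner n d u + a * d ! j" using assms(1) by (simp add: sum.distrib inner_def)
  finally show ?thesis .
qed

text \<open>Each write meets an entry that is still zero, because the indices are distinct; so
  overwriting acts as addition and the inner product grows by one term.\<close>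

lemma inner_scatter:
  assumes "distinct (map fst xs)" "\<forall>x\<in>set xs. fst x < n \<and> u ! fst x = 0" "length u = n"
  shows "inner n d (foldl (\<lambda>u x. u[fst x := snd x]) u xs) = inner n d u + (\<Sum>x\<leftarrow>xs. snd x * d ! fst x)"
  using assms
proof (induction xs arbitrary: u)
  case (Cons x xs)
  have "inner n d (foldl (\<lambda>u x. u[fst x := snd x]) (u[fst x := snd x]) xs)
    = inner n d (u[fst x := snd x]) + (\<Sum>x\<leftarrow>xs. snd x * d ! fst x)"
    using Cons.prems by (intro Cons.IH) (auto simp: nth_list_update image_iff)
  then show ?case using Cons.prems by (simp add: inner_list_update)
qed simp

lemma result_generator:
  "result (generator n S i) = (if i = 0 then replicate n 0
     else foldl (\<lambda>u x. u[fst x := snd x]) (replicate n 0) (S ! (i - 1)))"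
  by (simp add: generator_def case_prod_unfold)

lemma length_generator [simp]: "length (result (generator n S i)) = n"
  by (simp add: result_generator foldl_list_update_length)

lemma inner_replicate_0 [simp]: "inner n d (replicate n 0) = 0"
  by (simp add: inner_def)

text \<open>The link between the sparse and the dense form of a generator: the test made in a
  full-row pass becomes a statement about the vectors held in the corral.\<close>

lemma scores_nth:
  assumes "sparse_ok n S" "i \<le> length S"
  shows "result (scores S d) ! i = inner n d (result (generator n S i))"
proof (cases i)
  case 0
  then show ?thesis by (simp add: scores_def result_generator)
next
  case (Suc k)
  then have k: "k < length S" "S ! k \<in> set S" using assms by auto
  have "inner n d (foldl (\<lambda>u x. u[fst x := snd x]) (replicate n 0) (S ! k))
    = inner n d (replicate n 0) + (\<Sum>x\<leftarrow>S ! k. snd x * d ! fst x)"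
    using assms(1) k(2) by (intro inner_scatter) (auto simp: sparse_ok_def)
  moreover have "result (scores S d) ! i = (\<Sum>x\<leftarrow>S ! k. snd x * d ! fst x)"
    using k Suc by (simp add: scores_def sparse_mult_def case_prod_unfold foldl_add_map)
  ultimately show ?thesis using Suc by (simp add: result_generator)
qed

lemma length_scores [simp]: "length (result (scores S d)) = length S + 1"
  by (simp add: scores_def)

lemma cost_scores: "cost (scores S d) (length S + 3 * entries S + 2) (length S + 5)"
  unfolding scores_def
  by (rule cost_weaken[OF cost_bind[OF cost_sparse_mult cost_basic(7)]]) auto

text \<open>Only one row is read and it has at most \<open>n\<close> entries, so the size of the
  input does not enter.\<close>

lemma cost_generator:
  assumes "sparse_ok n S" "i \<le> length S"
  shows "cost (generator n S i) (4 * n + 1) (2 * n + 3)"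
proof -
  have "cost (foldC (\<lambda>u (j, a). upd u j a) (replicate n 0) (S ! (i - 1))) (n * (1 + 1)) ((n + 1) + 0)" if "i \<noteq> 0"
  proof (rule cost_foldC_le[where I = "\<lambda>u. length u = n"])
    show "length (S ! (i - 1)) \<le> n" using that assms by (intro sparse_ok_row_length[OF assms(1)]) auto
  qed (auto simp: cost_def comp_simps)
  then have "cost (generator n S i) ((2 * n + 1) + max 0 (n * (1 + 1))) ((n + 2) + max 0 ((n + 1) + 0))"
    unfolding generator_def
    by (intro cost_bind[OF cost_zeros] cost_if cost_basic(1)) simp_all
  then show ?thesis by (rule cost_weaken) simp_all
qed

lemma result_violators:
  "result (violators S y z) = map fst (filter (\<lambda>x. snd x - result (dot (map2 (-) y z) z) > 0)
     (zip [0..<length S + 1] (result (scores S (map2 (-) y z)))))"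
proof -
  have "foldl (\<lambda>vs x. result (if snd x - h > 0 then push vs (fst x) else ret vs)) vs xs =
    vs @ map fst (filter (\<lambda>x. snd x - h > 0) xs)" for h vs and xs :: "(nat \<times> real) list"
    by (induction xs arbitrary: vs) auto
  then show ?thesis by (simp add: violators_def case_prod_unfold)
qed

text \<open>The strict inequality is the hypothesis of \<open>aff_indep_insert\<close> for the
  inserted generator; the index bound makes its dense column available at cost linear in
  \<open>n\<close>.\<close>

lemma violators_sound:
  assumes S: "sparse_ok n S" and "length y = n" "length z = n" and j: "j \<in> set (result (violators S y z))"
  shows "j \<le> length S" "inner n (map2 (-) y z) (result (generator n S j)) > inner n (map2 (-) y z) z"
proof -
  from j show "j \<le> length S"
    by (auto simp: result_violators simp del: result_dot dest!: set_zip_leftD)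
  then show "inner n (map2 (-) y z) (result (generator n S j)) > inner n (map2 (-) y z) z"
    using j scores_nth[OF S] assms(2,3)
    by (auto simp: result_violators in_set_zip result_dot_inner[of _ n] simp del: result_dot upt_Suc)
qed

text \<open>The list of violators can reach \<open>length S + 1\<close> entries, so the collecting
  loop is bounded by counting iterations. The part \<open>5 * n\<close>, for the direction and its
  product with \<open>z\<close>, is what a pass does not pay for itself.\<close>

lemma cost_violators:
  assumes "length y \<le> n"
  shows "cost (violators S y z) (5 * n + 5 * length S + 3 * entries S + 10) (n + 3 * length S + 20)"
proof -
  have c4: "cost (foldC (\<lambda>vs (j, a). do {
       e \<leftarrow> flop (a - h); t \<leftarrow> test (e > 0);
       if t then push vs j else ret vs }) [] (zip [0..<length s] s)) ((length S + 1) * (1 + 3)) ((length S + 2) + 3)"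
    if s: "length s = length S + 1" for s h
  proof -
    have "length (zip [0..<length s] s) = length S + 1" using s by simp
    then show ?thesis
      using cost_foldC_count[where f = "\<lambda>vs (j, a). do {
       e \<leftarrow> flop (a - h); t \<leftarrow> test (e > 0);
       if t then push vs j else ret vs }" and I = "\<lambda>i vs. length vs \<le> i" and s = "[]" and xs = "zip [0..<length s] s" and b = "length S + 2" and a = 3 and w = 3]
      by (auto simp: cost_def comp_simps case_prod_unfold)
  qed
  have "length (result (violators S y z)) \<le> length (zip [0..<length S + 1] (result (scores S (map2 (-) y z))))"
    unfolding result_violators length_map by (rule length_filter_le)
  then have w: "words (result (violators S y z)) \<le> length S + 2" by simp
  have "cost (violators S y z) ((2 * n + 1) + ((length S + 3 * entries S + 2) + (3 * n + (length S + 1) * (1 + 3))))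
     (max ((n + 2) + ((length S + 5) + (3 + ((length S + 2) + 3)))) (length S + 2))"
    unfolding violators_def
  proof (rule cost_call, intro cost_bind cost_vec_sub cost_scores cost_dot c4)
    show "length y \<le> n" "length (result (vec_sub y z)) \<le> n" using assms by auto
    show "length (result (scores S (result (vec_sub y z)))) = length S + 1" by (rule length_scores)
  qed (rule w[unfolded violators_def result_basic])
  then show ?thesis by (rule cost_weaken) auto
qed

section \<open>Starting target, insertion and acceptance\<close>

lemma cost_initial_target:
  assumes "length c = n"
  shows "cost (initial_target S c r) (2 * n + 3 * length S + 3 * entries S + 6) (n + length S + 10)"
proof -
  have "cost (initial_target S c r) ((length S + 3 * entries S + 2) + (2 * (length S + 1) + (1 + ((2 * n + 1) + 0))))
    ((length S + 5) + (2 + (1 + ((n + 2) + 0))))"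
    unfolding initial_target_def
    by (intro cost_bind cost_scores cost_largest cost_basic cost_scale) (use assms in auto)
  then show ?thesis by (rule cost_weaken) auto
qed

lemma initial_target_length: "result (initial_target S c r) = (b, y) \<Longrightarrow> length y = length c"
  by (auto simp: initial_target_def)

lemma cost_warm_start: "cost (warm_start B b k) 4 4"
  by (simp add: warm_start_def cost_def comp_simps)

lemma cost_insert_generator:
  assumes "sparse_ok n S" "j \<le> length S"
  shows "cost (insert_generator n S j C gs ws) (4 * n + 4) (3 * n + 6)"
proof -
  have "cost (insert_generator n S j C gs ws) ((4 * n + 1) + (1 + (1 + (1 + 0)))) ((2 * n + 3) + (1 + ((n + 1) + (1 + 0))))"
    unfolding insert_generator_def
    by (intro cost_bind cost_generator assms) (auto simp: cost_def comp_simps)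
  then show ?thesis by (rule cost_weaken) auto
qed

lemma result_insert_generator:
  "result (insert_generator n S j C gs ws) = (C @ [j], gs @ [result (generator n S j)], ws @ [0])"
  by (simp add: insert_generator_def)

lemma length_sparse_mult_trans [simp]: "length (result (sparse_mult_trans n S w)) = n"
proof -
  have 1: "length (foldl (\<lambda>u x. u[f x := g u x]) u xs) = length u" for u :: dense and f g and xs :: "(nat \<times> real) list"
    by (rule foldl_list_update_length)
  have "length (foldl (\<lambda>u y. foldl (\<lambda>u x. u[fst x := u ! fst x + snd x * snd y]) u (fst y)) u ys) = length u"
    for u :: dense and ys :: "((nat \<times> real) list \<times> real) list"
    by (induction ys arbitrary: u) (simp_all add: 1)
  then show ?thesis by (simp add: sparse_mult_trans_def case_prod_unfold)
qed

lemma sum_list_zip_le: "(\<Sum>x\<leftarrow>zip S w. f (fst x)) \<le> (\<Sum>x\<leftarrow>S. f x)" for f :: "'a \<Rightarrow> nat"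
proof (induction S arbitrary: w)
  case (Cons x S)
  then show ?case by (cases w) auto
qed simp

lemma cost_sparse_mult_trans: "cost (sparse_mult_trans n S w) (2 * n + length S + 4 * entries S + 1) (3 * n + 6)"
proof -
  have 1: "cost (foldC (\<lambda>u (j, a). do { p \<leftarrow> flop (a * b); q \<leftarrow> flop (u ! j + p); upd u j q }) u row) (4 * length row) (n + 3)"
    if "length u = n" for u row b
    by (rule cost_weaken[OF cost_foldC_const[where I = "\<lambda>u. length u = n" and b = "n + 1" and a = 3 and w = 2]])
      (auto simp: cost_def comp_simps that)
  have 2: "length (result (foldC (\<lambda>u (j, a). do { p \<leftarrow> flop (a * b); q \<leftarrow> flop (u ! j + p); upd u j q }) u row)) = length u" for u row b
    using foldl_list_update_length[of fst "\<lambda>u x. u ! fst x + snd x * b" u row] by (simp add: case_prod_unfold)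
  have "cost (foldC (\<lambda>u (row, b).
       foldC (\<lambda>u (j, a). do { p \<leftarrow> flop (a * b); q \<leftarrow> flop (u ! j + p); upd u j q }) u row)
       (replicate n 0) (zip S w)) (\<Sum>x\<leftarrow>zip S w. 1 + 4 * length (fst x)) ((n + 1) + (n + 3))"
    using 1 2 by (intro cost_foldC[where I = "\<lambda>u. length u = n"]) (auto simp: case_prod_unfold)
  then have "cost (foldC (\<lambda>u (row, b).
       foldC (\<lambda>u (j, a). do { p \<leftarrow> flop (a * b); q \<leftarrow> flop (u ! j + p); upd u j q }) u row)
       (replicate n 0) (zip S w)) (length S + 4 * entries S) ((n + 1) + (n + 3))"
    using sum_list_zip_le[of "\<lambda>row. 1 + 4 * length row" S w] unfolding sum_rows
    by (elim cost_weaken) simp_all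
  then have "cost (sparse_mult_trans n S w) ((2 * n + 1) + (length S + 4 * entries S)) ((n + 2) + ((n + 1) + (n + 3)))"
    unfolding sparse_mult_trans_def by (intro cost_bind[OF cost_zeros]) simp
  then show ?thesis by (rule cost_weaken) auto
qed

lemma result_accept:
  "result (accept n S C ws) = (result (scatter (replicate (length S + 1) 0) C ws),
     result (combine n S (result (scatter (replicate (length S + 1) 0) C ws))))"
  unfolding accept_def result_bind result_basic result_zeros ..

lemma accept_lengths:
  assumes "result (accept n S C ws) = (l, z)"
  shows "length l = length S + 1" "length z = n"
  using assms by (auto simp: result_accept combine_def)

lemma foldl_list_update_support:
  "{i. i < length u \<and> foldl (\<lambda>u x. u[fst x := snd x]) u xs ! i \<noteq> 0} \<subseteq> fst ` set xs \<union> {i. i < length u \<and> u ! i \<noteq> 0}"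
proof (induction xs arbitrary: u)
  case (Cons x xs)
  have "{i. i < length u \<and> u[fst x := snd x] ! i \<noteq> 0} \<subseteq> insert (fst x) {i. i < length u \<and> u ! i \<noteq> 0}"
    by (auto simp: nth_list_update)
  then show ?case using Cons.IH[of "u[fst x := snd x]"] by auto
qed simp

text \<open>Scattering touches only positions listed in the corral. This carries the corral bound
  over to the weights of all generators, and from there to the number of rows used in
  polishing.\<close>

lemma accept_support:
  assumes "result (accept n S C ws) = (l, z)"
  shows "card {i. i < length l \<and> l ! i \<noteq> 0} \<le> length C"
proof -
  define N where "N = length S + 1"
  have l: "l = foldl (\<lambda>u x. u[fst x := snd x]) (replicate N 0) (zip C ws)"
    using assms unfolding result_accept N_def by (simp add: result_scatter)
  have "{i. i < length l \<and> l ! i \<noteq> 0} \<subseteq> fst ` set (zip C ws)"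
    using foldl_list_update_support[of "replicate N 0" "zip C ws"] accept_lengths(1)[OF assms]
    unfolding N_def[symmetric] by (auto simp: l)
  also have "\<dots> \<subseteq> set C" by (auto dest: set_zip_leftD)
  finally have "card {i. i < length l \<and> l ! i \<noteq> 0} \<le> card (set C)" by (intro card_mono) auto
  then show ?thesis using card_length le_trans by blast
qed

lemma cost_accept:
  assumes "length C \<le> n + 1"
  shows "cost (accept n S C ws) (4 * n + 3 * length S + 4 * entries S + 6) (3 * n + 2 * length S + 12)"
proof -
  have "cost (accept n S C ws) ((2 * (length S + 1) + 1) + (2 * (n + 1) + ((2 * n + length S + 4 * entries S + 1) + 0)))
     (((length S + 1) + 2) + (((length S + 1) + 1) + ((3 * n + 6) + 0)))"
    unfolding accept_def combine_def
    by (intro cost_bind[OF cost_zeros] cost_bind cost_basic(1) cost_sparse_mult_trans)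
       (use cost_scatter[OF assms, of "replicate (length S + 1) 0" ws] in simp)
  then show ?thesis by (rule cost_weaken) auto
qed

section \<open>Outer test and verification\<close>

lemma cost_allC_test:
  assumes "\<And>x. cost (f x) 1 1" "length xs \<le> k"
  shows "cost (allC f xs) (3 * k) 3"
  by (rule cost_weaken[OF cost_allC[of xs f 1 1]]) (use assms in auto)

lemma cost_outer_test:
  assumes "length y \<le> n" "length c = n"
  shows "cost (outer_test c y z) (13 * n + 4) (2 * n + 15)"
proof -
  have "cost (outer_test c y z)
     (3 * n + max 0 ((2 * n + 1) + (3 * n + (1 + max 0 (3 * n + (1 + ((2 * n + 1) + 0)))))))
     (3 + max 0 ((n + 2) + (3 + (1 + max 0 (3 + (1 + ((n + 2) + 0)))))))"
    unfolding outer_test_def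
    by (intro cost_bind cost_if cost_basic cost_vec_sub cost_dot cost_scale cost_allC_test)
      (use assms in \<open>auto simp: cost_def comp_simps\<close>)
  then show ?thesis by (rule cost_weaken) auto
qed

lemma outer_test_lengths:
  "result (outer_test c y z) = Zero_value d \<Longrightarrow> length d \<le> length y"
  "result (outer_test c y z) = Next_target d h r y' \<Longrightarrow> length d \<le> length y \<and> length y' = length c"
  by (auto simp: outer_test_def Let_def split: if_splits)

lemma cost_check_optimal:
  assumes "length c = n" "length u \<le> length S"
  shows "cost (check_optimal S c x u) (8 * n + 10 * length S + 7 * entries S + 12) (3 * n + length S + 40)"
proof -
  have "cost (check_optimal S c x u)
     ((length S + 3 * entries S + 1) + (3 * length S + (3 * length S + ((2 * n + length S + 4 * entries S + 1) +
       (3 * n + (3 * n + (2 * length S + (1 + 4 * (0 + 2)))))))))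
     ((length S + 4) + (3 + (3 + ((3 * n + 6) + (3 + (3 + (2 + (1 + (0 + 2)))))))))"
    unfolding check_optimal_def
  proof (intro cost_bind cost_sparse_mult cost_allC_test cost_dot cost_vec_sum)
    show "cost (sparse_mult_trans (length c) S u) (2 * n + length S + 4 * entries S + 1) (3 * n + 6)"
      unfolding assms(1) by (rule cost_sparse_mult_trans)
  next
    fix b1 b2 b3 b4
    show "cost (allC ret [b1, b2, b3, b4]) (4 * (0 + 2)) (0 + 2)"
      by (rule cost_weaken[OF cost_allC[of "[b1, b2, b3, b4]" ret 0 0]]) (simp_all add: cost_def comp_simps)
  qed (use assms in \<open>auto simp: cost_def comp_simps\<close>)
  then show ?thesis by (rule cost_weaken) auto
qed

lemma cost_check_recession:
  assumes "length c = n"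
  shows "cost (check_recession S c d) (3 * n + 4 * length S + 3 * entries S + 3) (length S + 12)"
proof -
  have "cost (check_recession S c d) ((length S + 3 * entries S + 1) + (3 * length S + (3 * n + (1 + 1))))
     ((length S + 4) + (3 + (3 + (1 + 1))))"
    unfolding check_recession_def
    by (intro cost_bind cost_sparse_mult cost_allC_test cost_dot cost_basic) (use assms in auto)
  then show ?thesis by (rule cost_weaken) auto
qed

section \<open>Polishing and recovery of a finite solution\<close>

definition positions :: "dense \<Rightarrow> nat list comp" where
  "positions u = foldC (\<lambda>T (i, a). do { t \<leftarrow> test (a > 0); if t then push T i else ret T }) [] (zip [0..<length u] u)"

definition polish_candidates ::
  "sparse \<Rightarrow> dense \<Rightarrow> dense \<Rightarrow> dense \<Rightarrow> bool \<Rightarrow> nat list \<Rightarrow> dense list \<Rightarrow> dense list \<Rightarrow> (dense \<times> dense \<times> bool) comp" where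
  "polish_candidates S c x u ok T M Z = do {
     P \<leftarrow> mult_trans Z M;
     Zt \<leftarrow> transp (length c) Z;
     Q \<leftarrow> mult_trans M Zt;
     e \<leftarrow> ones (length T);
     x' \<leftarrow> mult_vec P e;
     w \<leftarrow> mult_vec Q c;
     u0 \<leftarrow> zeros (length S);
     u' \<leftarrow> scatter u0 T w;
     ok' \<leftarrow> check_optimal S c x' u';
     ret (if ok' then (x', u', ok') else (x, u, ok)) }"

lemma polish_eq:
  "polish S c x u ok = call (do {
     T \<leftarrow> positions u;
     M \<leftarrow> mapC (\<lambda>i. generator (length c) S (i + 1)) T;
     Mt \<leftarrow> transp (length c) M;
     N \<leftarrow> mult_trans Mt Mt;
     Z \<leftarrow> inverse_matrix N;
     (case Z of None \<Rightarrow> ret (x, u, ok) | Some Z \<Rightarrow> polish_candidates S c x u ok T M Z) })"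
  unfolding polish_def positions_def polish_candidates_def ..

lemma result_positions: "result (positions u) = map fst (filter (\<lambda>x. snd x > 0) (zip [0..<length u] u))"
proof -
  have "foldl (\<lambda>vs x. result (if snd x > 0 then push vs (fst x) else ret vs)) vs xs =
    vs @ map fst (filter (\<lambda>x. snd x > 0) xs)" for vs and xs :: "(nat \<times> real) list"
    by (induction xs arbitrary: vs) auto
  then show ?thesis by (simp add: positions_def case_prod_unfold)
qed

lemma set_positions: "set (result (positions u)) \<subseteq> {i. i < length u \<and> u ! i > 0}"
  by (auto simp: result_positions in_set_zip)

lemma length_positions: "length (result (positions u)) \<le> card {i. i < length u \<and> u ! i > 0}"
proof -
  have "distinct (result (positions u))"
    unfolding result_positions by (rule distinct_map_filter) simp
  then have "length (result (positions u)) = card (set (result (positions u)))" by (simp add: distinct_card)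
  also have "\<dots> \<le> card {i. i < length u \<and> u ! i > 0}" by (intro card_mono set_positions) simp
  finally show ?thesis .
qed

lemma cost_positions: "length u \<le> m \<Longrightarrow> cost (positions u) (3 * m) (m + 3)"
  unfolding positions_def
  by (rule cost_weaken[OF cost_foldC_count[where I = "\<lambda>i T. length T \<le> i" and b = "m + 1" and a = 2 and w = 2]])
    (auto simp: cost_def comp_simps case_prod_unfold)

lemma polish_candidates_lengths:
  assumes "result (polish_candidates S c x u ok T M Z) = (x', u', ok')"
  shows "length x' \<le> max (length x) (length Z)" "length u' \<le> max (length u) (length S)"
  using assms unfolding polish_candidates_def by (auto simp: Let_def split: if_splits)

lemma cost_polish_candidates:
  assumes "length c = n" and M: "shape t n M" and Z: "shape n n Z" and T: "length T = t" and t: "t \<le> n + 1"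
  shows "cost (polish_candidates S c x u ok T M Z)
     (100 * ((n + 1) * (n + 1) * (n + 1) + length S + entries S)) (100 * ((n + 1) * (n + 1) + length S))"
proof -
  define P where "P = result (mult_trans Z M)"
  define Zt where "Zt = result (transp (length c) Z)"
  define Q where "Q = result (mult_trans M Zt)"
  have sh: "shape n t P" "shape n n Zt" "shape t n Q"
    using M Z assms(1) by (auto simp: P_def Zt_def Q_def shape_def)
  have c1: "cost (mult_trans Z M) (n * ((n + 1) * (3 * n + 1) + 2) + 1) (n * ((n + 1) + 1) + (n + 1) + 5)"
    using shapeD[OF Z] shapeD[OF M] t by (intro cost_mult_trans) auto
  have c2: "cost (transp (length c) Z) (n * (2 * n + 2) + 1) (n * (n + 1) + n + 3)"
    unfolding assms(1) using shapeD[OF Z] by (intro cost_transp) auto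
  have c3: "cost (mult_trans M Zt) ((n + 1) * (n * (3 * n + 1) + 2) + 1) ((n + 1) * (n + 1) + n + 5)"
    using shapeD[OF M] shapeD[OF sh(2)] t by (intro cost_mult_trans) auto
  have c4: "cost (ones (length T)) (2 * (n + 1) + 1) ((n + 1) + 2)"
    using T t by (intro cost_weaken[OF cost_ones]) auto
  have c5: "cost (mult_vec P e) (n * (3 * (n + 1) + 1) + 1) (n + 4)" for e
    using shapeD[OF sh(1)] t by (intro cost_mult_vec) auto
  have c6: "cost (mult_vec Q c) ((n + 1) * (3 * n + 1) + 1) ((n + 1) + 4)"
    using shapeD[OF sh(3)] t by (intro cost_mult_vec) auto
  have c7: "cost (scatter (replicate (length S) 0) T w) (2 * (n + 1)) (length S + 1)" for w
    using cost_scatter[of T "n + 1" "replicate (length S) 0"] T t by simp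
  have "cost (polish_candidates S c x u ok T M Z)
    ((n * ((n + 1) * (3 * n + 1) + 2) + 1) + ((n * (2 * n + 2) + 1) + (((n + 1) * (n * (3 * n + 1) + 2) + 1)
       + ((2 * (n + 1) + 1) + ((n * (3 * (n + 1) + 1) + 1) + (((n + 1) * (3 * n + 1) + 1) + ((2 * length S + 1) + (2 * (n + 1)
       + ((8 * n + 10 * length S + 7 * entries S + 12) + 0)))))))))
    ((n * ((n + 1) + 1) + (n + 1) + 5) + ((n * (n + 1) + n + 3) + (((n + 1) * (n + 1) + n + 5)
       + (((n + 1) + 2) + ((n + 4) + (((n + 1) + 4) + ((length S + 2) + ((length S + 1)
       + ((3 * n + length S + 40) + 0)))))))))"
    unfolding polish_candidates_def
    by (rule cost_bind[OF c1], unfold P_def[symmetric], rule cost_bind[OF c2], unfold Zt_def[symmetric],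
        rule cost_bind[OF c3], unfold Q_def[symmetric], rule cost_bind[OF c4], rule cost_bind[OF c5],
        rule cost_bind[OF c6], rule cost_bind[OF cost_zeros], unfold result_zeros, rule cost_bind[OF c7],
        rule cost_bind[OF cost_check_optimal[OF assms(1)]], unfold length_scatter length_replicate, rule order_refl,
        rule cost_basic(1))
  then show ?thesis by (rule cost_weaken) (simp_all add: algebra_simps)
qed

lemma polish_shapes:
  assumes "length c = n"
  shows "shape (length T) n (result (mapC (\<lambda>i. generator (length c) S (i + 1)) T))"
    "shape n n (result (mult_trans (result (transp (length c) M)) (result (transp (length c) M))))"
  using assms by (auto simp: shape_def)

text \<open>As far as lengths are concerned there are two outcomes: the given endpoint is kept, or
  the result is built with an inverse of order \<open>length c\<close>. The lengths are needed
  because the result stays in the state.\<close>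

lemma result_polish_cases:
  obtains "result (polish S c x u ok) = (x, u, ok)"
  | T M Z where "result (polish S c x u ok) = result (polish_candidates S c x u ok T M Z)" "length Z = length c"
proof -
  define T where "T = result (positions u)"
  define M where "M = result (mapC (\<lambda>i. generator (length c) S (i + 1)) T)"
  define N where "N = result (mult_trans (result (transp (length c) M)) (result (transp (length c) M)))"
  have *: "result (polish S c x u ok) = result (case result (inverse_matrix N) of None \<Rightarrow> ret (x, u, ok)
    | Some Z \<Rightarrow> polish_candidates S c x u ok T M Z)"
    unfolding polish_eq result_bind result_basic T_def M_def N_def ..
  have N: "shape (length c) (length c) N" unfolding N_def by (rule polish_shapes) simp
  show ?thesis
  proof (cases "result (inverse_matrix N)")
    case None
    then show ?thesis using that(1) * by simp
  next
    case (Some Z)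
    then have "length Z = length c" using inverse_matrix_shape[OF N Some] by (simp add: shape_def)
    then show ?thesis using that(2)[of T M Z] * Some by simp
  qed
qed

lemma polish_lengths:
  assumes "result (polish S c x u ok) = (x', u', ok')" "length x \<le> length c" "length u \<le> length S"
  shows "length x' \<le> length c" "length u' \<le> length S"
  using assms by (atomize (full), cases rule: result_polish_cases[of S c x u ok])
    (use polish_candidates_lengths in fastforce)+

text \<open>At most \<open>n + 1\<close> rows have positive weight, so all dense matrices have both
  dimensions at most \<open>n + 1\<close>. Beyond linear work on vectors of length \<open>m\<close>,
  only the final verification uses the whole input.\<close>

lemma cost_polish:
  assumes c: "length c = n" "1 \<le> n" and S: "sparse_ok n S" and u: "length u \<le> length S" and x: "length x \<le> n"
    and T: "card {i. i < length u \<and> u ! i > 0} \<le> n + 1"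
  shows "cost (polish S c x u ok)
     (300 * ((n + 1) * (n + 1) * (n + 1) + length S + entries S)) (300 * ((n + 1) * (n + 1) + length S))"
proof -
  define T where "T = result (positions u)"
  define M where "M = result (mapC (\<lambda>i. generator (length c) S (i + 1)) T)"
  define Mt where "Mt = result (transp (length c) M)"
  define N where "N = result (mult_trans Mt Mt)"
  have T: "length T \<le> n + 1" using length_positions[of u] T unfolding T_def by simp
  have M: "shape (length T) n M" unfolding M_def by (rule polish_shapes[OF c(1)])
  have N: "shape n n N" unfolding N_def Mt_def by (rule polish_shapes[OF c(1)])
  have Mt: "shape n (length T) Mt" using M c by (simp add: Mt_def shape_def)
  have c2: "cost (mapC (\<lambda>i. generator (length c) S (i + 1)) T) ((n + 1) * (1 + (4 * n + 1)) + 1)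
     ((n + 1) * (n + 1) + max (2 * n + 3) (n + 1) + 1)"
  proof (intro cost_mapC_le T)
    fix i assume "i \<in> set T"
    then have "i + 1 \<le> length S" using set_positions[of u] u by (auto simp: T_def)
    then show "cost (generator (length c) S (i + 1)) (4 * n + 1) (2 * n + 3)" unfolding c(1) by (rule cost_generator[OF S])
  qed (simp add: c(1))
  have c3: "cost (transp (length c) M) (n * (2 * (n + 1) + 2) + 1) (n * ((n + 1) + 1) + (n + 1) + 3)"
    unfolding c(1) using shapeD(1)[OF M] T by (intro cost_transp) auto
  have c4: "cost (mult_trans Mt Mt) (n * (n * (3 * (n + 1) + 1) + 2) + 1) (n * (n + 1) + n + 5)"
    using shapeD[OF Mt] T by (intro cost_mult_trans) auto
  have c6: "cost (case result (inverse_matrix N) of None \<Rightarrow> ret (x, u, ok) | Some Z \<Rightarrow> polish_candidates S c x u ok T M Z)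
    (100 * ((n + 1) * (n + 1) * (n + 1) + length S + entries S)) (100 * ((n + 1) * (n + 1) + length S))"
    by (intro cost_case_option cost_weaken[OF cost_basic(1)] cost_polish_candidates[OF c(1) M inverse_matrix_shape[OF N] refl T]) auto
  obtain x' u' ok' where r: "result (polish S c x u ok) = (x', u', ok')" by (cases "result (polish S c x u ok)") auto
  have w: "words (result (polish S c x u ok)) \<le> (n + 1) + ((length S + 1) + 1)"
    using polish_lengths[OF r] x u c by (simp add: r)
  have "cost (polish S c x u ok)
    (3 * length S + (((n + 1) * (1 + (4 * n + 1)) + 1) + ((n * (2 * (n + 1) + 2) + 1) + ((n * (n * (3 * (n + 1) + 1) + 2) + 1)
       + (110 * (n * n * n) + 100 * ((n + 1) * (n + 1) * (n + 1) + length S + entries S))))))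
    (max ((length S + 3) + (((n + 1) * (n + 1) + max (2 * n + 3) (n + 1) + 1) + ((n * ((n + 1) + 1) + (n + 1) + 3) + ((n * (n + 1) + n + 5)
       + (110 * (n * n) + 100 * ((n + 1) * (n + 1) + length S)))))) ((n + 1) + ((length S + 1) + 1)))"
    unfolding polish_eq
    by (rule cost_call, rule cost_bind[OF cost_positions[OF u]], unfold T_def[symmetric], rule cost_bind[OF c2], unfold M_def[symmetric],
      rule cost_bind[OF c3], unfold Mt_def[symmetric], rule cost_bind[OF c4], unfold N_def[symmetric],
      rule cost_bind[OF cost_inverse_matrix[OF N c(2)]], rule c6,
      rule w[unfolded polish_eq result_basic T_def[symmetric] M_def[symmetric] Mt_def[symmetric] N_def[symmetric]])
  then show ?thesis by (rule cost_weaken) (simp_all add: algebra_simps)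
qed

lemma recover_finite_lengths:
  assumes "result (recover_finite pol S c r l d h) = (x, u, ok)" "length l = length S + 1" "length d \<le> length c"
  shows "length x \<le> length c" "length u \<le> length S"
  using assms polish_lengths[of S c "map (\<lambda>a. a / h) d" "map (\<lambda>a. a / r) (tl l)" _ x u ok]
  by (auto simp: recover_finite_def split: if_splits)

lemma cost_recover_finite:
  assumes c: "length c = n" "1 \<le> n" and S: "sparse_ok n S" and l: "length l = length S + 1" and d: "length d \<le> n"
    and support: "card {i. i < length l \<and> l ! i \<noteq> 0} \<le> n + 1"
  shows "cost (recover_finite pol S c r l d h)
     (400 * ((n + 1) * (n + 1) * (n + 1) + length S + entries S)) (400 * ((n + 1) * (n + 1) + length S))"
proof -
  define u where "u = map (\<lambda>a. a / r) (tl l)"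
  define x where "x = map (\<lambda>a. a / h) d"
  have u: "length u = length S" and x: "length x \<le> n" using l d by (auto simp: u_def x_def)
  \<comment> \<open>Removing the weight of the origin shifts indices by one. Counting nonzero rather
    than positive entries of \<open>l\<close> makes the inclusion independent of the sign of the
    divisor.\<close>
  have "Suc ` {i. i < length u \<and> u ! i > 0} \<subseteq> {i. i < length l \<and> l ! i \<noteq> 0}"
    using l by (auto simp: u_def nth_tl)
  then have "card (Suc ` {i. i < length u \<and> u ! i > 0}) \<le> card {i. i < length l \<and> l ! i \<noteq> 0}"
    by (intro card_mono) auto
  then have T: "card {i. i < length u \<and> u ! i > 0} \<le> n + 1" using support by (simp add: card_image)
  have c1: "cost (mapC (\<lambda>a. flop (a / r)) (tl l)) (length S * (1 + 1) + 1) (length S * 1 + max 1 1 + 1)"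
    using l by (intro cost_mapC_le) (auto simp: cost_def comp_simps)
  have c2: "cost (mapC (\<lambda>a. flop (a / h)) d) (n * (1 + 1) + 1) (n * 1 + max 1 1 + 1)"
    using d by (intro cost_mapC_le) (auto simp: cost_def comp_simps)
  have "cost (recover_finite pol S c r l d h)
    ((length S * (1 + 1) + 1) + ((n * (1 + 1) + 1) + ((8 * n + 10 * length S + 7 * entries S + 12)
      + max (300 * ((n + 1) * (n + 1) * (n + 1) + length S + entries S)) 0)))
    ((length S * 1 + max 1 1 + 1) + ((n * 1 + max 1 1 + 1) + ((3 * n + length S + 40)
      + max (300 * ((n + 1) * (n + 1) + length S)) 0)))"
    unfolding recover_finite_def
    by (rule cost_bind[OF c1], rule cost_bind[OF c2], unfold result_mapC result_basic, unfold u_def[symmetric] x_def[symmetric],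
        rule cost_bind[OF cost_check_optimal[OF c(1)]], simp add: u,
        intro cost_if cost_basic(1) cost_polish[OF c S _ x T]) (simp add: u)
  then show ?thesis by (rule cost_weaken) (simp_all add: algebra_simps)
qed

section \<open>Invariant of executions\<close>

text \<open>With \<open>n\<close> at least 1, additive constants can be charged to \<open>n\<close>;
  the size of the input cannot serve for this, since \<open>S\<close> may have no rows.\<close>

locale implementation =
  fixes n :: nat and S :: sparse and c :: dense
  assumes n: "1 \<le> n" and S: "sparse_ok n S" and c: "length c = n"
begin

definition input_size :: nat where
  "input_size = entries S + length S"

text \<open>Before the start the target is empty, hence inequalities for the lengths in general and
  an equality afterwards. The clause for \<open>Cold\<close> guarantees that a cold start is
  continued with the credit of a cold projection. Orthogonality is kept only in
  \<open>Major\<close>, where an insertion may follow.\<close>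

definition state_inv :: "state \<Rightarrow> bool" where
  "state_inv s \<longleftrightarrow> length (target s) \<le> n \<and> length (point s) \<le> n \<and> length (lam s) \<le> length S + 1 \<and>
     length (dir s) \<le> n \<and> length (primal s) \<le> n \<and> length (dual s) \<le> length S \<and>
     corral_ok n (corral s) (gens s) (wts s) \<and>
     (phase s \<noteq> Start \<longrightarrow> length (target s) = n) \<and>
     (phase s = Cold \<longrightarrow> \<not> warm s) \<and>
     (phase s = Major \<longrightarrow> length (point s) = n \<and>
        (\<forall>v\<in>set (gens s). inner n (map2 (-) (target s) (point s)) v = inner n (map2 (-) (target s) (point s)) (point s))) \<and>
     (phase s \<in> {Accepted, Finite} \<longrightarrow> length (lam s) = length S + 1 \<and>
        card {i. i < length (lam s) \<and> lam s ! i \<noteq> 0} \<le> n + 1)"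

text \<open>
  The potential of a state: what may still be spent before the next charge to \<open>work\<close>. The last summand is kept for the
  recovery of a solution; a warm projection also keeps the cost of a cold restart.
\<close>

definition credit :: "state \<Rightarrow> nat" where
  "credit s = (case phase s of
       Start \<Rightarrow> 2100 * n + 3 * input_size
     | Project \<Rightarrow> 2000 * n
     | Cold \<Rightarrow> 905 * n
     | Major \<Rightarrow> if warm s then 1900 * n else 900 * n
     | Affine \<Rightarrow> if warm s then 1800 * n else 800 * n
     | Accepted \<Rightarrow> 17 * n
     | Finite \<Rightarrow> 0
     | Unbounded \<Rightarrow> 6 * n
     | Stopped \<Rightarrow> 0) + (if phase s = Stopped then 0 else 3200 * (n * n * n) + 400 * input_size)"

text \<open>The expression bounded in the theorem. The 1 in \<open>passes g + 1\<close> together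
  with \<open>n ^ 3\<close> finances the credit of the initial state, including the reserve for
  recovery.\<close>

definition work :: "config \<Rightarrow> nat" where
  "work g = (passes g + 1) * input_size + (\<Sum>r\<leftarrow>solves g. n * r ^ 2 + r ^ 3) + outers g * n + n ^ 3"

definition config_inv :: "config \<Rightarrow> bool" where
  "config_inv g \<longleftrightarrow> state_inv (state g) \<and> (\<forall>r\<in>set (solves g). r \<le> n + 1) \<and>
     operations g + credit (state g) \<le> 10000 * work g \<and>
     storage g \<le> 10000 * (input_size + n * n)"

section \<open>Size of a state and the amortized rule for a transition\<close>

lemma words_sparse: "words S = length S + 2 * entries S + 1"
proof -
  have *: "words xs = 2 * length xs + 1" for xs :: "(nat \<times> real) list"
    by (induction xs) auto
  have "words X = length X + 2 * entries X + 1" for X :: sparse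
    by (induction X) (simp_all add: * entries_def)
  then show ?thesis .
qed

lemma n_le: "n \<le> n * n" "1 \<le> n * n"
  using n by auto

text \<open>The quadratic term stems from the generators held explicitly, at most
  \<open>n + 1\<close> of them with \<open>n\<close> entries each.\<close>

lemma state_words_le: "state_inv s \<Longrightarrow> input_words S c + state_words s \<le> 100 * (input_size + n * n)"
proof -
  assume s: "state_inv s"
  then have ok: "corral_ok n (corral s) (gens s) (wts s)" by (simp add: state_inv_def)
  have r: "length (gens s) \<le> n + 1" by (rule corral_ok_length[OF ok])
  have "words (gens s) \<le> (n + 1) * (n + 1) + 1"
    using ok r by (intro words_dense_list) (auto simp: corral_ok_def)
  then have g: "words (gens s) \<le> n * n + 2 * n + 2" by (simp add: algebra_simps)
  have "length (corral s) \<le> n + 1" "length (wts s) \<le> n + 1" using ok r by (auto simp: corral_ok_def)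
  moreover have "length (target s) \<le> n" "length (point s) \<le> n" "length (lam s) \<le> length S + 1"
    "length (dir s) \<le> n" "length (primal s) \<le> n" "length (dual s) \<le> length S"
    using s by (auto simp: state_inv_def)
  ultimately show ?thesis
    using g n_le c unfolding state_words_def input_words_def words_sparse input_size_def words_nats words_reals
    unfolding distrib_left by linarith
qed

lemma execute_inv:
  assumes g: "config_inv g" and g': "state g' = state g" "operations g' = operations g" "storage g' = storage g"
    and solves: "\<forall>r\<in>set (solves g'). r \<le> n + 1"
    and p: "cost p a w" "w \<le> 9000 * (input_size + n * n)"
    and s': "state_inv s'"
    and a: "a + credit s' + 10000 * work g \<le> credit (state g) + 10000 * work g'"
  shows "config_inv (execute S c p s' g')"
proof -
  have "work (execute S c p s' g') = work g'" by (simp add: work_def execute_def)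
  moreover have "operations (execute S c p s' g') = operations g + ops p" "state (execute S c p s' g') = s'"
    "solves (execute S c p s' g') = solves g'"
    by (simp_all add: execute_def g')
  moreover have "ops p \<le> a" using p by (simp add: cost_def)
  moreover have "storage (execute S c p s' g') \<le> 10000 * (input_size + n * n)"
  proof -
    have "peak p \<le> w" using p by (simp add: cost_def)
    moreover have "input_words S c + state_words (state g) \<le> 100 * (input_size + n * n)"
      using g by (intro state_words_le) (simp add: config_inv_def)
    ultimately have "input_words S c + state_words (state g) + peak p \<le> 10000 * (input_size + n * n)"
      using p(2) unfolding distrib_left by linarith
    moreover have "input_words S c + state_words s' \<le> 10000 * (input_size + n * n)"
      using state_words_le[OF s'] unfolding distrib_left by linarith
    moreover have "storage g \<le> 10000 * (input_size + n * n)" using g by (simp add: config_inv_def)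
    ultimately show ?thesis by (simp add: execute_def g')
  qed
  ultimately show ?thesis using g a s' solves unfolding config_inv_def by simp
qed

lemma config_invD:
  assumes "config_inv g"
  shows "state_inv (state g)" "\<forall>r\<in>set (solves g). r \<le> n + 1"
  using assms by (auto simp: config_inv_def)

lemma work_simps:
  "work (g\<lparr>passes := passes g + 1\<rparr>) = work g + input_size"
  "work (g\<lparr>solves := solves g @ [r]\<rparr>) = work g + (n * r ^ 2 + r ^ 3)"
  "work (g\<lparr>outers := outers g + 1\<rparr>) = work g + n"
  by (simp_all add: work_def algebra_simps)

text \<open>For positive \<open>r\<close> use \<open>r + 1 \<le> 2 * r\<close>. An empty corral
  contributes nothing to the sum, and \<open>2 * n\<close> covers its system of order 1.\<close>

lemma kkt_order_le: "(r + 1) * (r + 1) * (n + (r + 1)) \<le> 8 * (n * r ^ 2 + r ^ 3) + 2 * n"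
proof (cases r)
  case 0
  then show ?thesis using n by simp
next
  case (Suc q)
  then show ?thesis by (simp add: power2_eq_square power3_eq_cube algebra_simps)
qed

lemma kkt_order_le_pos: "r \<noteq> 0 \<Longrightarrow> (r + 1) * (r + 1) * (n + (r + 1)) \<le> 8 * (n * r ^ 2 + r ^ 3)"
  by (cases r) (simp_all add: power2_eq_square power3_eq_cube algebra_simps)

lemma n_le_order: "r \<noteq> 0 \<Longrightarrow> n \<le> n * r ^ 2 + r ^ 3"
  by (cases r) (simp_all add: power2_eq_square algebra_simps)

lemma kkt_storage_le: "r \<le> n + 1 \<Longrightarrow> (r + 1) * (n + (r + 1)) \<le> 12 * (n * n)"
proof -
  assume "r \<le> n + 1"
  \<comment> \<open>The factors are at most \<open>n + 2\<close> and \<open>2 * n + 2\<close>, and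
    \<open>n\<close> is at least 1.\<close>
  then have "(r + 1) * (n + (r + 1)) \<le> (3 * n) * (4 * n)" using n by (intro mult_mono) auto
  then show ?thesis by simp
qed

section \<open>Preservation of the invariant by each transition\<close>

lemma start_inv:
  assumes g: "config_inv g" and ph: "phase (state g) = Start" and y: "result (initial_target S c r) = (True, y)"
  shows "config_inv (execute S c (initial_target S c r) ((state g)\<lparr>phase := Project, rho := r, target := y\<rparr>) g)"
proof (rule execute_inv[OF g refl refl refl _ cost_initial_target[OF c]])
  show "n + length S + 10 \<le> 9000 * (input_size + n * n)" using n_le unfolding input_size_def unfolding distrib_left by linarith
  show "state_inv ((state g)\<lparr>phase := Project, rho := r, target := y\<rparr>)"
    using config_invD(1)[OF g] initial_target_length[OF y] c by (simp add: state_inv_def)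
  \<comment> \<open>The credit of \<open>Start\<close> exceeds that of \<open>Project\<close> by
    \<open>100 * n + 3 * input_size\<close>, which covers the scores of the objective.\<close>
  show "2 * n + 3 * length S + 3 * entries S + 6 + credit ((state g)\<lparr>phase := Project, rho := r, target := y\<rparr>) + 10000 * work g
    \<le> credit (state g) + 10000 * work g"
    using n by (simp add: credit_def ph input_size_def)
qed (rule config_invD(2)[OF g])

lemma project_inv:
  assumes g: "config_inv g" and ph: "phase (state g) = Project"
  shows "config_inv (execute S c (warm_start B (reuse (state g)) (iter (state g)))
    ((state g)\<lparr>phase := (if b then Affine else Cold), warm := b\<rparr>) g)"
proof (rule execute_inv[OF g refl refl refl _ cost_warm_start])
  show "4 \<le> 9000 * (input_size + n * n)" using n_le unfolding distrib_left by linarith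
  show "state_inv ((state g)\<lparr>phase := (if b then Affine else Cold), warm := b\<rparr>)"
    using config_invD(1)[OF g] by (simp add: state_inv_def ph)
  show "4 + credit ((state g)\<lparr>phase := (if b then Affine else Cold), warm := b\<rparr>) + 10000 * work g
    \<le> credit (state g) + 10000 * work g"
    using n by (simp add: credit_def ph)
qed (rule config_invD(2)[OF g])

lemma cold_start_inv:
  assumes g: "config_inv g" and ph: "phase (state g) = Cold" and i: "i \<le> length S"
  shows "config_inv (execute S c (generator (length c) S i) ((state g)\<lparr>phase := Major, point := result (generator (length c) S i),
    corral := [i], gens := [result (generator (length c) S i)], wts := [1]\<rparr>) g)"
  unfolding c
proof (rule execute_inv[OF g refl refl refl _ cost_generator[OF S i]])
  let ?s = "(state g)\<lparr>phase := Major, point := result (generator n S i),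
    corral := [i], gens := [result (generator n S i)], wts := [1]\<rparr>"
  show "2 * n + 3 \<le> 9000 * (input_size + n * n)" using n_le unfolding distrib_left by linarith
  show "state_inv ?s"
    using config_invD(1)[OF g] by (simp add: state_inv_def ph corral_ok_def aff_indep_singleton)
  \<comment> \<open>The difference between 905 and 900 pays for it:
    \<open>4 * n + 1 \<le> 5 * n\<close>.\<close>
  show "4 * n + 1 + credit ?s + 10000 * work g \<le> credit (state g) + 10000 * work g"
    using n config_invD(1)[OF g] by (simp add: credit_def ph state_inv_def)
qed (rule config_invD(2)[OF g])

lemma major_insert_inv:
  assumes g: "config_inv g" and ph: "phase (state g) = Major"
    and v: "v = violators S (target (state g)) (point (state g))" and j: "j \<in> set (result v)"
    and p: "p = insert_generator (length c) S j (corral (state g)) (gens (state g)) (wts (state g))"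
    and r: "result p = (C', gs', ws')"
  shows "config_inv (execute S c (bind_comp v (\<lambda>_. p))
    ((state g)\<lparr>phase := Affine, corral := C', gens := gs', wts := ws'\<rparr>) (g\<lparr>passes := passes g + 1\<rparr>))"
proof -
  let ?s = "(state g)\<lparr>phase := Affine, corral := C', gens := gs', wts := ws'\<rparr>"
  let ?d = "map2 (-) (target (state g)) (point (state g))"
  note s = config_invD(1)[OF g]
  have len: "length (target (state g)) = n" "length (point (state g)) = n" using s ph by (auto simp: state_inv_def)
  have ok: "corral_ok n (corral (state g)) (gens (state g)) (wts (state g))" using s by (simp add: state_inv_def)
  have orth: "\<And>v. v \<in> set (gens (state g)) \<Longrightarrow> inner n ?d v = inner n ?d (point (state g))"
    using s ph by (auto simp: state_inv_def)
  note sound = violators_sound[OF S len j[unfolded v]]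
  have new: "C' = corral (state g) @ [j]" "gs' = gens (state g) @ [result (generator n S j)]" "ws' = wts (state g) @ [0]"
    using r by (auto simp: p result_insert_generator c)
  \<comment> \<open>The strict inequality also excludes that the vector is already present, possibly
    under another index.\<close>
  have "result (generator n S j) \<notin> set (gens (state g))" using sound(2) orth by auto
  moreover have "aff_indep n (insert (result (generator n S j)) (set (gens (state g))))"
    using ok sound(2) by (intro aff_indep_insert[where d = ?d and h = "inner n ?d (point (state g))"] orth) (auto simp: corral_ok_def)
  ultimately have ok': "corral_ok n C' gs' ws'" using ok by (simp add: corral_ok_def new)
  show ?thesis
  proof (rule execute_inv[OF g])
    show "cost (bind_comp v (\<lambda>_. p)) ((5 * n + 5 * length S + 3 * entries S + 10) + (4 * n + 4)) ((n + 3 * length S + 20) + (3 * n + 6))"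
      unfolding v p c using len by (intro cost_bind cost_violators cost_insert_generator[OF S sound(1)]) simp
    show "n + 3 * length S + 20 + (3 * n + 6) \<le> 9000 * (input_size + n * n)" using n_le unfolding input_size_def unfolding distrib_left by linarith
    show "state_inv ?s" using s ok' len by (simp add: state_inv_def)
    \<comment> \<open>Warm or cold, the credit falls by \<open>100 * n\<close> from
      \<open>Major\<close> to \<open>Affine\<close>; this pays for the terms free of the input size,
      and the new pass pays for the others.\<close>
    show "5 * n + 5 * length S + 3 * entries S + 10 + (4 * n + 4) + credit ?s + 10000 * work g
      \<le> credit (state g) + 10000 * work (g\<lparr>passes := passes g + 1\<rparr>)"
      using n unfolding work_simps by (simp add: credit_def ph input_size_def)
  qed (use config_invD(2)[OF g] in simp_all)
qed

lemma major_accept_inv: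
  assumes g: "config_inv g" and ph: "phase (state g) = Major"
    and v: "v = violators S (target (state g)) (point (state g))"
    and p: "p = accept (length c) S (corral (state g)) (wts (state g))"
    and r: "result p = (l, z)"
  shows "config_inv (execute S c (bind_comp v (\<lambda>_. p))
    ((state g)\<lparr>phase := Accepted, lam := l, point := z\<rparr>) (g\<lparr>passes := passes g + 1\<rparr>))"
proof -
  let ?s = "(state g)\<lparr>phase := Accepted, lam := l, point := z\<rparr>"
  note s = config_invD(1)[OF g]
  have len: "length (target (state g)) = n" using s ph by (auto simp: state_inv_def)
  have ok: "corral_ok n (corral (state g)) (gens (state g)) (wts (state g))" using s by (simp add: state_inv_def)
  have C: "length (corral (state g)) \<le> n + 1" using corral_ok_length[OF ok] ok by (simp add: corral_ok_def)
  note r' = r[unfolded p c]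
  have new: "length l = length S + 1" "length z = n" "card {i. i < length l \<and> l ! i \<noteq> 0} \<le> n + 1"
    using accept_lengths[OF r'] accept_support[OF r'] C by auto
  show ?thesis
  proof (rule execute_inv[OF g])
    show "cost (bind_comp v (\<lambda>_. p)) ((5 * n + 5 * length S + 3 * entries S + 10) + (4 * n + 3 * length S + 4 * entries S + 6))
       ((n + 3 * length S + 20) + (3 * n + 2 * length S + 12))"
      unfolding v p c using len by (intro cost_bind cost_violators cost_accept C) simp
    show "n + 3 * length S + 20 + (3 * n + 2 * length S + 12) \<le> 9000 * (input_size + n * n)" using n_le unfolding input_size_def unfolding distrib_left by linarith
    show "state_inv ?s" using s len new by (simp add: state_inv_def)
    show "5 * n + 5 * length S + 3 * entries S + 10 + (4 * n + 3 * length S + 4 * entries S + 6) + credit ?s + 10000 * work g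
      \<le> credit (state g) + 10000 * work (g\<lparr>passes := passes g + 1\<rparr>)"
      using n unfolding work_simps by (simp add: credit_def ph input_size_def)
  qed (use config_invD(2)[OF g] in simp_all)
qed

lemma affine_inv:
  assumes g: "config_inv g" and ph: "phase (state g) = Affine"
    and p: "p = corral_step (length c) est (corral (state g)) (gens (state g)) (wts (state g)) (target (state g)) (point (state g))"
    and r: "result p = Some (fin, C', gs', ws', z')"
  shows "config_inv (execute S c p
    ((state g)\<lparr>phase := (if fin then Major else Affine), corral := C', gens := gs', wts := ws', point := z'\<rparr>)
    (g\<lparr>solves := solves g @ [length (corral (state g))]\<rparr>))"
proof -
  let ?s = "(state g)\<lparr>phase := (if fin then Major else Affine), corral := C', gens := gs', wts := ws', point := z'\<rparr>"
  note s = config_invD(1)[OF g]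
  define k where "k = length (corral (state g))"
  have len: "length (target (state g)) = n" "length (point (state g)) \<le> n" using s ph by (auto simp: state_inv_def)
  have ok: "corral_ok n (corral (state g)) (gens (state g)) (wts (state g))" using s by (simp add: state_inv_def)
  have k: "length (gens (state g)) = k" "k \<le> n + 1" using corral_ok_length[OF ok] ok by (auto simp: corral_ok_def k_def)
  note new = corral_step_ok[OF ok len(1) r[unfolded p c]]
  have "k \<noteq> 0" using new(1) k(1) by auto
  show ?thesis
  proof (rule execute_inv[OF g])
    show "cost p (400 * ((k + 1) * (k + 1) * (n + (k + 1)))) (400 * ((k + 1) * (n + (k + 1))))"
      unfolding p c by (rule cost_corral_step[OF ok]) (simp add: k)
    show "400 * ((k + 1) * (n + (k + 1))) \<le> 9000 * (input_size + n * n)" using kkt_storage_le[OF k(2)] unfolding distrib_left by linarith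
    show "state_inv ?s" using s ph len new(2-5) by (auto simp: state_inv_def)
    \<comment> \<open>The increase prepares the next full-row pass. It is charged to this solve,
      whose corral is nonempty.\<close>
    have "credit ?s \<le> credit (state g) + 100 * n" by (simp add: credit_def ph)
    then show "400 * ((k + 1) * (k + 1) * (n + (k + 1))) + credit ?s + 10000 * work g
      \<le> credit (state g) + 10000 * work (g\<lparr>solves := solves g @ [length (corral (state g))]\<rparr>)"
      using kkt_order_le_pos[OF \<open>k \<noteq> 0\<close>] n_le_order[OF \<open>k \<noteq> 0\<close>] unfolding work_simps k_def[symmetric] unfolding distrib_left by linarith
  qed (use config_invD(2)[OF g] k in \<open>simp_all add: k_def\<close>)
qed

text \<open>Common to a singular solve and to a warm exit after a condition estimate. Here the
  corral may be empty as far as the invariant knows, so the solve need not pay for itself.\<close>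

lemma affine_fail_inv:
  assumes g: "config_inv g" and ph: "phase (state g) = Affine"
    and p: "cost p (400 * ((k + 1) * (k + 1) * (n + (k + 1)))) (400 * ((k + 1) * (n + (k + 1))))"
    and k: "k = length (corral (state g))"
  shows "config_inv (execute S c p
    (if warm (state g) then (state g)\<lparr>phase := Cold, warm := False, reuse := False\<rparr> else (state g)\<lparr>phase := Stopped\<rparr>)
    (g\<lparr>solves := solves g @ [length (corral (state g))]\<rparr>))"
proof -
  let ?s = "if warm (state g) then (state g)\<lparr>phase := Cold, warm := False, reuse := False\<rparr> else (state g)\<lparr>phase := Stopped\<rparr>"
  note s = config_invD(1)[OF g]
  have ok: "corral_ok n (corral (state g)) (gens (state g)) (wts (state g))" using s by (simp add: state_inv_def)
  have k': "k \<le> n + 1" using corral_ok_length[OF ok] ok by (auto simp: corral_ok_def k)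
  show ?thesis
  proof (rule execute_inv[OF g _ _ _ _ p])
    show "400 * ((k + 1) * (n + (k + 1))) \<le> 9000 * (input_size + n * n)" using kkt_storage_le[OF k'] unfolding distrib_left by linarith
    show "state_inv ?s" using s ph by (auto simp: state_inv_def)
    \<comment> \<open>The factor is 400 times the 2 in \<open>kkt_order_le\<close>. A warm
      projection releases the difference of 1800 and 905, a cold one releases everything.\<close>
    have "credit ?s + 800 * n \<le> credit (state g)" by (simp add: credit_def ph)
    then show "400 * ((k + 1) * (k + 1) * (n + (k + 1))) + credit ?s + 10000 * work g
      \<le> credit (state g) + 10000 * work (g\<lparr>solves := solves g @ [length (corral (state g))]\<rparr>)"
      using kkt_order_le[of k] unfolding work_simps k[symmetric] unfolding distrib_left by linarith
  qed (use config_invD(2)[OF g] k k' in simp_all)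
qed

lemma affine_singular_inv:
  assumes g: "config_inv g" and ph: "phase (state g) = Affine"
    and p: "p = corral_step (length c) est (corral (state g)) (gens (state g)) (wts (state g)) (target (state g)) (point (state g))"
  shows "config_inv (execute S c p
    (if warm (state g) then (state g)\<lparr>phase := Cold, warm := False, reuse := False\<rparr> else (state g)\<lparr>phase := Stopped\<rparr>)
    (g\<lparr>solves := solves g @ [length (corral (state g))]\<rparr>))"
proof (rule affine_fail_inv[OF g ph _ refl])
  have ok: "corral_ok n (corral (state g)) (gens (state g)) (wts (state g))" using config_invD(1)[OF g] by (simp add: state_inv_def)
  then show "cost p (400 * ((length (corral (state g)) + 1) * (length (corral (state g)) + 1) * (n + (length (corral (state g)) + 1))))
     (400 * ((length (corral (state g)) + 1) * (n + (length (corral (state g)) + 1))))"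
    unfolding p c by (intro cost_corral_step) (simp_all add: corral_ok_def)
qed

lemma warm_exit_estimate_inv:
  assumes g: "config_inv g" and ph: "phase (state g) = Affine" and w: "warm (state g)"
  shows "config_inv (execute S c (affine_estimate (gens (state g))) ((state g)\<lparr>phase := Cold, warm := False, reuse := False\<rparr>)
    (g\<lparr>solves := solves g @ [length (corral (state g))]\<rparr>))"
proof -
  have ok: "corral_ok n (corral (state g)) (gens (state g)) (wts (state g))" using config_invD(1)[OF g] by (simp add: state_inv_def)
  define k where "k = length (corral (state g))"
  have "cost (affine_estimate (gens (state g))) (300 * ((k + 1) * (k + 1) * (n + (k + 1)))) (300 * ((k + 1) * (k + 1)))"
    using ok by (intro cost_affine_estimate) (auto simp: corral_ok_def k_def)
  then have "cost (affine_estimate (gens (state g))) (400 * ((k + 1) * (k + 1) * (n + (k + 1)))) (400 * ((k + 1) * (n + (k + 1))))"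
    by (rule cost_weaken) (simp_all add: algebra_simps)
  from affine_fail_inv[OF g ph this k_def] show ?thesis using w by simp
qed

lemma warm_exit_inv:
  assumes g: "config_inv g" and ph: "phase (state g) \<in> {Major, Affine}" and w: "warm (state g)"
  shows "config_inv (execute S c tick ((state g)\<lparr>phase := Cold, warm := False, reuse := False\<rparr>) g)"
proof (rule execute_inv[OF g refl refl refl _ cost_basic(4)])
  let ?s = "(state g)\<lparr>phase := Cold, warm := False, reuse := False\<rparr>"
  show "state_inv ?s" using config_invD(1)[OF g] ph by (auto simp: state_inv_def)
  \<comment> \<open>The warm credits 1900 and 1800 both contain the 905 of the cold restart.\<close>
  show "1 + credit ?s + 10000 * work g \<le> credit (state g) + 10000 * work g"
    using ph w n by (auto simp: credit_def)
qed (use config_invD(2)[OF g] in simp_all)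

text \<open>One argument for all three results of the outer test: the largest subsequent credit is
  the \<open>2000 * n\<close> of \<open>Project\<close>, and a completed iteration raises
  \<open>work\<close> by \<open>n\<close>, hence the available budget by
  \<open>10000 * n\<close>.\<close>

lemma outer_inv:
  assumes g: "config_inv g" and ph: "phase (state g) = Accepted" and s': "state_inv s'"
    and cr: "credit s' \<le> 3200 * (n * n * n) + 400 * input_size + 2000 * n"
  shows "config_inv (execute S c (outer_test c (target (state g)) (point (state g))) s' (g\<lparr>outers := outers g + 1\<rparr>))"
proof (rule execute_inv[OF g _ _ _ _ cost_outer_test[OF _ c] _ s'])
  show "length (target (state g)) \<le> n" using config_invD(1)[OF g] by (simp add: state_inv_def)
  show "2 * n + 15 \<le> 9000 * (input_size + n * n)" using n_le unfolding distrib_left by linarith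
  have "3200 * (n * n * n) + 400 * input_size \<le> credit (state g)" by (simp add: credit_def ph)
  then show "13 * n + 4 + credit s' + 10000 * work g \<le> credit (state g) + 10000 * work (g\<lparr>outers := outers g + 1\<rparr>)"
    using n cr unfolding work_simps unfolding distrib_left by linarith
qed (use config_invD(2)[OF g] in simp_all)

lemma finite_inv:
  assumes g: "config_inv g" and ph: "phase (state g) = Finite"
    and r: "result (recover_finite pol S c (rho (state g)) (lam (state g)) (dir (state g)) (hval (state g))) = (x, u, ok)"
  shows "config_inv (execute S c (recover_finite pol S c (rho (state g)) (lam (state g)) (dir (state g)) (hval (state g)))
    ((state g)\<lparr>phase := Stopped, primal := x, dual := u, verified := ok\<rparr>) g)"
proof -
  note s = config_invD(1)[OF g]
  let ?s = "(state g)\<lparr>phase := Stopped, primal := x, dual := u, verified := ok\<rparr>"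
  have l: "length (lam (state g)) = length S + 1" and d: "length (dir (state g)) \<le> n"
    and support: "card {i. i < length (lam (state g)) \<and> lam (state g) ! i \<noteq> 0} \<le> n + 1"
    using s ph by (auto simp: state_inv_def)
  show ?thesis
  proof (rule execute_inv[OF g refl refl refl _ cost_recover_finite[OF c n S l d support]])
    have "(n + 1) * (n + 1) \<le> (2 * n) * (2 * n)" "(n + 1) * (n + 1) * (n + 1) \<le> (2 * n) * (2 * n) * (2 * n)"
      \<comment> \<open>From \<open>n + 1 \<le> 2 * n\<close> come the factors 4 and 8; the latter,
        times the 400 of the recovery cost, is the reserve of 3200 carried by every unfinished
        state.\<close>
      using n by (intro mult_mono; simp)+
    then have *: "(n + 1) * (n + 1) \<le> 4 * (n * n)" "(n + 1) * (n + 1) * (n + 1) \<le> 8 * (n * n * n)" by simp_all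
    show "400 * ((n + 1) * (n + 1) + length S) \<le> 9000 * (input_size + n * n)" using * unfolding input_size_def unfolding distrib_left by linarith
    show "state_inv ?s" using s ph recover_finite_lengths[OF r l] d c by (auto simp: state_inv_def)
    have "credit ?s = 0" "credit (state g) = 3200 * (n * n * n) + 400 * input_size" by (simp_all add: credit_def ph)
    then show "400 * ((n + 1) * (n + 1) * (n + 1) + length S + entries S) + credit ?s + 10000 * work g
      \<le> credit (state g) + 10000 * work g"
      using * unfolding input_size_def unfolding distrib_left by linarith
  qed (rule config_invD(2)[OF g])
qed

lemma unbounded_inv:
  assumes g: "config_inv g" and ph: "phase (state g) = Unbounded"
  shows "config_inv (execute S c (check_recession S c (dir (state g))) ((state g)\<lparr>phase := Stopped, verified := b\<rparr>) g)"
proof (rule execute_inv[OF g refl refl refl _ cost_check_recession[OF c]])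
  let ?s = "(state g)\<lparr>phase := Stopped, verified := b\<rparr>"
  show "length S + 12 \<le> 9000 * (input_size + n * n)" using n_le unfolding input_size_def unfolding distrib_left by linarith
  show "state_inv ?s" using config_invD(1)[OF g] by (simp add: state_inv_def ph)
  show "3 * n + 4 * length S + 3 * entries S + 3 + credit ?s + 10000 * work g \<le> credit (state g) + 10000 * work g"
    using n by (simp add: credit_def ph input_size_def)
qed (rule config_invD(2)[OF g])

lemma step_inv: "step S c B g g' \<Longrightarrow> config_inv g \<Longrightarrow> config_inv g'"
proof (induction rule: step.induct)
  case start
  then show ?case using start_inv by simp
next
  case project
  then show ?case using project_inv by simp
next
  case cold_start
  then show ?case using cold_start_inv by simp
next
  case major_insert
  then show ?case using major_insert_inv by simp
next
  case major_accept
  then show ?case using major_accept_inv by simp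
next
  case affine
  then show ?case using affine_inv by simp
next
  case affine_singular
  then show ?case by (simp only: affine_singular_inv)
next
  case warm_exit
  then show ?case using warm_exit_inv by simp
next
  case warm_exit_estimate
  then show ?case using warm_exit_estimate_inv by simp
next
  case (stop_finite s g p)
  then have "state_inv (s\<lparr>phase := Finite\<rparr>)" using config_invD(1)[of g] by (auto simp: state_inv_def)
  then show ?case using stop_finite outer_inv[of g "s\<lparr>phase := Finite\<rparr>"] by (simp add: credit_def)
next
  case (stop_unbounded s g p d)
  then have "state_inv (s\<lparr>phase := Unbounded, dir := d, hval := 0\<rparr>)"
    using config_invD(1)[of g] outer_test_lengths(1)[of c "target s" "point s" d] by (simp add: state_inv_def)
  then show ?case using stop_unbounded outer_inv[of g "s\<lparr>phase := Unbounded, dir := d, hval := 0\<rparr>"] by (simp add: credit_def)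
next
  case (next_target s g p d h r y)
  then have "state_inv (s\<lparr>phase := Project, iter := iter s + 1, rho := r, target := y, dir := d, hval := h\<rparr>)"
    using config_invD(1)[of g] outer_test_lengths(2)[of c "target s" "point s" d h r y] c by (simp add: state_inv_def)
  then show ?case
    using next_target outer_inv[of g "s\<lparr>phase := Project, iter := iter s + 1, rho := r, target := y, dir := d, hval := h\<rparr>"]
    by (simp add: credit_def)
next
  case finite
  then show ?case using finite_inv by simp
next
  case unbounded
  then show ?case using unbounded_inv by simp
qed

lemma initial_inv: "config_inv (initial S c)"
proof -
  have s: "state_inv (state (initial S c))"
    by (simp add: initial_def Let_def state_inv_def corral_ok_def aff_indep_def)
  moreover have "storage (initial S c) = input_words S c + state_words (state (initial S c))"
    by (simp add: initial_def Let_def)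
  then have "storage (initial S c) \<le> 10000 * (input_size + n * n)" using state_words_le[OF s] unfolding distrib_left by linarith
  \<comment> \<open>The credit \<open>2100 * n\<close> of the start has no linear counterpart in
    \<open>work\<close> before the first outer iteration, so it is charged to the cubic
    term.\<close>
  moreover have "n \<le> n ^ 3" "n * n * n = n ^ 3" using n by (auto simp: power3_eq_cube)
  ultimately show ?thesis
    by (simp add: config_inv_def credit_def work_def) (simp add: initial_def Let_def)
qed

lemma reachable_inv: "(step S c B)\<^sup>*\<^sup>* (initial S c) g \<Longrightarrow> config_inv g"
  by (induction rule: rtranclp_induct) (auto intro: initial_inv step_inv)

end

section \<open>The bounds for a matrix and its stored rows\<close>

lemma sparse_rows_ok: "sparse_ok (dim_col A) (sparse_rows A)"
  by (auto simp: sparse_ok_def sparse_rows_def comp_def)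

lemma length_sparse_rows: "length (sparse_rows A) = dim_row A"
  by (simp add: sparse_rows_def)

text \<open>\<open>execution\<close> is reachability, so the bounds hold after every finite prefix
  of a run and for all choices left open by the method. The constant is fixed before the data, as
  the order notation demands.\<close>

theorem proposition1:
  "\<exists>K::nat. \<forall>(A::real mat) (c::real vec) (B::nat) (g::config).
     dim_vec c = dim_col A \<longrightarrow> sqrt (c \<bullet> c) = 1 \<longrightarrow> 1 \<le> B \<longrightarrow> execution A c B g \<longrightarrow>
     (let m = dim_row A; n = dim_col A; G = passes g; H = length (solves g); r = (\<lambda>h. solves g ! h) in
        (\<forall>h<H. r h \<le> n + 1) \<and>
        operations g \<le> K * ((G + 1) * (nnz A + m) + (\<Sum>h<H. n * r h ^ 2 + r h ^ 3)
                             + outers g * n + n ^ 3) \<and>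
        storage g \<le> K * (nnz A + m + n ^ 2))"
proof (intro exI allI impI)
  fix A :: "real mat" and c :: "real vec" and B :: nat and g :: config
  assume dim: "dim_vec c = dim_col A" and norm: "sqrt (c \<bullet> c) = 1" and exec: "execution A c B g"
  \<comment> \<open>The normalization of the objective enters only here: a vector without entries
    has norm zero.\<close>
  have "dim_col A \<noteq> 0"
  proof
    assume "dim_col A = 0"
    then have "c \<bullet> c = 0" using dim by (simp add: scalar_prod_def)
    then show False using norm by simp
  qed
  then interpret implementation "dim_col A" "sparse_rows A" "list_of_vec c"
    by unfold_locales (use dim in \<open>auto simp: sparse_rows_ok\<close>)
  have g: "config_inv g" using reachable_inv[OF exec[unfolded execution_def]] .
  have size: "input_size = nnz A + dim_row A" by (simp add: input_size_def length_sparse_rows nnz_def entries_def)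
  have "(\<Sum>r\<leftarrow>solves g. dim_col A * r ^ 2 + r ^ 3) = (\<Sum>h<length (solves g). dim_col A * (solves g ! h) ^ 2 + (solves g ! h) ^ 3)"
    by (simp add: sum_list_sum_nth atLeast0LessThan)
  moreover have "operations g \<le> 10000 * work g" using g by (simp add: config_inv_def)
  moreover have "storage g \<le> 10000 * (nnz A + dim_row A + dim_col A ^ 2)"
    using g by (simp add: config_inv_def size power2_eq_square)
  moreover have "\<forall>h<length (solves g). solves g ! h \<le> dim_col A + 1" using config_invD(2)[OF g] by simp
  ultimately show "let m = dim_row A; n = dim_col A; G = passes g; H = length (solves g); r = (\<lambda>h. solves g ! h) in
        (\<forall>h<H. r h \<le> n + 1) \<and>
        operations g \<le> 10000 * ((G + 1) * (nnz A + m) + (\<Sum>h<H. n * r h ^ 2 + r h ^ 3)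
                             + outers g * n + n ^ 3) \<and>
        storage g \<le> 10000 * (nnz A + m + n ^ 2)"
    unfolding Let_def work_def size by simp
qed

end
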